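(* Suppose that (A1) $(\mathbf y_p^\top A_p\mathbf y_p-\mathrm{tr}(\Sigma_p A_p))/p\to 0$ in probability as $p\to\infty$ for all sequences of real symmetric positive semi-definite $p\times p$ matrices $A_p$ with uniformly bounded spectral norms $\|A_p\|$; (A2) $\mathrm{tr}(\Sigma_p^2)/p^2\to 0$ in probability as $p\to\infty$; (A6) $\big(\|\mathbb E\mathbf y_p\mathbf y_p^\top\|+\|\mathbb E\Sigma_p\|\big)\,\mathrm{tr}\big(\mathbb E\mathbf y_p\mathbf y_p^\top+\mathbb E\Sigma_p\big)=o(p^2)$ as $p\to\infty$. Let $m$ be a fixed natural number, and for each $n\ge1$ let $L_n=(l_{kj})_{k,j=1}^n$ be a lower triangular $m$-banded real $n\times n$ matrix, i.e. its entries $l_{kj}=l_{kj}(n)$ are zero when $j\le k-m$ or $j>k$. Suppose the entries of $L_n$ are uniformly bounded over $n$. Then for all $z\in\mathbb C^+$, $$p^{-1}\mathrm{tr}\big(n^{-1}\mathbf Y_{pn}L_n^\top L_n\mathbf Y_{pn}^\top-zI_p\big)^{-1}-p^{-1}\mathrm{tr}\big(n^{-1}\mathbf Z_{pn}L_n^\top L_n\mathbf Z_{pn}^\top-zI_p\big)^{-1}\to 0\quad\text{almost surely}$$ as $n\to\infty$, where $p=p(n)$ is such that $p/n\to y$ for some $y>0$.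
   Context: For each $p\ge 1$, $\mathbf y_p$ is a random vector in $\mathbb R^p$ and $\Sigma_p$ is a random symmetric positive semi-definite $p\times p$ matrix defined on the same probability space; the entries of $\mathbf y_p\mathbf y_p^\top$ and $\Sigma_p$ have finite expectations. $\mathbf z_p=\Sigma_p^{1/2}\mathbf w_p$, where $\Sigma_p^{1/2}$ is the principal square root of $\Sigma_p$ and $\mathbf w_p$ is a standard normal vector in $\mathbb R^p$ independent of $\Sigma_p$. $\mathbf Y_{pn}$ is a $p\times n$ random matrix whose columns are independent copies of $\mathbf y_p$, and $\mathbf Z_{pn}$ is a $p\times n$ random matrix whose columns are independent copies of $\mathbf z_p$ (all matrices, over all $n$, are defined on a common probability space). $\|\cdot\|$ is the spectral norm, $I_p$ the $p\times p$ identity matrix, $\mathbb C^+=\{w\in\mathbb C:\mathrm{Im}(w)>0\}$, and $\mathrm{tr}(M)^{-1}$ denotes the trace of $M^{-1}$. *)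

theory Defs
  imports
    "HOL-Probability.Probability"
    "Jordan_Normal_Form.Gauss_Jordan_Elimination"
begin

unbundle no vec_syntax
unbundle no inner_syntax

definition mat_trace :: "'a::comm_monoid_add mat \<Rightarrow> 'a" where
  "mat_trace A = (\<Sum>i<dim_row A. A $$ (i, i))"

definition sym_mat :: "nat \<Rightarrow> real mat \<Rightarrow> bool" where
  "sym_mat n A \<longleftrightarrow> A \<in> carrier_mat n n \<and> A\<^sup>T = A"

definition sym_psd_mat :: "nat \<Rightarrow> real mat \<Rightarrow> bool" where
  "sym_psd_mat n A \<longleftrightarrow> sym_mat n A \<and> (\<forall>v\<in>carrier_vec n. 0 \<le> v \<bullet> (A *\<^sub>v v))"

text \<open>The spectral norm as the operator norm for the Euclidean norm \<open>sqrt (v \<bullet> v)\<close>.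
  Taking the closed unit ball instead of the unit sphere keeps the index set nonempty
  in dimension 0.\<close>

definition spectral_norm :: "real mat \<Rightarrow> real" where
  "spectral_norm A =
     (SUP v\<in>{v \<in> carrier_vec (dim_col A). v \<bullet> v \<le> 1}. sqrt ((A *\<^sub>v v) \<bullet> (A *\<^sub>v v)))"

text \<open>Principal square root: the unique symmetric positive semi-definite square root.
  Only meaningful for symmetric positive semi-definite arguments.\<close>

definition psd_sqrt :: "real mat \<Rightarrow> real mat" where
  "psd_sqrt S = (THE R. sym_psd_mat (dim_row S) R \<and> R * R = S)"

text \<open>\<open>mat_inverse\<close> returns an option; \<open>S - zI\<close> is invertible whenever \<open>S\<close> is real symmetric
  and \<open>z\<close> is not real.\<close>

definition trace_resolvent :: "real mat \<Rightarrow> complex \<Rightarrow> complex" where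
  "trace_resolvent S z =
     mat_trace (the (mat_inverse (map_mat complex_of_real S - z \<cdot>\<^sub>m 1\<^sub>m (dim_row S))))"

text \<open>The Borel sigma-algebras of \<open>\<real>\<^sup>n\<close> and \<open>\<real>\<^bsup>n\<times>k\<^esup>\<close>, transported from the product
  sigma-algebra on coordinates (only the measurable space structure is used).\<close>

definition vec_borel :: "nat \<Rightarrow> real vec measure" where
  "vec_borel n = vimage_algebra (carrier_vec n)
     (\<lambda>v. \<lambda>i\<in>{..<n}. v $ i) (\<Pi>\<^sub>M i\<in>{..<n}. borel)"

definition mat_borel :: "nat \<Rightarrow> nat \<Rightarrow> real mat measure" where
  "mat_borel n k = vimage_algebra (carrier_mat n k)
     (\<lambda>A. \<lambda>ij\<in>{..<n} \<times> {..<k}. A $$ ij) (\<Pi>\<^sub>M ij\<in>{..<n} \<times> {..<k}. borel)"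

definition mat_expectation :: "nat \<Rightarrow> 'a measure \<Rightarrow> ('a \<Rightarrow> real mat) \<Rightarrow> real mat" where
  "mat_expectation n M X = mat n n (\<lambda>ij. integral\<^sup>L M (\<lambda>\<omega>. X \<omega> $$ ij))"

definition outer_prod :: "real vec \<Rightarrow> real mat" where
  "outer_prod v = mat (dim_vec v) (dim_vec v) (\<lambda>(i, j). v $ i * v $ j)"

definition integrable_mat :: "nat \<Rightarrow> 'a measure \<Rightarrow> ('a \<Rightarrow> real mat) \<Rightarrow> bool" where
  "integrable_mat n M X \<longleftrightarrow> (\<forall>i<n. \<forall>j<n. integrable M (\<lambda>\<omega>. X \<omega> $$ (i, j)))"

definition std_normal_vec :: "nat \<Rightarrow> 'a measure \<Rightarrow> ('a \<Rightarrow> real vec) \<Rightarrow> bool" where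
  "std_normal_vec n M w \<longleftrightarrow>
     w \<in> measurable M (vec_borel n) \<and>
     prob_space.indep_vars M (\<lambda>_. borel) (\<lambda>i \<omega>. w \<omega> $ i) {..<n} \<and>
     (\<forall>i<n. distributed M lborel (\<lambda>\<omega>. w \<omega> $ i) std_normal_density)"

text \<open>The library's \<open>indep_var\<close> forces both random variables to have the same value type.\<close>

definition indep_rv ::
  "'a measure \<Rightarrow> 'b measure \<Rightarrow> ('a \<Rightarrow> 'b) \<Rightarrow> 'c measure \<Rightarrow> ('a \<Rightarrow> 'c) \<Rightarrow> bool" where
  "indep_rv M A X B Y \<longleftrightarrow>
     X \<in> measurable M A \<and> Y \<in> measurable M B \<and>
     prob_space.indep_set M {X -` S \<inter> space M | S. S \<in> sets A} {Y -` S \<inter> space M | S. S \<in> sets B}"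

text \<open>\<open>X\<close> is a random matrix on \<open>N\<close> whose \<open>n\<close> columns are independent and each distributed
  as the random vector \<open>x\<close> of \<open>\<real>\<^sup>p\<close>, which lives on a possibly different space \<open>M\<close>.\<close>

definition iid_columns ::
  "nat \<Rightarrow> nat \<Rightarrow> 'b measure \<Rightarrow> ('b \<Rightarrow> real mat) \<Rightarrow> 'a measure \<Rightarrow> ('a \<Rightarrow> real vec) \<Rightarrow> bool" where
  "iid_columns p n N X M x \<longleftrightarrow>
     X \<in> measurable N (mat_borel p n) \<and>
     prob_space.indep_vars N (\<lambda>_. vec_borel p) (\<lambda>j \<omega>. col (X \<omega>) j) {..<n} \<and>
     (\<forall>j<n. distr N (vec_borel p) (\<lambda>\<omega>. col (X \<omega>) j) = distr M (vec_borel p) x)"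

text \<open>The random variables \<open>X p\<close> may live on different probability spaces \<open>M p\<close>.\<close>

definition tendsto_0_in_prob :: "(nat \<Rightarrow> 'a measure) \<Rightarrow> (nat \<Rightarrow> 'a \<Rightarrow> real) \<Rightarrow> bool" where
  "tendsto_0_in_prob M X \<longleftrightarrow>
     (\<forall>\<epsilon>>0. (\<lambda>p. measure (M p) {\<omega> \<in> space (M p). \<epsilon> < \<bar>X p \<omega>\<bar>}) \<longlonglongrightarrow> 0)"

definition lower_banded :: "nat \<Rightarrow> nat \<Rightarrow> real mat \<Rightarrow> bool" where
  "lower_banded m n L \<longleftrightarrow> L \<in> carrier_mat n n \<and>
     (\<forall>k<n. \<forall>j<n. j + m \<le> k \<or> k < j \<longrightarrow> L $$ (k, j) = 0)"

end

theory Submission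
  imports Defs
    "Jordan_Normal_Form.Determinant"
    "HOL-Computational_Algebra.Formal_Power_Series"
    "HOL-Probability.Hoeffding"
begin

text \<open>
  Completing the square in one column of the data matrix exhibits \<open>n\<inverse> Y L\<^sup>T L Y\<^sup>T\<close> as a
  positive semi-definite matrix not depending on that column plus a rank-one matrix \<open>x x\<^sup>T\<close>, where
  \<open>x = \<beta> y\<^sub>j + \<alpha>\<close> and \<open>\<alpha>\<close> is a combination of at most \<open>2m\<close> other columns. By Sherman--Morrison the
  trace of the resolvent changes by \<open>- N(x) / D(x)\<close> with \<open>\<bar>N\<bar> \<le> \<bar>D\<bar> / Im \<zeta>\<close> and
  \<open>\<bar>D\<bar> \<ge> Im \<zeta> / \<bar>\<zeta>\<bar>\<close>. Hence the trace has bounded differences in the columns and concentrates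
  exponentially around its mean, which reduces the claim to the means.

  The means are compared by a Lindeberg exchange of the columns. Exchanging \<open>y\<close> for \<open>z\<close> in one column
  alters \<open>N\<close> and \<open>D\<close> by \<open>\<beta>\<^sup>2 (y\<^sup>TAy - z\<^sup>TAz)\<close> and by terms \<open>\<beta> (A\<alpha>)\<^sup>Ty\<close>, \<open>\<beta> (A\<alpha>)\<^sup>Tz\<close>, for real symmetric
  \<open>A\<close> of bounded norm. Both quadratic forms are close to \<open>tr(\<Sigma>A)\<close>: for \<open>y\<close> by (A1), and for \<open>z\<close> by (A2)
  and the variance of a Gaussian quadratic form. The linear terms are negligible by (A6).
\<close>

section \<open>Measurability of vectors and matrices; resolvents\<close>

text \<open>The trace is divided by \<open>p\<close> and \<open>n\<close> columns are exchanged,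
  with \<open>n\<close> of the order of \<open>p\<close>, so one exchange may cost only o(1). With
  the factor 1/n spread over the coefficients, \<beta>^2 is of order at most 1/n, and (A1) makes
  \<beta>^2 (y^T A y - z^T A z) small, but only in probability. This suffices because one column
  never changes the trace by more than 2 / Im \<zeta>, so an event of small probability costs
  little. The matrices \<open>A\<close> depend on the other columns, whereas (A1) speaks of
  deterministic sequences. With the other columns frozen \<open>A\<close> is fixed, and uniformity
  over all \<open>A\<close> of bounded norm is gained from (A1) by testing it on a worst matrix in
  each dimension. The product in (A6) has the same origin: for frozen \<alpha> the mean of ((A
  \<alpha>)^T y)^2 is at most C^2 ||E y y^T|| |\<alpha>|^2, and the mean of |\<alpha>|^2 is of order
  at most tr(E y y^T + E \<Sigma>) / n, the neighbouring columns being of either kind during the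
  exchange. Together with \<beta>^2 this leaves the product in (A6) divided by n^2.\<close>

lemma measurable_vec_borel_iff:
  "f \<in> measurable M (vec_borel n) \<longleftrightarrow>
     f \<in> space M \<rightarrow> carrier_vec n \<and> (\<forall>i<n. (\<lambda>x. f x $ i) \<in> borel_measurable M)"
proof safe
  assume f: "f \<in> measurable M (vec_borel n)"
  then show "f x \<in> carrier_vec n" if "x \<in> space M" for x
    using that measurable_space[OF f] by (auto simp: vec_borel_def)
  have "(\<lambda>v. \<lambda>i\<in>{..<n}. v $ i) \<in> measurable (vec_borel n) (\<Pi>\<^sub>M i\<in>{..<n}. (borel :: real measure))"
    unfolding vec_borel_def by (rule measurable_vimage_algebra1) (auto simp: space_PiM)
  from measurable_compose[OF f this]
  have g: "(\<lambda>x. \<lambda>i\<in>{..<n}. f x $ i) \<in> measurable M (\<Pi>\<^sub>M i\<in>{..<n}. borel)" .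
  fix i assume "i < n"
  with measurable_compose[OF g measurable_component_singleton[of i "{..<n}"]]
  show "(\<lambda>x. f x $ i) \<in> borel_measurable M" by simp
next
  assume "f \<in> space M \<rightarrow> carrier_vec n" "\<forall>i<n. (\<lambda>x. f x $ i) \<in> borel_measurable M"
  then show "f \<in> measurable M (vec_borel n)"
    unfolding vec_borel_def by (intro measurable_vimage_algebra2 measurable_restrict) auto
qed

lemma measurable_mat_borel_iff:
  "f \<in> measurable M (mat_borel n k) \<longleftrightarrow>
     f \<in> space M \<rightarrow> carrier_mat n k \<and> (\<forall>i<n. \<forall>j<k. (\<lambda>x. f x $$ (i, j)) \<in> borel_measurable M)"
proof safe
  assume f: "f \<in> measurable M (mat_borel n k)"
  then show "f x \<in> carrier_mat n k" if "x \<in> space M" for x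
    using that measurable_space[OF f] by (auto simp: mat_borel_def)
  have "(\<lambda>A. \<lambda>ij\<in>{..<n} \<times> {..<k}. A $$ ij)
      \<in> measurable (mat_borel n k) (\<Pi>\<^sub>M ij\<in>{..<n} \<times> {..<k}. (borel :: real measure))"
    unfolding mat_borel_def by (rule measurable_vimage_algebra1) (auto simp: space_PiM)
  from measurable_compose[OF f this]
  have g: "(\<lambda>x. \<lambda>ij\<in>{..<n} \<times> {..<k}. f x $$ ij) \<in> measurable M (\<Pi>\<^sub>M ij\<in>{..<n} \<times> {..<k}. borel)" .
  fix i j assume "i < n" "j < k"
  with measurable_compose[OF g measurable_component_singleton[of "(i, j)" "{..<n} \<times> {..<k}"]]
  show "(\<lambda>x. f x $$ (i, j)) \<in> borel_measurable M" by simp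
next
  assume "f \<in> space M \<rightarrow> carrier_mat n k" "\<forall>i<n. \<forall>j<k. (\<lambda>x. f x $$ (i, j)) \<in> borel_measurable M"
  then show "f \<in> measurable M (mat_borel n k)"
    unfolding mat_borel_def by (intro measurable_vimage_algebra2 measurable_restrict) auto
qed

lemma space_vec_borel [simp]: "space (vec_borel n) = carrier_vec n"
  by (simp add: vec_borel_def)

lemma space_mat_borel [simp]: "space (mat_borel n k) = carrier_mat n k"
  by (simp add: mat_borel_def)

lemma measurable_vec_index [measurable (raw)]:
  "f \<in> measurable M (vec_borel n) \<Longrightarrow> i < n \<Longrightarrow> (\<lambda>x. f x $ i) \<in> borel_measurable M"
  by (simp add: measurable_vec_borel_iff)

lemma measurable_mat_index [measurable (raw)]:
  "f \<in> measurable M (mat_borel n k) \<Longrightarrow> i < n \<Longrightarrow> j < k \<Longrightarrow>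
     (\<lambda>x. f x $$ (i, j)) \<in> borel_measurable M"
  by (simp add: measurable_mat_borel_iff)

section \<open>Coordinate formulas for products and quadratic forms\<close>

lemma scalar_prod_sum:
  "w \<in> carrier_vec n \<Longrightarrow> v \<bullet> w = (\<Sum>i<n. v $ i * w $ i)"
  by (auto simp: scalar_prod_def atLeast0LessThan)

lemma scalar_prod_self_nonneg: "0 \<le> v \<bullet> (v :: real vec)"
  by (simp add: scalar_prod_def sum_nonneg)

lemma mult_mat_vec_sum:
  "A \<in> carrier_mat n k \<Longrightarrow> v \<in> carrier_vec k \<Longrightarrow> i < n \<Longrightarrow>
     (A *\<^sub>v v) $ i = (\<Sum>j<k. A $$ (i, j) * v $ j)"
  by (auto simp: scalar_prod_def atLeast0LessThan intro!: sum.cong)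

lemma mult_mat_sum:
  "A \<in> carrier_mat n k \<Longrightarrow> B \<in> carrier_mat k l \<Longrightarrow> i < n \<Longrightarrow> j < l \<Longrightarrow>
     (A * B) $$ (i, j) = (\<Sum>a<k. A $$ (i, a) * B $$ (a, j))"
  by (auto simp: scalar_prod_def atLeast0LessThan intro!: sum.cong)

lemma quad_form_sum:
  fixes A :: "'a::comm_semiring_0 mat"
  assumes "A \<in> carrier_mat n n" "v \<in> carrier_vec n" "w \<in> carrier_vec n"
  shows "v \<bullet> (A *\<^sub>v w) = (\<Sum>i<n. \<Sum>j<n. A $$ (i, j) * (v $ i * w $ j))"
proof -
  have "v \<bullet> (A *\<^sub>v w) = (\<Sum>i<n. v $ i * (A *\<^sub>v w) $ i)"
    using assms by (intro scalar_prod_sum) auto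
  also have "\<dots> = (\<Sum>i<n. \<Sum>j<n. A $$ (i, j) * (v $ i * w $ j))"
    using assms by (intro sum.cong refl)
      (simp add: mult_mat_vec_sum sum_distrib_left algebra_simps del: index_mult_mat_vec)
  finally show ?thesis .
qed

section \<open>The resolvent of a real symmetric positive semi-definite matrix\<close>

definition shifted :: "real mat \<Rightarrow> complex \<Rightarrow> complex mat" where
  "shifted S \<zeta> = map_mat complex_of_real S - \<zeta> \<cdot>\<^sub>m 1\<^sub>m (dim_row S)"

definition resolvent :: "real mat \<Rightarrow> complex \<Rightarrow> complex mat" where
  "resolvent S \<zeta> = the (mat_inverse (shifted S \<zeta>))"

lemma sym_psd_matD:
  assumes "sym_psd_mat p S"
  shows "S \<in> carrier_mat p p" "\<And>i j. i < p \<Longrightarrow> j < p \<Longrightarrow> S $$ (i, j) = S $$ (j, i)"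
    "\<And>v. v \<in> carrier_vec p \<Longrightarrow> 0 \<le> v \<bullet> (S *\<^sub>v v)"
proof -
  show c: "S \<in> carrier_mat p p" using assms by (auto simp: sym_psd_mat_def sym_mat_def)
  have "S\<^sup>T = S" using assms by (auto simp: sym_psd_mat_def sym_mat_def)
  then show "S $$ (i, j) = S $$ (j, i)" if "i < p" "j < p" for i j
    using that c index_transpose_mat(1)[of i S j] by auto
  show "\<And>v. v \<in> carrier_vec p \<Longrightarrow> 0 \<le> v \<bullet> (S *\<^sub>v v)"
    using assms by (auto simp: sym_psd_mat_def)
qed

lemma shifted_carrier [simp]: "S \<in> carrier_mat p p \<Longrightarrow> shifted S \<zeta> \<in> carrier_mat p p"
  by (auto simp: shifted_def)

lemma shifted_index:
  "S \<in> carrier_mat p p \<Longrightarrow> i < p \<Longrightarrow> j < p \<Longrightarrow>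
     shifted S \<zeta> $$ (i, j) = complex_of_real (S $$ (i, j)) - (if i = j then \<zeta> else 0)"
  by (auto simp: shifted_def)

text \<open>With u = r + i t the form of the real symmetric \<open>S\<close> splits as r^T S r + t^T
  S t, the cross terms cancelling by symmetry. So \<open>a\<close> is nonnegative, and only the
  multiple of |u|^2 carries an imaginary part.\<close>

lemma shifted_hermitian_form:
  assumes S: "sym_psd_mat p S" and u: "u \<in> carrier_vec p"
  obtains a where "0 \<le> a"
    "(\<Sum>i<p. cnj (u $ i) * (shifted S \<zeta> *\<^sub>v u) $ i) =
       complex_of_real a - \<zeta> * complex_of_real (\<Sum>i<p. (cmod (u $ i))\<^sup>2)"
proof -
  note Sc = sym_psd_matD(1)[OF S]
  define r where "r i = Re (u $ i)" for i
  define t where "t i = Im (u $ i)" for i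
  define s where "s i j = S $$ (i, j)" for i j
  define a where "a = (\<Sum>i<p. \<Sum>j<p. s i j * (r i * r j)) + (\<Sum>i<p. \<Sum>j<p. s i j * (t i * t j))"
  have "0 \<le> (\<Sum>i<p. \<Sum>j<p. s i j * (f i * f j))" for f :: "nat \<Rightarrow> real"
    using sym_psd_matD(3)[OF S, of "vec p f"] by (simp add: quad_form_sum[OF Sc] s_def)
  then have "0 \<le> a" unfolding a_def by (intro add_nonneg_nonneg)
  have uc: "u $ i = Complex (r i) (t i)" for i by (simp add: r_def t_def)
  have split: "(\<Sum>j<p. (complex_of_real (s i j) - (if i = j then \<zeta> else 0)) * u $ j)
      = (\<Sum>j<p. complex_of_real (s i j) * u $ j) - \<zeta> * u $ i" if "i < p" for i
    using that by (simp add: left_diff_distrib sum_subtractf if_distrib[of "\<lambda>x. x * _"] cong: if_cong)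
  have "(\<Sum>i<p. cnj (u $ i) * (shifted S \<zeta> *\<^sub>v u) $ i)
      = (\<Sum>i<p. cnj (u $ i) * ((\<Sum>j<p. complex_of_real (s i j) * u $ j) - \<zeta> * u $ i))"
  proof (intro sum.cong refl)
    fix i assume "i \<in> {..<p}"
    then have i: "i < p" by simp
    have "(shifted S \<zeta> *\<^sub>v u) $ i = (\<Sum>j<p. (complex_of_real (s i j) - (if i = j then \<zeta> else 0)) * u $ j)"
      unfolding s_def mult_mat_vec_sum[OF shifted_carrier[OF Sc] u i]
      using i by (intro sum.cong refl) (simp add: shifted_index[OF Sc])
    then show "cnj (u $ i) * (shifted S \<zeta> *\<^sub>v u) $ i
        = cnj (u $ i) * ((\<Sum>j<p. complex_of_real (s i j) * u $ j) - \<zeta> * u $ i)"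
      by (simp only: split[OF i])
  qed
  also have "\<dots> = (\<Sum>i<p. \<Sum>j<p. complex_of_real (s i j) * (cnj (u $ i) * u $ j))
      - \<zeta> * (\<Sum>i<p. cnj (u $ i) * u $ i)"
    by (simp add: right_diff_distrib sum_subtractf sum_distrib_left algebra_simps)
  also have "(\<Sum>i<p. cnj (u $ i) * u $ i) = complex_of_real (\<Sum>i<p. (cmod (u $ i))\<^sup>2)"
    unfolding of_real_sum by (intro sum.cong refl, subst complex_norm_square) (rule mult.commute)
  also have "(\<Sum>i<p. \<Sum>j<p. complex_of_real (s i j) * (cnj (u $ i) * u $ j)) = complex_of_real a"
  proof (rule complex_eqI)
    show "Re (\<Sum>i<p. \<Sum>j<p. complex_of_real (s i j) * (cnj (u $ i) * u $ j)) = Re (complex_of_real a)"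
      by (simp add: a_def r_def t_def sum.distrib[symmetric] algebra_simps)
    have "(\<Sum>i<p. \<Sum>j<p. s i j * (r i * t j)) = (\<Sum>j<p. \<Sum>i<p. s i j * (r i * t j))"
      by (rule sum.swap)
    also have "\<dots> = (\<Sum>i<p. \<Sum>j<p. s i j * (t i * r j))"
      using sym_psd_matD(2)[OF S] by (intro sum.cong refl) (auto simp: s_def)
    finally show "Im (\<Sum>i<p. \<Sum>j<p. complex_of_real (s i j) * (cnj (u $ i) * u $ j)) = Im (complex_of_real a)"
      by (simp add: r_def t_def sum_subtractf right_diff_distrib)
  qed
  finally show thesis using that \<open>0 \<le> a\<close> by blast
qed

text \<open>A kernel vector \<open>u\<close> would make the Hermitian form vanish, but its imaginary
  part is - Im \<zeta> |u|^2. Injectivity gives a nonzero determinant, and then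
  \<open>mat_inverse\<close> cannot return \<open>None\<close>.\<close>

lemma resolvent_inverse:
  assumes S: "sym_psd_mat p S" and z: "0 < Im \<zeta>"
  shows "resolvent S \<zeta> \<in> carrier_mat p p" "shifted S \<zeta> * resolvent S \<zeta> = 1\<^sub>m p"
    "resolvent S \<zeta> * shifted S \<zeta> = 1\<^sub>m p" "Determinant.det (shifted S \<zeta>) \<noteq> 0"
proof -
  note Sc = sym_psd_matD(1)[OF S]
  have H: "shifted S \<zeta> \<in> carrier_mat p p" using Sc by simp
  have inj: "u = 0\<^sub>v p" if u: "u \<in> carrier_vec p" and 0: "shifted S \<zeta> *\<^sub>v u = 0\<^sub>v p" for u
  proof -
    from shifted_hermitian_form[OF S u, of \<zeta>] obtain a where
      "(\<Sum>i<p. cnj (u $ i) * (shifted S \<zeta> *\<^sub>v u) $ i) =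
       complex_of_real a - \<zeta> * complex_of_real (\<Sum>i<p. (cmod (u $ i))\<^sup>2)" by metis
    then have "Im (complex_of_real a - \<zeta> * complex_of_real (\<Sum>i<p. (cmod (u $ i))\<^sup>2)) = 0"
      unfolding 0 by (simp flip: \<open>_ = complex_of_real a - _\<close>)
    then have "(\<Sum>i<p. (cmod (u $ i))\<^sup>2) = 0" using z by simp
    then have "\<forall>i\<in>{..<p}. (cmod (u $ i))\<^sup>2 = 0" by (subst (asm) sum_nonneg_eq_0_iff) auto
    then show ?thesis using u by (intro eq_vecI) auto
  qed
  then show det: "Determinant.det (shifted S \<zeta>) \<noteq> 0" using det_0_iff_vec_prod_zero[OF H] by auto
  obtain B where B: "mat_inverse (shifted S \<zeta>) = Some B"
  proof (cases "mat_inverse (shifted S \<zeta>)")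
    case None
    from mat_inverse(1)[OF H None, where b = "()"] det_non_zero_imp_unit[OF H det, where b = "()"]
    show ?thesis by contradiction
  qed auto
  from mat_inverse(2)[OF H B] B
  show "resolvent S \<zeta> \<in> carrier_mat p p" "shifted S \<zeta> * resolvent S \<zeta> = 1\<^sub>m p"
    "resolvent S \<zeta> * shifted S \<zeta> = 1\<^sub>m p" by (auto simp: resolvent_def)
qed

lemma resolvent_unique:
  assumes S: "sym_psd_mat p S" and z: "0 < Im \<zeta>"
    and G: "G \<in> carrier_mat p p" "shifted S \<zeta> * G = 1\<^sub>m p"
  shows "resolvent S \<zeta> = G"
proof -
  note R = resolvent_inverse[OF S z]
  have H: "shifted S \<zeta> \<in> carrier_mat p p" using sym_psd_matD(1)[OF S] by simp
  have "resolvent S \<zeta> = resolvent S \<zeta> * (shifted S \<zeta> * G)" using R(1) G by simp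
  also have "\<dots> = (resolvent S \<zeta> * shifted S \<zeta>) * G" using R(1) G H by (simp add: assoc_mult_mat)
  also have "\<dots> = G" using R(3) G by simp
  finally show ?thesis .
qed

text \<open>The transpose is also a right inverse, as \<open>shifted\<close> is symmetric. The
  resolvent is symmetric but in general not Hermitian, so the forms x^T R x and x^T R^2 x used below
  carry no conjugation.\<close>

lemma resolvent_sym:
  assumes S: "sym_psd_mat p S" and z: "0 < Im \<zeta>"
  shows "(resolvent S \<zeta>)\<^sup>T = resolvent S \<zeta>"
proof -
  note R = resolvent_inverse[OF S z]
  have H: "shifted S \<zeta> \<in> carrier_mat p p" using sym_psd_matD(1)[OF S] by simp
  have "(shifted S \<zeta>)\<^sup>T = shifted S \<zeta>"
    using sym_psd_matD(2)[OF S] carrier_matD[OF H]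
    by (intro eq_matI) (auto simp: shifted_index[OF sym_psd_matD(1)[OF S]])
  then have "shifted S \<zeta> * (resolvent S \<zeta>)\<^sup>T = (resolvent S \<zeta> * shifted S \<zeta>)\<^sup>T"
    using R(1) H by (simp add: transpose_mult)
  then have "shifted S \<zeta> * (resolvent S \<zeta>)\<^sup>T = 1\<^sub>m p" using R(3) by simp
  from resolvent_unique[OF S z _ this] R(1) show ?thesis by simp
qed

text \<open>Everything about the size of the resolvent follows from this identity for \<open>u = R x\<close>.\<close>

lemma resolvent_form:
  assumes S: "sym_psd_mat p S" and z: "0 < Im \<zeta>" and x: "x \<in> carrier_vec p"
  obtains a where "0 \<le> a"
    "(\<Sum>i<p. cnj ((resolvent S \<zeta> *\<^sub>v x) $ i) * x $ i) =
       complex_of_real a - \<zeta> * complex_of_real (\<Sum>i<p. (cmod ((resolvent S \<zeta> *\<^sub>v x) $ i))\<^sup>2)"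
proof -
  note R = resolvent_inverse[OF S z]
  have H: "shifted S \<zeta> \<in> carrier_mat p p" using sym_psd_matD(1)[OF S] by simp
  have "shifted S \<zeta> *\<^sub>v (resolvent S \<zeta> *\<^sub>v x) = x"
    using R H x by (simp flip: assoc_mult_mat_vec)
  with shifted_hermitian_form[OF S mult_mat_vec_carrier[OF R(1) x], of \<zeta>] that
  show thesis by metis
qed

text \<open>The imaginary part of the identity for u = R x gives Im \<zeta> |u|^2 \<le> |u| |x|, and
  |u| cancels. Squares are kept on both sides to avoid roots.\<close>

lemma resolvent_norm_le:
  assumes S: "sym_psd_mat p S" and z: "0 < Im \<zeta>" and x: "x \<in> carrier_vec p"
  shows "(\<Sum>i<p. (cmod ((resolvent S \<zeta> *\<^sub>v x) $ i))\<^sup>2) * (Im \<zeta>)\<^sup>2 \<le> (\<Sum>i<p. (cmod (x $ i))\<^sup>2)"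
proof -
  define u where "u = resolvent S \<zeta> *\<^sub>v x"
  define s where "s = (\<Sum>i<p. (cmod (u $ i))\<^sup>2)"
  define t where "t = (\<Sum>i<p. (cmod (x $ i))\<^sup>2)"
  have st: "0 \<le> s" "0 \<le> t" unfolding s_def t_def by (auto intro: sum_nonneg)
  from resolvent_form[OF S z x] obtain a where
    a: "(\<Sum>i<p. cnj (u $ i) * x $ i) = complex_of_real a - \<zeta> * complex_of_real s"
    unfolding s_def u_def by metis
  have "s * Im \<zeta> = \<bar>Im (complex_of_real a - \<zeta> * complex_of_real s)\<bar>"
    using st z by (simp add: mult.commute)
  also have "\<dots> \<le> cmod (\<Sum>i<p. cnj (u $ i) * x $ i)" unfolding a by (rule abs_Im_le_cmod)
  also have "\<dots> \<le> (\<Sum>i<p. cmod (u $ i) * cmod (x $ i))"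
    by (rule order_trans[OF norm_sum]) (simp add: norm_mult)
  finally have "(s * Im \<zeta>)\<^sup>2 \<le> (\<Sum>i<p. cmod (u $ i) * cmod (x $ i))\<^sup>2"
    using st z by (intro power_mono) auto
  also have "\<dots> \<le> s * t" unfolding s_def t_def by (rule Cauchy_Schwarz_ineq_sum)
  finally have *: "s * (s * (Im \<zeta>)\<^sup>2) \<le> s * t" by (simp add: power2_eq_square algebra_simps)
  have "s * (Im \<zeta>)\<^sup>2 \<le> t"
  proof (cases "s = 0")
    case False
    with st * show ?thesis by (simp add: mult_le_cancel_left)
  qed (use st in simp)
  then show ?thesis by (simp add: s_def t_def u_def)
qed

section \<open>Rank-one perturbations\<close>

text \<open>With R the resolvent at \<zeta> this is x^T R^2 x, and \<open>rk_den\<close> is 1 + x^T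
  R x: the two parts of the Sherman-Morrison correction of the trace. Symmetry of R turns x^T R^2 x
  into the sum of the unconjugated squares of the entries of R x.\<close>

definition rk_num :: "real mat \<Rightarrow> complex \<Rightarrow> real vec \<Rightarrow> complex" where
  "rk_num S \<zeta> x = (\<Sum>i<dim_row S. ((resolvent S \<zeta> *\<^sub>v map_vec complex_of_real x) $ i)\<^sup>2)"

definition rk_den :: "real mat \<Rightarrow> complex \<Rightarrow> real vec \<Rightarrow> complex" where
  "rk_den S \<zeta> x = 1 + (\<Sum>i<dim_row S. complex_of_real (x $ i) *
     (resolvent S \<zeta> *\<^sub>v map_vec complex_of_real x) $ i)"

text \<open>Put s = |R x|^2 and let a \<ge> 0 be the form of \<open>S\<close> at R x; then the
  denominator is D = 1 + a - cnj \<zeta> s. Multiplying by \<zeta> makes the s term real, so Im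
  (\<zeta> D) = Im \<zeta> (1 + a) bounds |D| from below. Without that factor Im D = Im \<zeta> s,
  and the numerator is at most s.\<close>

lemma rk_bounds:
  assumes S: "sym_psd_mat p S" and z: "0 < Im \<zeta>" and x: "x \<in> carrier_vec p"
  shows "Im \<zeta> / cmod \<zeta> \<le> cmod (rk_den S \<zeta> x)" "cmod (rk_num S \<zeta> x) \<le> cmod (rk_den S \<zeta> x) / Im \<zeta>"
    "rk_den S \<zeta> x \<noteq> 0"
proof -
  have dim: "dim_row S = p" using sym_psd_matD(1)[OF S] by simp
  define cx where "cx = map_vec complex_of_real x"
  have cx: "cx \<in> carrier_vec p" using x by (simp add: cx_def)
  define u where "u = resolvent S \<zeta> *\<^sub>v cx"
  define s where "s = (\<Sum>i<p. (cmod (u $ i))\<^sup>2)"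
  have s: "0 \<le> s" unfolding s_def by (auto intro: sum_nonneg)
  from resolvent_form[OF S z cx] obtain a where a0: "0 \<le> a" and
    a: "(\<Sum>i<p. cnj (u $ i) * cx $ i) = complex_of_real a - \<zeta> * complex_of_real s"
    unfolding s_def u_def by metis
  have cxi: "cx $ i = complex_of_real (x $ i)" if "i < p" for i using that x by (simp add: cx_def)
  have "(\<Sum>i<p. complex_of_real (x $ i) * u $ i) = cnj (\<Sum>i<p. cnj (u $ i) * cx $ i)"
    by (simp add: cxi mult.commute)
  then have D: "rk_den S \<zeta> x = complex_of_real (1 + a) - cnj \<zeta> * complex_of_real s"
    unfolding rk_den_def dim u_def[symmetric] cx_def[symmetric] a by (simp add: u_def cx_def)
  have z0: "0 < cmod \<zeta>" using z by (auto simp: complex_eq_iff)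
  have "\<zeta> * rk_den S \<zeta> x = \<zeta> * complex_of_real (1 + a) - complex_of_real ((cmod \<zeta>)\<^sup>2) * complex_of_real s"
    unfolding D complex_norm_square by (simp add: algebra_simps)
  then have "Im (\<zeta> * rk_den S \<zeta> x) = Im \<zeta> * (1 + a)" by simp
  then have "Im \<zeta> \<le> \<bar>Im (\<zeta> * rk_den S \<zeta> x)\<bar>" using z a0 by simp
  also have "\<dots> \<le> cmod \<zeta> * cmod (rk_den S \<zeta> x)" by (metis abs_Im_le_cmod norm_mult)
  finally show 1: "Im \<zeta> / cmod \<zeta> \<le> cmod (rk_den S \<zeta> x)"
    using z0 by (simp add: field_simps)
  then show "rk_den S \<zeta> x \<noteq> 0" using z z0 by (metis divide_pos_pos norm_eq_zero not_le)
  have "Im (rk_den S \<zeta> x) = Im \<zeta> * s" unfolding D by simp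
  then have "Im \<zeta> * s \<le> cmod (rk_den S \<zeta> x)" by (metis abs_Im_le_cmod abs_le_D1)
  then have "s \<le> cmod (rk_den S \<zeta> x) / Im \<zeta>" using z by (simp add: field_simps)
  moreover have "cmod (rk_num S \<zeta> x) \<le> s"
    unfolding rk_num_def s_def dim u_def cx_def
    by (rule order_trans[OF norm_sum]) (simp add: norm_power)
  ultimately show "cmod (rk_num S \<zeta> x) \<le> cmod (rk_den S \<zeta> x) / Im \<zeta>" by simp
qed

lemma trace_resolvent_rank_one:
  assumes S0: "sym_psd_mat p S0" and S: "sym_psd_mat p S" and z: "0 < Im \<zeta>"
    and x: "x \<in> carrier_vec p"
    and eq: "\<And>i j. i < p \<Longrightarrow> j < p \<Longrightarrow> S $$ (i, j) = S0 $$ (i, j) + x $ i * x $ j"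
  shows "trace_resolvent S \<zeta> = trace_resolvent S0 \<zeta> - rk_num S0 \<zeta> x / rk_den S0 \<zeta> x"
proof -
  note S0c = sym_psd_matD(1)[OF S0] and Sc = sym_psd_matD(1)[OF S]
  have dim: "dim_row S0 = p" using S0c by simp
  define R where "R = resolvent S0 \<zeta>"
  note R = resolvent_inverse[OF S0 z, folded R_def]
  define cx where "cx = map_vec complex_of_real x"
  have cx: "cx \<in> carrier_vec p" using x by (simp add: cx_def)
  have cxi: "complex_of_real (x $ i) = cx $ i" if "i < p" for i using that x by (simp add: cx_def)
  define u where "u = R *\<^sub>v cx"
  have u: "u \<in> carrier_vec p" using R(1) cx by (simp add: u_def)
  define D where "D = rk_den S0 \<zeta> x"
  have D0: "D \<noteq> 0" using rk_bounds(3)[OF S0 z x] by (simp add: D_def)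
  have D1: "(\<Sum>k<p. cx $ k * u $ k) = D - 1"
    unfolding D_def rk_den_def dim u_def R_def by (simp add: cx_def[symmetric] cxi)
  have Rsym: "R $$ (i, j) = R $$ (j, i)" if "i < p" "j < p" for i j
    using resolvent_sym[OF S0 z] that R(1) index_transpose_mat(1)[of i R j] unfolding R_def by simp
  define H where "H = shifted S0 \<zeta>"
  have Hc: "H \<in> carrier_mat p p" using S0c by (simp add: H_def)
  have HR: "(\<Sum>k<p. H $$ (i, k) * R $$ (k, j)) = (if i = j then 1 else 0)" if "i < p" "j < p" for i j
    using mult_mat_sum[OF Hc R(1) that] R(2)[folded H_def] that by simp
  have "H *\<^sub>v u = cx" using R(1,2) Hc cx unfolding u_def H_def by (simp flip: assoc_mult_mat_vec)
  then have Hu: "(\<Sum>k<p. H $$ (i, k) * u $ k) = cx $ i" if "i < p" for i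
    using mult_mat_vec_sum[OF Hc u that] by simp
  have xR: "(\<Sum>k<p. cx $ k * R $$ (k, j)) = u $ j" if "j < p" for j
    unfolding u_def mult_mat_vec_sum[OF R(1) cx that] using that
    by (intro sum.cong refl) (simp add: Rsym[of j] mult.commute)
  \<comment> \<open>The Sherman-Morrison inverse with u = R x; the row x^T R is u^T because R is
    symmetric. Only the right-inverse identity is verified, \<open>resolvent_unique\<close> does the
    rest.\<close>
  define G where "G = mat p p (\<lambda>(i, j). R $$ (i, j) - u $ i * u $ j / D)"
  have Gc: "G \<in> carrier_mat p p" by (simp add: G_def)
  have "shifted S \<zeta> * G = 1\<^sub>m p"
  proof (rule eq_matI)
    fix i j assume "i < dim_row (1\<^sub>m p :: complex mat)" "j < dim_col (1\<^sub>m p :: complex mat)"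
    then have ij: "i < p" "j < p" by auto
    have "(shifted S \<zeta> * G) $$ (i, j) = (\<Sum>k<p. shifted S \<zeta> $$ (i, k) * G $$ (k, j))"
      by (rule mult_mat_sum[OF shifted_carrier[OF Sc] Gc ij])
    also have "\<dots> = (\<Sum>k<p. (H $$ (i, k) + cx $ i * cx $ k) * (R $$ (k, j) - u $ k * u $ j / D))"
      using ij by (intro sum.cong refl)
        (simp add: shifted_index[OF Sc] shifted_index[OF S0c] H_def eq G_def cxi)
    also have "\<dots> = (\<Sum>k<p. H $$ (i, k) * R $$ (k, j)) - (\<Sum>k<p. H $$ (i, k) * u $ k) * u $ j / D
        + cx $ i * (\<Sum>k<p. cx $ k * R $$ (k, j)) - cx $ i * (\<Sum>k<p. cx $ k * u $ k) * u $ j / D"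
      by (simp add: sum_distrib_left sum_distrib_right sum_divide_distrib sum.distrib[symmetric]
          sum_subtractf[symmetric] algebra_simps)
    also have "\<dots> = (if i = j then 1 else 0)"
      unfolding HR[OF ij] Hu[OF ij(1)] xR[OF ij(2)] D1 using D0 by (simp add: field_simps)
    finally show "(shifted S \<zeta> * G) $$ (i, j) = 1\<^sub>m p $$ (i, j)" using ij by simp
  qed (use Gc shifted_carrier[OF Sc] in auto)
  from resolvent_unique[OF S z Gc this] have "resolvent S \<zeta> = G" .
  then have "trace_resolvent S \<zeta> = mat_trace G"
    by (simp add: trace_resolvent_def resolvent_def shifted_def)
  also have "\<dots> = (\<Sum>i<p. R $$ (i, i) - u $ i * u $ i / D)" by (simp add: mat_trace_def G_def)
  also have "\<dots> = (\<Sum>i<p. R $$ (i, i)) - (\<Sum>i<p. (u $ i)\<^sup>2) / D"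
    by (simp add: sum_subtractf sum_divide_distrib power2_eq_square)
  also have "(\<Sum>i<p. R $$ (i, i)) = trace_resolvent S0 \<zeta>"
    using R(1) by (simp add: trace_resolvent_def resolvent_def shifted_def mat_trace_def R_def)
  also have "(\<Sum>i<p. (u $ i)\<^sup>2) = rk_num S0 \<zeta> x"
    by (simp add: rk_num_def dim u_def R_def cx_def)
  finally show ?thesis by (simp add: D_def)
qed

section \<open>Stability of the rank-one correction\<close>

text \<open>The operator norm bound is kept as a squared inequality, free of suprema;
  \<open>spectral_norm_le\<close> translates it when (A1) is applied.\<close>

definition bounded_sym :: "nat \<Rightarrow> real \<Rightarrow> real mat \<Rightarrow> bool" where
  "bounded_sym p C A \<longleftrightarrow> sym_mat p A \<and>
     (\<forall>v\<in>carrier_vec p. (A *\<^sub>v v) \<bullet> (A *\<^sub>v v) \<le> C\<^sup>2 * (v \<bullet> v))"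

definition qform :: "real mat \<Rightarrow> real vec \<Rightarrow> real" where
  "qform A x = x \<bullet> (A *\<^sub>v x)"

text \<open>The term a^T A a is common to both forms and cancels, so \<open>a\<close> enters only
  through the vector A a in the linear terms. Symmetry of \<open>A\<close> merges the two cross
  terms.\<close>

lemma qform_affine_diff:
  assumes A: "sym_mat p A" and y: "y \<in> carrier_vec p" and w: "w \<in> carrier_vec p"
    and a: "a \<in> carrier_vec p"
  shows "\<bar>qform A (\<beta> \<cdot>\<^sub>v y + a) - qform A (\<beta> \<cdot>\<^sub>v w + a)\<bar>
    \<le> \<beta>\<^sup>2 * \<bar>qform A y - qform A w\<bar> + 2 * \<bar>\<beta>\<bar> * (\<bar>(A *\<^sub>v a) \<bullet> y\<bar> + \<bar>(A *\<^sub>v a) \<bullet> w\<bar>)"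
proof -
  have Ac: "A \<in> carrier_mat p p" and At: "A\<^sup>T = A" using A by (auto simp: sym_mat_def)
  have sym: "A $$ (i, j) = A $$ (j, i)" if "i < p" "j < p" for i j
    using At that Ac index_transpose_mat(1)[of i A j] by simp
  have expand: "qform A (\<beta> \<cdot>\<^sub>v y + a) = \<beta>\<^sup>2 * qform A y + 2 * \<beta> * ((A *\<^sub>v a) \<bullet> y) + qform A a"
    if y: "y \<in> carrier_vec p" for y
  proof -
    have 1: "(A *\<^sub>v a) \<bullet> y = (\<Sum>i<p. \<Sum>j<p. A $$ (i, j) * (y $ i * a $ j))"
      using quad_form_sum[OF Ac y a] comm_scalar_prod[of y p "A *\<^sub>v a"] Ac y a by auto
    also have "\<dots> = (\<Sum>j<p. \<Sum>i<p. A $$ (i, j) * (y $ i * a $ j))" by (rule sum.swap)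
    also have "\<dots> = (\<Sum>i<p. \<Sum>j<p. A $$ (i, j) * (a $ i * y $ j))"
      using sym by (intro sum.cong refl) (simp add: mult.commute)
    finally have 2: "(A *\<^sub>v a) \<bullet> y = (\<Sum>i<p. \<Sum>j<p. A $$ (i, j) * (a $ i * y $ j))" .
    have "qform A (\<beta> \<cdot>\<^sub>v y + a) = (\<Sum>i<p. \<Sum>j<p. A $$ (i, j) *
        ((\<beta> * y $ i + a $ i) * (\<beta> * y $ j + a $ j)))"
      unfolding qform_def using y a by (subst quad_form_sum[OF Ac]) auto
    also have "\<dots> = \<beta>\<^sup>2 * (\<Sum>i<p. \<Sum>j<p. A $$ (i, j) * (y $ i * y $ j))
       + \<beta> * (\<Sum>i<p. \<Sum>j<p. A $$ (i, j) * (y $ i * a $ j))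
       + \<beta> * (\<Sum>i<p. \<Sum>j<p. A $$ (i, j) * (a $ i * y $ j))
       + (\<Sum>i<p. \<Sum>j<p. A $$ (i, j) * (a $ i * a $ j))"
      unfolding sum_distrib_left sum.distrib[symmetric]
      by (intro sum.cong refl) (simp add: algebra_simps power2_eq_square)
    finally show ?thesis
      unfolding 1[symmetric] 2[symmetric] qform_def quad_form_sum[OF Ac y y] quad_form_sum[OF Ac a a] by simp
  qed
  have "qform A (\<beta> \<cdot>\<^sub>v y + a) - qform A (\<beta> \<cdot>\<^sub>v w + a)
    = \<beta>\<^sup>2 * (qform A y - qform A w) + 2 * \<beta> * ((A *\<^sub>v a) \<bullet> y - (A *\<^sub>v a) \<bullet> w)"
    unfolding expand[OF y] expand[OF w] by (simp add: algebra_simps)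
  also have "\<bar>\<dots>\<bar> \<le> \<beta>\<^sup>2 * \<bar>qform A y - qform A w\<bar> + 2 * \<bar>\<beta>\<bar> * \<bar>(A *\<^sub>v a) \<bullet> y - (A *\<^sub>v a) \<bullet> w\<bar>"
    by (rule order_trans[OF abs_triangle_ineq]) (simp add: abs_mult)
  also have "\<dots> \<le> \<beta>\<^sup>2 * \<bar>qform A y - qform A w\<bar> + 2 * \<bar>\<beta>\<bar> * (\<bar>(A *\<^sub>v a) \<bullet> y\<bar> + \<bar>(A *\<^sub>v a) \<bullet> w\<bar>)"
    by (intro add_left_mono mult_left_mono abs_triangle_ineq4) auto
  finally show ?thesis .
qed

lemma bounded_sym_zero: "bounded_sym q C (0\<^sub>m q q)"
proof -
  have "0\<^sub>m q q *\<^sub>v v = (0\<^sub>v q :: real vec)" if "v \<in> carrier_vec q" for v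
    using that by (intro eq_vecI) auto
  then show ?thesis
    by (auto simp: bounded_sym_def sym_mat_def scalar_prod_self_nonneg)
qed

lemma bounded_sym_mono:
  assumes "bounded_sym p C A" "0 \<le> C" "C \<le> C'"
  shows "bounded_sym p C' A"
proof -
  have "C\<^sup>2 * (v \<bullet> v) \<le> C'\<^sup>2 * (v \<bullet> v)" if "v \<in> carrier_vec p" for v :: "real vec"
    using assms that by (intro mult_right_mono power_mono) (auto simp: scalar_prod_sum intro: sum_nonneg)
  with assms(1) show ?thesis unfolding bounded_sym_def by (meson order_trans)
qed

text \<open>(A1) concerns real matrices, so a complex symmetric matrix is replaced by its real and
  imaginary parts. On real vectors taking such a part commutes with applying the matrix and
  increases no modulus.\<close>

lemma bounded_sym_parts:
  assumes Q: "Q \<in> carrier_mat p p" "\<And>i j. i < p \<Longrightarrow> j < p \<Longrightarrow> Q $$ (i, j) = Q $$ (j, i)"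
    and bound: "\<And>v. v \<in> carrier_vec p \<Longrightarrow>
      (\<Sum>i<p. (cmod ((Q *\<^sub>v v) $ i))\<^sup>2) \<le> C\<^sup>2 * (\<Sum>i<p. (cmod (v $ i))\<^sup>2)"
  shows "bounded_sym p C (map_mat Re Q)" "bounded_sym p C (map_mat Im Q)"
proof -
  have part: "bounded_sym p C (map_mat h Q)"
    if h: "h = Re \<or> h = Im" for h
    unfolding bounded_sym_def
  proof safe
    show "sym_mat p (map_mat h Q)" unfolding sym_mat_def
      using Q by (auto intro!: eq_matI)
    fix v :: "real vec" assume v: "v \<in> carrier_vec p"
    define cv where "cv = map_vec complex_of_real v"
    have cv: "cv \<in> carrier_vec p" using v by (simp add: cv_def)
    have hQ: "map_mat h Q \<in> carrier_mat p p" using Q by simp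
    have el: "(map_mat h Q *\<^sub>v v) $ i = h ((Q *\<^sub>v cv) $ i)" if "i < p" for i
      unfolding mult_mat_vec_sum[OF Q(1) cv that] mult_mat_vec_sum[OF hQ v that]
      using h Q(1) v that by (auto simp: cv_def intro!: sum.cong)
    have "(map_mat h Q *\<^sub>v v) \<bullet> (map_mat h Q *\<^sub>v v) = (\<Sum>i<p. (h ((Q *\<^sub>v cv) $ i))\<^sup>2)"
      using hQ v by (subst scalar_prod_sum[of _ p]) (auto simp: el power2_eq_square simp del: index_mult_mat_vec)
    also have "\<dots> \<le> (\<Sum>i<p. (cmod ((Q *\<^sub>v cv) $ i))\<^sup>2)"
      using h by (intro sum_mono) (auto simp: cmod_power2 simp del: index_mult_mat_vec)
    also have "\<dots> \<le> C\<^sup>2 * (\<Sum>i<p. (cmod (cv $ i))\<^sup>2)" by (rule bound[OF cv])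
    also have "(\<Sum>i<p. (cmod (cv $ i))\<^sup>2) = v \<bullet> v"
      using v by (auto simp: scalar_prod_sum cv_def power2_eq_square intro!: sum.cong)
    finally show "(map_mat h Q *\<^sub>v v) \<bullet> (map_mat h Q *\<^sub>v v) \<le> C\<^sup>2 * (v \<bullet> v)" .
  qed
  show "bounded_sym p C (map_mat Re Q)" "bounded_sym p C (map_mat Im Q)"
    by (auto intro: part)
qed

lemma complex_qform:
  assumes Q: "Q \<in> carrier_mat p p" and x: "x \<in> carrier_vec p"
  shows "(\<Sum>i<p. complex_of_real (x $ i) * (Q *\<^sub>v map_vec complex_of_real x) $ i)
     = Complex (qform (map_mat Re Q) x) (qform (map_mat Im Q) x)"
proof -
  have cv: "map_vec complex_of_real x \<in> carrier_vec p" using x by simp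
  have "(\<Sum>i<p. complex_of_real (x $ i) * (Q *\<^sub>v map_vec complex_of_real x) $ i)
      = (\<Sum>i<p. \<Sum>j<p. Q $$ (i, j) * complex_of_real (x $ i * x $ j))"
    using x by (intro sum.cong refl)
      (simp add: mult_mat_vec_sum[OF Q cv] sum_distrib_left algebra_simps del: index_mult_mat_vec)
  also have "\<dots> = Complex (qform (map_mat Re Q) x) (qform (map_mat Im Q) x)"
    using Q x unfolding qform_def
    by (subst (1 2) quad_form_sum[of _ p]) (auto simp: complex_eq_iff intro!: sum.cong)
  finally show ?thesis .
qed

lemma cmod_Complex_diff_le: "cmod (Complex a b - Complex c d) \<le> \<bar>a - c\<bar> + \<bar>b - d\<bar>"
  using cmod_le[of "Complex a b - Complex c d"] by simp

text \<open>The estimate does not involve the size of \<open>y\<close>, \<open>w\<close> or \<open>a\<close> beyond the displayed differences,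
  because \<open>rk_num\<close> is dominated by \<open>rk_den\<close>.\<close>

lemma rank_one_swap:
  assumes S: "sym_psd_mat p S" and z: "0 < Im \<zeta>"
  obtains A :: "nat \<Rightarrow> real mat" where
    "\<And>k. bounded_sym p (1 / Im \<zeta> + 1 / (Im \<zeta>)\<^sup>2) (A k)"
    "\<And>\<beta> a y w. y \<in> carrier_vec p \<Longrightarrow> w \<in> carrier_vec p \<Longrightarrow> a \<in> carrier_vec p \<Longrightarrow>
       cmod (rk_num S \<zeta> (\<beta> \<cdot>\<^sub>v y + a) / rk_den S \<zeta> (\<beta> \<cdot>\<^sub>v y + a)
           - rk_num S \<zeta> (\<beta> \<cdot>\<^sub>v w + a) / rk_den S \<zeta> (\<beta> \<cdot>\<^sub>v w + a))
       \<le> (cmod \<zeta> / Im \<zeta> * (1 + 1 / Im \<zeta>)) * (\<Sum>k<4. \<beta>\<^sup>2 * \<bar>qform (A k) y - qform (A k) w\<bar>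
           + 2 * \<bar>\<beta>\<bar> * (\<bar>(A k *\<^sub>v a) \<bullet> y\<bar> + \<bar>(A k *\<^sub>v a) \<bullet> w\<bar>))"
proof -
  define v where "v = Im \<zeta>"
  have v: "0 < v" using z by (simp add: v_def)
  have z0: "0 < cmod \<zeta>" using z by (auto simp: complex_eq_iff)
  have dim: "dim_row S = p" using sym_psd_matD(1)[OF S] by simp
  define R where "R = resolvent S \<zeta>"
  note R = resolvent_inverse[OF S z, folded R_def]
  have Rsym: "R $$ (i, j) = R $$ (j, i)" if "i < p" "j < p" for i j
    using resolvent_sym[OF S z] that R(1) index_transpose_mat(1)[of i R j] unfolding R_def by simp
  have Rb: "(\<Sum>i<p. (cmod ((R *\<^sub>v x) $ i))\<^sup>2) \<le> (1 / v)\<^sup>2 * (\<Sum>i<p. (cmod (x $ i))\<^sup>2)"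
    if "x \<in> carrier_vec p" for x
    using resolvent_norm_le[OF S z that] v unfolding R_def v_def by (simp add: field_simps)
  have R2: "R * R \<in> carrier_mat p p" using R(1) by simp
  have "(R * R)\<^sup>T = R * R"
    using R(1) resolvent_sym[OF S z] by (simp add: transpose_mult R_def[symmetric])
  then have R2sym: "(R * R) $$ (i, j) = (R * R) $$ (j, i)" if "i < p" "j < p" for i j
    using that R2 index_transpose_mat(1)[of i "R * R" j] by (metis carrier_matD)
  have R2b: "(\<Sum>i<p. (cmod ((R * R *\<^sub>v x) $ i))\<^sup>2) \<le> (1 / v\<^sup>2)\<^sup>2 * (\<Sum>i<p. (cmod (x $ i))\<^sup>2)"
    if x: "x \<in> carrier_vec p" for x
  proof -
    have Rx: "R *\<^sub>v x \<in> carrier_vec p" using R(1) x by simp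
    have "(\<Sum>i<p. (cmod ((R * R *\<^sub>v x) $ i))\<^sup>2) = (\<Sum>i<p. (cmod ((R *\<^sub>v (R *\<^sub>v x)) $ i))\<^sup>2)"
      using R(1) x by (simp add: assoc_mult_mat_vec[of R p p R p x])
    also have "\<dots> \<le> (1 / v)\<^sup>2 * ((1 / v)\<^sup>2 * (\<Sum>i<p. (cmod (x $ i))\<^sup>2))"
      by (rule order_trans[OF Rb[OF Rx]]) (intro mult_left_mono Rb[OF x], simp)
    finally show ?thesis by (simp add: power2_eq_square)
  qed
  \<comment> \<open>\<open>A 0\<close> and \<open>A 1\<close> give the real and imaginary parts of
    x^T R x, hence the denominator; \<open>A 2\<close> and \<open>A 3\<close> those of x^T R^2 x,
    the numerator. The norms of R and R^2 are at most 1 / v and 1 / v^2, and the sum of these two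
    bounds serves for all four matrices.\<close>
  define A where "A k = (if k = 0 then map_mat Re R else if k = 1 then map_mat Im R
    else if k = 2 then map_mat Re (R * R) else map_mat Im (R * R))" for k :: nat
  have "bounded_sym p (1 / v + 1 / v\<^sup>2) (A k)" for k
    using bounded_sym_parts[OF R(1) Rsym Rb] bounded_sym_parts[OF R2 R2sym R2b] v
    by (auto simp: A_def intro: bounded_sym_mono)
  then have Asym: "sym_mat p (A k)" and Ab: "bounded_sym p (1 / v + 1 / v\<^sup>2) (A k)" for k
    by (auto simp: bounded_sym_def)
  have D: "rk_den S \<zeta> x = 1 + Complex (qform (A 0) x) (qform (A 1) x)"
    if x: "x \<in> carrier_vec p" for x
    unfolding rk_den_def dim R_def[symmetric] complex_qform[OF R(1) x] by (simp add: A_def)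
  have N: "rk_num S \<zeta> x = Complex (qform (A 2) x) (qform (A 3) x)"
    if x: "x \<in> carrier_vec p" for x
  proof -
    define cx where "cx = map_vec complex_of_real x"
    have cx: "cx \<in> carrier_vec p" using x by (simp add: cx_def)
    define u where "u = R *\<^sub>v cx"
    have u: "u \<in> carrier_vec p" using R(1) cx by (simp add: u_def)
    have cxi: "complex_of_real (x $ i) = cx $ i" if "i < p" for i using that x by (simp add: cx_def)
    have "(\<Sum>i<p. complex_of_real (x $ i) * (R * R *\<^sub>v cx) $ i) = (\<Sum>i<p. cx $ i * (R *\<^sub>v u) $ i)"
      using R(1) cx by (simp add: cxi u_def assoc_mult_mat_vec[of R p p R p])
    also have "\<dots> = (\<Sum>i<p. \<Sum>k<p. cx $ i * (R $$ (i, k) * u $ k))"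
      by (intro sum.cong refl)
        (simp add: mult_mat_vec_sum[OF R(1) u] sum_distrib_left del: index_mult_mat_vec)
    also have "\<dots> = (\<Sum>k<p. \<Sum>i<p. cx $ i * (R $$ (i, k) * u $ k))" by (rule sum.swap)
    also have "\<dots> = (\<Sum>k<p. u $ k * u $ k)"
    proof (intro sum.cong refl)
      fix k assume "k \<in> {..<p}"
      then have k: "k < p" by simp
      have "u $ k = (\<Sum>i<p. R $$ (k, i) * cx $ i)" unfolding u_def by (rule mult_mat_vec_sum[OF R(1) cx k])
      then have "u $ k * u $ k = (\<Sum>i<p. R $$ (k, i) * cx $ i) * u $ k" by simp
      also have "\<dots> = (\<Sum>i<p. cx $ i * (R $$ (i, k) * u $ k))"
        using Rsym k by (simp add: sum_distrib_left sum_distrib_right mult_ac)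
      finally show "(\<Sum>i<p. cx $ i * (R $$ (i, k) * u $ k)) = u $ k * u $ k" by simp
    qed
    finally have "rk_num S \<zeta> x = (\<Sum>i<p. complex_of_real (x $ i) * (R * R *\<^sub>v cx) $ i)"
      unfolding rk_num_def dim R_def[symmetric] cx_def[symmetric] u_def[symmetric]
      by (simp add: power2_eq_square)
    then show ?thesis unfolding cx_def complex_qform[OF R2 x] by (simp add: A_def)
  qed
  have main: "cmod (rk_num S \<zeta> x / rk_den S \<zeta> x - rk_num S \<zeta> x' / rk_den S \<zeta> x')
       \<le> cmod \<zeta> / v * (1 + 1 / v) * (\<Sum>k<4. \<bar>qform (A k) x - qform (A k) x'\<bar>)"
    if x: "x \<in> carrier_vec p" and x': "x' \<in> carrier_vec p" for x x'
  proof -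
    define N1 N2 D1 D2 where nd: "N1 = rk_num S \<zeta> x" "N2 = rk_num S \<zeta> x'" "D1 = rk_den S \<zeta> x"
      "D2 = rk_den S \<zeta> x'"
    note b1 = rk_bounds[OF S z x, folded nd v_def] and b2 = rk_bounds[OF S z x', folded nd v_def]
    have dN: "cmod (N1 - N2) \<le> \<bar>qform (A 2) x - qform (A 2) x'\<bar> + \<bar>qform (A 3) x - qform (A 3) x'\<bar>"
      unfolding nd N[OF x] N[OF x'] by (rule cmod_Complex_diff_le)
    have "D1 - D2 = Complex (qform (A 0) x) (qform (A 1) x) - Complex (qform (A 0) x') (qform (A 1) x')"
      unfolding nd D[OF x] D[OF x'] by simp
    then have dD: "cmod (D2 - D1) \<le> \<bar>qform (A 0) x - qform (A 0) x'\<bar> + \<bar>qform (A 1) x - qform (A 1) x'\<bar>"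
      using cmod_Complex_diff_le by (metis norm_minus_commute)
    have D2: "1 / cmod D2 \<le> cmod \<zeta> / v"
      using b2(1,3) v z0 by (simp add: field_simps)
    have ND: "cmod (N1 / D1) \<le> 1 / v"
      using b1(2,3) v by (simp add: norm_divide field_simps)
    \<comment> \<open>Split so that one quotient stays whole: N1 / D1 is at most 1 / v and 1 / D2 at
      most |\<zeta>| / v in modulus, however large N1 is.\<close>
    have "N1 / D1 - N2 / D2 = (N1 - N2) / D2 + (N1 / D1) * ((D2 - D1) / D2)"
      using b1(3) b2(3) by (simp add: field_simps)
    also have "cmod \<dots> \<le> cmod (N1 - N2) * (1 / cmod D2) + cmod (N1 / D1) * (cmod (D2 - D1) * (1 / cmod D2))"
      by (rule order_trans[OF norm_triangle_ineq]) (simp add: norm_divide norm_mult)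
    also have "\<dots> \<le> cmod (N1 - N2) * (cmod \<zeta> / v) + (1 / v) * (cmod (D2 - D1) * (cmod \<zeta> / v))"
      using ND D2 v by (intro add_mono mult_mono mult_left_mono mult_nonneg_nonneg) auto
    also have "\<dots> \<le> cmod \<zeta> / v * (1 + 1 / v) * (cmod (N1 - N2) + cmod (D2 - D1))"
      using v z0 by (simp add: field_simps)
    also have "\<dots> \<le> cmod \<zeta> / v * (1 + 1 / v) * (\<Sum>k<4. \<bar>qform (A k) x - qform (A k) x'\<bar>)"
      using dN dD v z0 by (intro mult_left_mono) (auto simp: eval_nat_numeral)
    finally show ?thesis unfolding nd .
  qed
  show thesis
  proof (rule that)
    show "bounded_sym p (1 / Im \<zeta> + 1 / (Im \<zeta>)\<^sup>2) (A k)" for k using Ab by (simp add: v_def)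
    fix \<beta> :: real and a y w :: "real vec"
    assume y: "y \<in> carrier_vec p" and w: "w \<in> carrier_vec p" and a: "a \<in> carrier_vec p"
    have c: "\<beta> \<cdot>\<^sub>v y + a \<in> carrier_vec p" "\<beta> \<cdot>\<^sub>v w + a \<in> carrier_vec p" using y w a by auto
    show "cmod (rk_num S \<zeta> (\<beta> \<cdot>\<^sub>v y + a) / rk_den S \<zeta> (\<beta> \<cdot>\<^sub>v y + a)
           - rk_num S \<zeta> (\<beta> \<cdot>\<^sub>v w + a) / rk_den S \<zeta> (\<beta> \<cdot>\<^sub>v w + a))
       \<le> (cmod \<zeta> / Im \<zeta> * (1 + 1 / Im \<zeta>)) * (\<Sum>k<4. \<beta>\<^sup>2 * \<bar>qform (A k) y - qform (A k) w\<bar>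
           + 2 * \<bar>\<beta>\<bar> * (\<bar>(A k *\<^sub>v a) \<bullet> y\<bar> + \<bar>(A k *\<^sub>v a) \<bullet> w\<bar>))"
      unfolding v_def[symmetric]
      using v z0 by (intro order_trans[OF main[OF c]] mult_left_mono sum_mono
        qform_affine_diff[OF Asym y w a]) auto
  qed
qed

text \<open>Both matrices perturb the same \<open>S0\<close>, whose trace cancels. Each remaining
  quotient is at most 1 / Im \<zeta> in modulus, so the second bound holds for vectors of any size;
  it becomes the bounded-difference constant.\<close>

lemma trace_resolvent_rank_one_diff:
  assumes S0: "sym_psd_mat p S0" and S: "sym_psd_mat p S" and S': "sym_psd_mat p S'" and z: "0 < Im \<zeta>"
    and x: "x \<in> carrier_vec p" and x': "x' \<in> carrier_vec p"
    and eq: "\<And>i j. i < p \<Longrightarrow> j < p \<Longrightarrow> S $$ (i, j) = S0 $$ (i, j) + x $ i * x $ j"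
      "\<And>i j. i < p \<Longrightarrow> j < p \<Longrightarrow> S' $$ (i, j) = S0 $$ (i, j) + x' $ i * x' $ j"
  shows "cmod (trace_resolvent S \<zeta> - trace_resolvent S' \<zeta>) =
      cmod (rk_num S0 \<zeta> x / rk_den S0 \<zeta> x - rk_num S0 \<zeta> x' / rk_den S0 \<zeta> x')"
    "cmod (trace_resolvent S \<zeta> - trace_resolvent S' \<zeta>) \<le> 2 / Im \<zeta>"
proof -
  have 1: "trace_resolvent S \<zeta> = trace_resolvent S0 \<zeta> - rk_num S0 \<zeta> x / rk_den S0 \<zeta> x"
    by (rule trace_resolvent_rank_one[OF S0 S z x]) (rule eq(1))
  have 2: "trace_resolvent S' \<zeta> = trace_resolvent S0 \<zeta> - rk_num S0 \<zeta> x' / rk_den S0 \<zeta> x'"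
    by (rule trace_resolvent_rank_one[OF S0 S' z x']) (rule eq(2))
  show *: "cmod (trace_resolvent S \<zeta> - trace_resolvent S' \<zeta>) =
      cmod (rk_num S0 \<zeta> x / rk_den S0 \<zeta> x - rk_num S0 \<zeta> x' / rk_den S0 \<zeta> x')"
    unfolding 1 2 by (subst norm_minus_commute) simp
  have "cmod (rk_num S0 \<zeta> x / rk_den S0 \<zeta> x) \<le> 1 / Im \<zeta>" if "x \<in> carrier_vec p" for x
    using rk_bounds(2,3)[OF S0 z that] z by (simp add: norm_divide field_simps)
  from add_mono[OF this[OF x] this[OF x']] show "cmod (trace_resolvent S \<zeta> - trace_resolvent S' \<zeta>) \<le> 2 / Im \<zeta>"
    unfolding * by (intro order_trans[OF norm_triangle_ineq4]) simp
qed

section \<open>Gram matrices\<close>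

lemma borel_measurable_det:
  fixes f :: "'a \<Rightarrow> complex mat"
  assumes c: "\<And>x. x \<in> space M \<Longrightarrow> f x \<in> carrier_mat n n"
    and m: "\<And>i j. i < n \<Longrightarrow> j < n \<Longrightarrow> (\<lambda>x. f x $$ (i, j)) \<in> borel_measurable M"
  shows "(\<lambda>x. Determinant.det (f x)) \<in> borel_measurable M"
proof -
  have "(\<lambda>x. \<Sum>q | q permutes {0..<n}. signof q * (\<Prod>i = 0..<n. f x $$ (i, q i))) \<in> borel_measurable M"
  proof (intro borel_measurable_sum borel_measurable_times borel_measurable_const borel_measurable_prod)
    fix q i assume "q \<in> {q. q permutes {0..<n}}" "i \<in> {0..<n}"
    then have "i < n" "q i < n" using permutes_in_image[of q "{0..<n}" i] by auto
    then show "(\<lambda>x. f x $$ (i, q i)) \<in> borel_measurable M" by (rule m)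
  qed
  then show ?thesis
    by (subst measurable_cong[where g = "\<lambda>x. \<Sum>q | q permutes {0..<n}. signof q * (\<Prod>i = 0..<n. f x $$ (i, q i))"])
      (auto simp: det_def' c)
qed

text \<open>Cramer's rule. It exhibits the entries of the resolvent as rational functions of those
  of \<open>S\<close>, from which measurability of the trace is read off.\<close>

lemma resolvent_adj:
  assumes S: "sym_psd_mat p S" and z: "0 < Im \<zeta>" and ij: "i < p" "j < p"
  shows "resolvent S \<zeta> $$ (i, j) = cofactor (shifted S \<zeta>) j i / Determinant.det (shifted S \<zeta>)"
proof -
  define H where "H = shifted S \<zeta>"
  have H: "H \<in> carrier_mat p p" using sym_psd_matD(1)[OF S] by (simp add: H_def)
  have d: "Determinant.det H \<noteq> 0" using resolvent_inverse(4)[OF S z] by (simp add: H_def)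
  note a = adj_mat[OF H]
  have "H * ((1 / Determinant.det H) \<cdot>\<^sub>m adj_mat H) = (1 / Determinant.det H) \<cdot>\<^sub>m (Determinant.det H \<cdot>\<^sub>m 1\<^sub>m p)"
    using mult_smult_distrib[OF H a(1)] a(2) by simp
  also have "\<dots> = 1\<^sub>m p" using d by (intro eq_matI) auto
  finally have "resolvent S \<zeta> = (1 / Determinant.det H) \<cdot>\<^sub>m adj_mat H"
    using resolvent_unique[OF S z] a(1) by (simp add: H_def)
  then show ?thesis using ij H by (simp add: H_def adj_mat_def)
qed

lemma borel_measurable_trace_resolvent:
  assumes psd: "\<And>x. x \<in> space M \<Longrightarrow> sym_psd_mat p (f x)" and z: "0 < Im \<zeta>"
    and m: "\<And>i j. i < p \<Longrightarrow> j < p \<Longrightarrow> (\<lambda>x. f x $$ (i, j)) \<in> borel_measurable M"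
  shows "(\<lambda>x. trace_resolvent (f x) \<zeta>) \<in> borel_measurable M"
proof -
  have fc: "f x \<in> carrier_mat p p" if "x \<in> space M" for x using sym_psd_matD(1)[OF psd[OF that]] .
  have Hm: "(\<lambda>x. shifted (f x) \<zeta> $$ (i, j)) \<in> borel_measurable M" if "i < p" "j < p" for i j
  proof -
    have "(\<lambda>x. complex_of_real (f x $$ (i, j)) - (if i = j then \<zeta> else 0)) \<in> borel_measurable M"
      using m[OF that] by simp
    then show ?thesis
      by (subst measurable_cong[where g = "\<lambda>x. complex_of_real (f x $$ (i, j)) - (if i = j then \<zeta> else 0)"])
        (auto simp: shifted_index[OF fc] that)
  qed
  have dm: "(\<lambda>x. Determinant.det (shifted (f x) \<zeta>)) \<in> borel_measurable M"
    by (rule borel_measurable_det[of _ _ p]) (auto simp: fc Hm)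
  have cm: "(\<lambda>x. cofactor (shifted (f x) \<zeta>) i i) \<in> borel_measurable M" if "i < p" for i
    unfolding cofactor_def
  proof (intro borel_measurable_times borel_measurable_const borel_measurable_det[of _ _ "p - 1"])
    show "mat_delete (shifted (f x) \<zeta>) i i \<in> carrier_mat (p - 1) (p - 1)" if "x \<in> space M" for x
      by (intro mat_delete_carrier) (simp add: fc that)
    fix a b assume ab: "a < p - 1" "b < p - 1"
    then obtain p' where p': "p = Suc p'" using \<open>i < p\<close> by (cases p) auto
    have "insert_index i a < p" "insert_index i b < p" using ab p' by (auto simp: insert_index_def)
    from Hm[OF this] show "(\<lambda>x. mat_delete (shifted (f x) \<zeta>) i i $$ (a, b)) \<in> borel_measurable M"
      by (subst measurable_cong[where g = "\<lambda>x. shifted (f x) \<zeta> $$ (insert_index i a, insert_index i b)"])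
        (use ab p' that fc in \<open>auto intro!: mat_delete_index[symmetric]\<close>)
  qed
  have "(\<lambda>x. \<Sum>i<p. cofactor (shifted (f x) \<zeta>) i i / Determinant.det (shifted (f x) \<zeta>)) \<in> borel_measurable M"
    by (intro borel_measurable_sum borel_measurable_divide cm dm) auto
  moreover have "trace_resolvent (f x) \<zeta> = (\<Sum>i<p. cofactor (shifted (f x) \<zeta>) i i / Determinant.det (shifted (f x) \<zeta>))"
    if "x \<in> space M" for x
    using resolvent_inverse(1)[OF psd[OF that] z] resolvent_adj[OF psd[OF that] z]
    by (simp add: trace_resolvent_def mat_trace_def resolvent_def shifted_def)
  ultimately show ?thesis by (subst measurable_cong) auto
qed

text \<open>\<open>X G\<^sup>T G X\<^sup>T\<close> for the matrix \<open>X\<close> with columns \<open>x i\<close> and the matrix \<open>G\<close> with entries \<open>g l i\<close>.\<close>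

definition gram :: "nat \<Rightarrow> nat \<Rightarrow> (nat \<Rightarrow> nat \<Rightarrow> real) \<Rightarrow> (nat \<Rightarrow> real vec) \<Rightarrow> real mat" where
  "gram p n g x = mat p p (\<lambda>(a, c). \<Sum>l<n. (\<Sum>i<n. g l i * x i $ a) * (\<Sum>i<n. g l i * x i $ c))"

lemma sum_outer_psd:
  fixes A :: "real mat"
  assumes A: "A \<in> carrier_mat p p" "\<And>a c. a < p \<Longrightarrow> c < p \<Longrightarrow> A $$ (a, c) = (\<Sum>l<n. r l a * r l c)"
    and v: "v \<in> carrier_vec p"
  shows "v \<bullet> (A *\<^sub>v v) = (\<Sum>l<n. (\<Sum>a<p. r l a * v $ a)\<^sup>2)"
proof -
  have "v \<bullet> (A *\<^sub>v v) = (\<Sum>a<p. \<Sum>c<p. \<Sum>l<n. (r l a * v $ a) * (r l c * v $ c))"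
    unfolding quad_form_sum[OF A(1) v v]
    by (intro sum.cong refl) (simp add: A(2) sum_distrib_left sum_distrib_right mult_ac)
  also have "\<dots> = (\<Sum>a<p. \<Sum>l<n. \<Sum>c<p. (r l a * v $ a) * (r l c * v $ c))"
    by (intro sum.cong refl sum.swap)
  also have "\<dots> = (\<Sum>l<n. \<Sum>a<p. \<Sum>c<p. (r l a * v $ a) * (r l c * v $ c))" by (rule sum.swap)
  also have "\<dots> = (\<Sum>l<n. (\<Sum>a<p. r l a * v $ a)\<^sup>2)" by (simp add: power2_eq_square sum_product)
  finally show ?thesis .
qed

lemma gram_psd: "sym_psd_mat p (gram p n g x)"
proof -
  have c: "gram p n g x \<in> carrier_mat p p" by (simp add: gram_def)
  have "0 \<le> v \<bullet> (gram p n g x *\<^sub>v v)" if "v \<in> carrier_vec p" for v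
    by (subst sum_outer_psd[OF c _ that, where r = "\<lambda>l a. \<Sum>i<n. g l i * x i $ a"])
      (auto simp: gram_def intro: sum_nonneg)
  moreover have "(gram p n g x)\<^sup>T = gram p n g x" by (rule eq_matI) (auto simp: gram_def mult.commute)
  ultimately show ?thesis using c by (auto simp: sym_psd_mat_def sym_mat_def)
qed

lemma borel_measurable_gram_index:
  assumes "a < p" "c < p"
  shows "(\<lambda>x. gram p n g x $$ (a, c)) \<in> borel_measurable (\<Pi>\<^sub>M i\<in>{..<n}. vec_borel p)"
proof -
  have "(\<lambda>x. x i $ b) \<in> borel_measurable (\<Pi>\<^sub>M i\<in>{..<n}. vec_borel p)" if "i < n" "b < p" for i b
    using that by (intro measurable_vec_index[of _ _ p] measurable_component_singleton) auto
  then show ?thesis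
    unfolding gram_def index_mat[OF assms] prod.case using assms
    by (intro borel_measurable_sum borel_measurable_times borel_measurable_const) auto
qed

section \<open>Separating one column from a Gram matrix\<close>

text \<open>The Euclidean norm of column \<open>j\<close> of the coefficient matrix: the factor
  \<beta> in front of the column that is exchanged.\<close>

definition loading :: "nat \<Rightarrow> (nat \<Rightarrow> nat \<Rightarrow> real) \<Rightarrow> nat \<Rightarrow> real" where
  "loading n g j = sqrt (\<Sum>l<n. (g l j)\<^sup>2)"

text \<open>When \<open>loading n g j = 0\<close> the coefficients \<open>g l j\<close> vanish, so the value of \<open>x / 0\<close> is
  harmless here.\<close>

definition cross_coeff :: "nat \<Rightarrow> (nat \<Rightarrow> nat \<Rightarrow> real) \<Rightarrow> nat \<Rightarrow> nat \<Rightarrow> real" where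
  "cross_coeff n g j i = (\<Sum>l<n. g l i * (g l j / loading n g j))"

text \<open>The vector \<alpha>. Its coefficients are the inner products of the other coefficient
  columns with the normalised column \<open>j\<close>, so \<open>x j\<close> does not occur in
  it.\<close>

definition residual :: "nat \<Rightarrow> nat \<Rightarrow> (nat \<Rightarrow> nat \<Rightarrow> real) \<Rightarrow> nat \<Rightarrow> (nat \<Rightarrow> real vec) \<Rightarrow> real vec" where
  "residual p n g j x = vec p (\<lambda>a. \<Sum>i\<in>{..<n} - {j}. cross_coeff n g j i * x i $ a)"

text \<open>The value is 1, or 0 when the coefficient column vanishes and every quotient is a
  division by zero; the inequality covers both.\<close>

lemma sum_unit_loading: "(\<Sum>l<n. (g l j / loading n g j)\<^sup>2) \<le> 1"
  by (simp add: power_divide loading_def sum_nonneg sum_divide_distrib[symmetric])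

text \<open>Completing the square in column \<open>j\<close>; the remainder is positive semi-definite by the
  Cauchy--Schwarz inequality.\<close>

lemma gram_complete_square:
  assumes j: "j < n"
  obtains S0 where "sym_psd_mat p S0"
    "\<And>u a c. u \<in> carrier_vec p \<Longrightarrow> a < p \<Longrightarrow> c < p \<Longrightarrow>
       gram p n g (x(j := u)) $$ (a, c) = S0 $$ (a, c) +
         (loading n g j \<cdot>\<^sub>v u + residual p n g j x) $ a * (loading n g j \<cdot>\<^sub>v u + residual p n g j x) $ c"
proof -
  define \<beta> where "\<beta> = loading n g j"
  define J where "J = {..<n} - {j}"
  define h where "h l a = (\<Sum>i\<in>J. g l i * x i $ a)" for l a
  define e where "e l = g l j / \<beta>" for l
  have e1: "(\<Sum>l<n. (e l)\<^sup>2) \<le> 1" unfolding e_def \<beta>_def by (rule sum_unit_loading)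
  have gj: "g l j = \<beta> * e l" if "l < n" for l
  proof (cases "\<beta> = 0")
    case True
    then have "(\<Sum>l<n. (g l j)\<^sup>2) = 0" by (simp add: \<beta>_def loading_def)
    then have "\<forall>l\<in>{..<n}. (g l j)\<^sup>2 = 0" by (subst (asm) sum_nonneg_eq_0_iff) auto
    with that show ?thesis using True by simp
  qed (simp add: e_def)
  have bb: "(\<Sum>l<n. g l j * g l j) = \<beta>\<^sup>2"
    by (simp add: \<beta>_def loading_def sum_nonneg power2_eq_square)
  have be: "(\<Sum>l<n. h l a * g l j) = \<beta> * (\<Sum>l<n. e l * h l a)" for a
    unfolding sum_distrib_left by (intro sum.cong refl) (simp add: gj)
  have res: "residual p n g j x $ a = (\<Sum>l<n. e l * h l a)" if "a < p" for a
  proof -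
    have "residual p n g j x $ a = (\<Sum>i\<in>J. \<Sum>l<n. g l i * e l * x i $ a)"
      using that by (simp add: residual_def cross_coeff_def e_def J_def \<beta>_def sum_distrib_right)
    also have "\<dots> = (\<Sum>l<n. \<Sum>i\<in>J. g l i * e l * x i $ a)" by (rule sum.swap)
    finally show ?thesis by (simp add: h_def sum_distrib_left mult_ac)
  qed
  \<comment> \<open>With H the matrix of the \<open>h l a\<close> this is H^T (I - e e^T) H: the
    contribution of the other columns with the direction \<open>e\<close> of column \<open>j\<close>
    removed. It is positive semi-definite because |e| \<le> 1.\<close>
  define S0 where "S0 = mat p p (\<lambda>(a, c). (\<Sum>l<n. h l a * h l c)
    - (\<Sum>l<n. e l * h l a) * (\<Sum>l<n. e l * h l c))"
  have S0c: "S0 \<in> carrier_mat p p" by (simp add: S0_def)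
  have psd: "0 \<le> v \<bullet> (S0 *\<^sub>v v)" if v: "v \<in> carrier_vec p" for v
  proof -
    define P where "P = mat p p (\<lambda>(a, c). \<Sum>l<n. h l a * h l c)"
    \<comment> \<open>The outer sum over a single index puts the rank-one matrix into the form that
      \<open>sum_outer_psd\<close> expects.\<close>
    define Q where "Q = mat p p (\<lambda>(a, c). \<Sum>_<1::nat. (\<Sum>l<n. e l * h l a) * (\<Sum>l<n. e l * h l c))"
    have PQ: "P \<in> carrier_mat p p" "Q \<in> carrier_mat p p" by (auto simp: P_def Q_def)
    have "v \<bullet> (S0 *\<^sub>v v) = v \<bullet> (P *\<^sub>v v) - v \<bullet> (Q *\<^sub>v v)"
      unfolding quad_form_sum[OF S0c v v] quad_form_sum[OF PQ(1) v v] quad_form_sum[OF PQ(2) v v]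
        sum_subtractf[symmetric]
      by (intro sum.cong refl) (simp add: S0_def P_def Q_def left_diff_distrib)
    also have "v \<bullet> (P *\<^sub>v v) = (\<Sum>l<n. (\<Sum>a<p. h l a * v $ a)\<^sup>2)"
      by (rule sum_outer_psd[OF PQ(1) _ v]) (simp add: P_def)
    also have "v \<bullet> (Q *\<^sub>v v) = (\<Sum>l<(1::nat). (\<Sum>a<p. (\<Sum>l<n. e l * h l a) * v $ a)\<^sup>2)"
      by (rule sum_outer_psd[OF PQ(2) _ v]) (simp add: Q_def)
    also have "\<dots> = (\<Sum>a<p. (\<Sum>l<n. e l * h l a) * v $ a)\<^sup>2" by simp
    also have "(\<Sum>a<p. (\<Sum>l<n. e l * h l a) * v $ a) = (\<Sum>a<p. \<Sum>l<n. e l * (h l a * v $ a))"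
      by (simp add: sum_distrib_left sum_distrib_right mult_ac)
    also have "\<dots> = (\<Sum>l<n. e l * (\<Sum>a<p. h l a * v $ a))"
      by (subst sum.swap) (simp add: sum_distrib_left)
    finally have eq: "v \<bullet> (S0 *\<^sub>v v) = (\<Sum>l<n. (\<Sum>a<p. h l a * v $ a)\<^sup>2)
       - (\<Sum>l<n. e l * (\<Sum>a<p. h l a * v $ a))\<^sup>2" .
    have "(\<Sum>l<n. e l * (\<Sum>a<p. h l a * v $ a))\<^sup>2
      \<le> (\<Sum>l<n. (e l)\<^sup>2) * (\<Sum>l<n. (\<Sum>a<p. h l a * v $ a)\<^sup>2)"
      by (rule Cauchy_Schwarz_ineq_sum)
    also have "\<dots> \<le> 1 * (\<Sum>l<n. (\<Sum>a<p. h l a * v $ a)\<^sup>2)"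
      using e1 by (intro mult_right_mono sum_nonneg) auto
    finally show ?thesis unfolding eq by simp
  qed
  have "S0\<^sup>T = S0" by (rule eq_matI) (auto simp: S0_def mult.commute)
  with psd S0c have S0: "sym_psd_mat p S0" by (auto simp: sym_psd_mat_def sym_mat_def)
  show thesis
  proof (rule that[OF S0])
    fix u :: "real vec" and a c :: nat
    assume u: "u \<in> carrier_vec p" and ac: "a < p" "c < p"
    have expand: "(\<Sum>i<n. g l i * (x(j := u)) i $ b) = g l j * u $ b + h l b" for l b
    proof -
      have "(\<Sum>i<n. g l i * (x(j := u)) i $ b) = g l j * u $ b + (\<Sum>i\<in>J. g l i * (x(j := u)) i $ b)"
        unfolding J_def using j by (subst sum.remove[of _ j]) auto
      also have "(\<Sum>i\<in>J. g l i * (x(j := u)) i $ b) = h l b"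
        unfolding h_def J_def by (intro sum.cong) auto
      finally show ?thesis .
    qed
    have "gram p n g (x(j := u)) $$ (a, c) = (\<Sum>l<n. (g l j * u $ a + h l a) * (g l j * u $ c + h l c))"
      using ac by (simp add: gram_def expand del: fun_upd_apply)
    also have "\<dots> = (\<Sum>l<n. g l j * g l j) * (u $ a * u $ c) + (\<Sum>l<n. h l c * g l j) * u $ a
        + (\<Sum>l<n. h l a * g l j) * u $ c + (\<Sum>l<n. h l a * h l c)"
      unfolding sum_distrib_right sum.distrib[symmetric] by (intro sum.cong refl) (simp add: algebra_simps)
    also have "\<dots> = S0 $$ (a, c) + (\<beta> * u $ a + residual p n g j x $ a) * (\<beta> * u $ c + residual p n g j x $ c)"
      unfolding bb be res[OF ac(1)] res[OF ac(2)] using ac by (simp add: S0_def algebra_simps power2_eq_square)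
    finally show "gram p n g (x(j := u)) $$ (a, c) = S0 $$ (a, c) +
         (loading n g j \<cdot>\<^sub>v u + residual p n g j x) $ a * (loading n g j \<cdot>\<^sub>v u + residual p n g j x) $ c"
      using ac u by (simp add: \<beta>_def residual_def)
  qed
qed

text \<open>Column \<open>i\<close> of a lower triangular \<open>m\<close>-banded matrix is
  supported on the rows from \<open>i\<close> to \<open>i + m - 1\<close>, so at most
  \<open>m\<close> entries contribute.\<close>

lemma banded_column_sum:
  fixes g :: "nat \<Rightarrow> nat \<Rightarrow> real"
  assumes band: "\<And>l i. l < n \<Longrightarrow> i < n \<Longrightarrow> i + m \<le> l \<or> l < i \<Longrightarrow> g l i = 0"
    and bound: "\<And>l i. l < n \<Longrightarrow> i < n \<Longrightarrow> (g l i)\<^sup>2 \<le> K" and K: "0 \<le> K" and i: "i < n"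
  shows "(\<Sum>l<n. (g l i)\<^sup>2) \<le> real m * K"
proof -
  have "(\<Sum>l<n. (g l i)\<^sup>2) = (\<Sum>l\<in>{i..<i + m} \<inter> {..<n}. (g l i)\<^sup>2)"
  proof (rule sum.mono_neutral_right)
    show "\<forall>l\<in>{..<n} - {i..<i + m} \<inter> {..<n}. (g l i)\<^sup>2 = 0"
    proof
      fix l assume l: "l \<in> {..<n} - {i..<i + m} \<inter> {..<n}"
      then have "i + m \<le> l \<or> l < i" by auto
      with l i show "(g l i)\<^sup>2 = 0" using band[of l i] by simp
    qed
  qed auto
  also have "\<dots> \<le> (\<Sum>l\<in>{i..<i + m} \<inter> {..<n}. K)" using bound i by (intro sum_mono) auto
  also have "\<dots> \<le> real m * K"
    using K card_mono[of "{i..<i + m}" "{i..<i + m} \<inter> {..<n}"] by (auto intro!: mult_right_mono)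
  finally show ?thesis .
qed

lemma loading_le:
  fixes g :: "nat \<Rightarrow> nat \<Rightarrow> real"
  assumes "\<And>l i. l < n \<Longrightarrow> i < n \<Longrightarrow> i + m \<le> l \<or> l < i \<Longrightarrow> g l i = 0"
    and "\<And>l i. l < n \<Longrightarrow> i < n \<Longrightarrow> (g l i)\<^sup>2 \<le> K" and "0 \<le> K" and "j < n"
  shows "loading n g j \<le> sqrt (real m * K)"
  unfolding loading_def real_sqrt_le_iff by (rule banded_column_sum) fact+

text \<open>The indices at distance less than \<open>m\<close> from \<open>j\<close> lie in the
  half-open interval from \<open>j - m\<close> to \<open>j + m\<close>; truncated subtraction only
  shortens it.\<close>

lemma card_band_le: "card {i\<in>{..<n} - {j}. j < i + m \<and> i < j + m} \<le> 2 * m"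
proof -
  have "card {i\<in>{..<n} - {j}. j < i + m \<and> i < j + m} \<le> card {j - m..<j + m}"
    by (rule card_mono) auto
  then show ?thesis by simp
qed

text \<open>Coefficient columns at distance \<open>m\<close> or more have disjoint supports, so
  their cross coefficients vanish. For the at most \<open>2 * m\<close> others the squared
  coefficient is at most \<open>m * K\<close> by Cauchy-Schwarz, and Cauchy-Schwarz over these
  neighbours yields the remaining factor \<open>2 * m\<close>.\<close>

lemma residual_bound:
  assumes band: "\<And>l i. l < n \<Longrightarrow> i < n \<Longrightarrow> i + m \<le> l \<or> l < i \<Longrightarrow> g l i = 0"
    and bound: "\<And>l i. l < n \<Longrightarrow> i < n \<Longrightarrow> (g l i)\<^sup>2 \<le> K" and K: "0 \<le> K" and j: "j < n"
    and x: "\<And>i. i < n \<Longrightarrow> i \<noteq> j \<Longrightarrow> x i \<in> carrier_vec p"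
  shows "residual p n g j x \<bullet> residual p n g j x
     \<le> 2 * real m * (real m * K) * (\<Sum>i\<in>{i\<in>{..<n} - {j}. j < i + m \<and> i < j + m}. x i \<bullet> x i)"
proof -
  define T where "T = {i\<in>{..<n} - {j}. j < i + m \<and> i < j + m}"
  have T: "finite T" "T \<subseteq> {..<n} - {j}" by (auto simp: T_def)
  have "card T \<le> 2 * m" unfolding T_def by (rule card_band_le)
  then have cardT: "real (card T) \<le> 2 * real m" by linarith
  have load: "(\<Sum>l<n. (g l i)\<^sup>2) \<le> real m * K" if "i < n" for i
    by (rule banded_column_sum[of n m g K i]) (fact band bound K that)+
  have c2: "(cross_coeff n g j i)\<^sup>2 \<le> real m * K" if i: "i < n" for i
  proof -
    have "(cross_coeff n g j i)\<^sup>2 \<le> (\<Sum>l<n. (g l i)\<^sup>2) * (\<Sum>l<n. (g l j / loading n g j)\<^sup>2)"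
      unfolding cross_coeff_def by (rule Cauchy_Schwarz_ineq_sum)
    also have "\<dots> \<le> (\<Sum>l<n. (g l i)\<^sup>2) * 1" by (intro mult_left_mono sum_unit_loading sum_nonneg) auto
    also have "\<dots> \<le> real m * K" using load[OF i] by simp
    finally show ?thesis .
  qed
  have c0: "cross_coeff n g j i = 0" if "i \<in> ({..<n} - {j}) - T" for i
    unfolding cross_coeff_def
  proof (intro sum.neutral ballI)
    fix l assume l: "l \<in> {..<n}"
    have "i + m \<le> j \<or> j + m \<le> i" using that by (auto simp: T_def)
    then have "(i + m \<le> l \<or> l < i) \<or> (j + m \<le> l \<or> l < j)" by linarith
    then show "g l i * (g l j / loading n g j) = 0" using band[of l i] band[of l j] that l j by auto
  qed
  have r: "(residual p n g j x $ a)\<^sup>2 \<le> 2 * real m * (\<Sum>i\<in>T. real m * K * (x i $ a)\<^sup>2)" if a: "a < p" for a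
  proof -
    have "residual p n g j x $ a = (\<Sum>i\<in>T. 1 * (cross_coeff n g j i * x i $ a))"
    proof -
      have "residual p n g j x $ a = (\<Sum>i\<in>{..<n} - {j}. cross_coeff n g j i * x i $ a)"
        using a by (simp add: residual_def)
      also have "\<dots> = (\<Sum>i\<in>T. cross_coeff n g j i * x i $ a)"
        by (rule sum.mono_neutral_right) (use T c0 in \<open>simp_all\<close>)
      finally show ?thesis by simp
    qed
    then have "(residual p n g j x $ a)\<^sup>2 \<le> (\<Sum>i\<in>T. 1\<^sup>2) * (\<Sum>i\<in>T. (cross_coeff n g j i * x i $ a)\<^sup>2)"
      by (simp only:) (rule Cauchy_Schwarz_ineq_sum)
    also have "\<dots> \<le> (2 * real m) * (\<Sum>i\<in>T. real m * K * (x i $ a)\<^sup>2)"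
    proof (intro mult_mono sum_mono)
      fix i assume "i \<in> T"
      then show "(cross_coeff n g j i * x i $ a)\<^sup>2 \<le> real m * K * (x i $ a)\<^sup>2"
        using c2[of i] T by (auto simp: power_mult_distrib intro!: mult_right_mono)
    qed (use cardT in \<open>auto intro: sum_nonneg\<close>)
    finally show ?thesis .
  qed
  have "residual p n g j x \<bullet> residual p n g j x = (\<Sum>a<p. (residual p n g j x $ a)\<^sup>2)"
    by (subst scalar_prod_sum[of _ p]) (auto simp: residual_def power2_eq_square)
  also have "\<dots> \<le> (\<Sum>a<p. 2 * real m * (\<Sum>i\<in>T. real m * K * (x i $ a)\<^sup>2))"
    by (intro sum_mono r) auto
  also have "\<dots> = 2 * real m * (real m * K) * (\<Sum>a<p. \<Sum>i\<in>T. (x i $ a)\<^sup>2)"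
    by (simp add: sum_distrib_left mult_ac)
  also have "(\<Sum>a<p. \<Sum>i\<in>T. (x i $ a)\<^sup>2) = (\<Sum>i\<in>T. \<Sum>a<p. (x i $ a)\<^sup>2)" by (rule sum.swap)
  also have "\<dots> = (\<Sum>i\<in>T. x i \<bullet> x i)"
  proof (intro sum.cong refl)
    fix i assume "i \<in> T"
    with T have "x i \<in> carrier_vec p" by (intro x) auto
    then show "(\<Sum>a<p. (x i $ a)\<^sup>2) = x i \<bullet> x i" by (simp add: scalar_prod_sum power2_eq_square)
  qed
  finally show ?thesis unfolding T_def .
qed

text \<open>A diagonal entry is a coordinate of R applied to a unit vector, hence at most 1 / Im
  \<zeta> in modulus. The bound makes the trace integrable under every law of the columns.\<close>

lemma trace_resolvent_bound:
  assumes S: "sym_psd_mat p S" and z: "0 < Im \<zeta>"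
  shows "cmod (trace_resolvent S \<zeta>) \<le> real p / Im \<zeta>"
proof -
  define R where "R = resolvent S \<zeta>"
  have R: "R \<in> carrier_mat p p" using resolvent_inverse(1)[OF S z] by (simp add: R_def)
  have "cmod (R $$ (i, i)) \<le> 1 / Im \<zeta>" if i: "i < p" for i
  proof -
    have u: "unit_vec p i \<in> carrier_vec p" by simp
    have Ru: "(R *\<^sub>v unit_vec p i) $ k = R $$ (k, i)" if "k < p" for k
      unfolding mult_mat_vec_sum[OF R u that] using i
      by (simp add: unit_vec_def if_distrib[of "\<lambda>x. _ * x"] cong: if_cong)
    have "(\<Sum>k<p. (cmod (unit_vec p i $ k :: complex))\<^sup>2) = (\<Sum>k<p. if k = i then 1 else 0)"
      by (intro sum.cong refl) (auto simp: unit_vec_def)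
    then have one: "(\<Sum>k<p. (cmod (unit_vec p i $ k :: complex))\<^sup>2) = 1" using i by simp
    have "(cmod (R $$ (i, i)))\<^sup>2 \<le> (\<Sum>k<p. (cmod (R $$ (k, i)))\<^sup>2)"
      by (rule member_le_sum) (use i in auto)
    also have "\<dots> = (\<Sum>k<p. (cmod ((R *\<^sub>v unit_vec p i) $ k))\<^sup>2)"
      by (intro sum.cong refl) (simp add: Ru del: index_mult_mat_vec)
    finally have "(cmod (R $$ (i, i)))\<^sup>2 * (Im \<zeta>)\<^sup>2 \<le> (\<Sum>k<p. (cmod ((R *\<^sub>v unit_vec p i) $ k))\<^sup>2) * (Im \<zeta>)\<^sup>2"
      by (rule mult_right_mono) simp
    also have "\<dots> \<le> 1" using resolvent_norm_le[OF S z u] unfolding one R_def .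
    finally have "(cmod (R $$ (i, i)) * Im \<zeta>)\<^sup>2 \<le> 1\<^sup>2" by (simp add: power_mult_distrib)
    then have "cmod (R $$ (i, i)) * Im \<zeta> \<le> 1" by (rule power2_le_imp_le) simp
    then show ?thesis using z by (simp add: field_simps)
  qed
  then have "(\<Sum>i<p. cmod (R $$ (i, i))) \<le> (\<Sum>i<p. 1 / Im \<zeta>)" by (intro sum_mono) auto
  moreover have "trace_resolvent S \<zeta> = (\<Sum>i<p. R $$ (i, i))"
    using R by (simp add: trace_resolvent_def resolvent_def shifted_def mat_trace_def R_def)
  ultimately show ?thesis using norm_sum[of "\<lambda>i. R $$ (i, i)" "{..<p}"] by simp
qed

section \<open>The principal square root\<close>

text \<open>Matrices are plain functions of two indices here, so that powers and series can be
  formed entrywise without carrier conditions.\<close>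

definition bform :: "nat \<Rightarrow> (nat \<Rightarrow> nat \<Rightarrow> real) \<Rightarrow> (nat \<Rightarrow> real) \<Rightarrow> (nat \<Rightarrow> real) \<Rightarrow> real" where
  "bform p A u v = (\<Sum>i<p. \<Sum>j<p. A i j * (u i * v j))"

lemma bform_lin_left: "bform p A (\<lambda>i. a * u i + b * w i) v = a * bform p A u v + b * bform p A w v"
  unfolding bform_def sum_distrib_left sum.distrib[symmetric]
  by (intro sum.cong refl) (simp add: algebra_simps)

lemma bform_lin_right: "bform p A v (\<lambda>i. a * u i + b * w i) = a * bform p A v u + b * bform p A v w"
  unfolding bform_def sum_distrib_left sum.distrib[symmetric]
  by (intro sum.cong refl) (simp add: algebra_simps)

lemma bform_sym:
  assumes "\<And>i j. i < p \<Longrightarrow> j < p \<Longrightarrow> A i j = A j i"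
  shows "bform p A u v = bform p A v u"
proof -
  have "bform p A u v = (\<Sum>j<p. \<Sum>i<p. A i j * (u i * v j))" unfolding bform_def by (rule sum.swap)
  also have "\<dots> = bform p A v u" unfolding bform_def using assms by (intro sum.cong refl) (simp add: mult.commute)
  finally show ?thesis .
qed

text \<open>Positivity of the form at s u + t v is used with s = b and t = - c. This says nothing
  when b = 0; there a nonzero c is excluded by s = 1 and t = - (a + 1) / (2 c), where the form would
  take the value -1.\<close>

lemma bform_Cauchy_Schwarz:
  assumes sym: "\<And>i j. i < p \<Longrightarrow> j < p \<Longrightarrow> A i j = A j i" and psd: "\<And>u. 0 \<le> bform p A u u"
  shows "(bform p A u v)\<^sup>2 \<le> bform p A u u * bform p A v v"
proof -
  define a b c where abc: "a = bform p A u u" "b = bform p A v v" "c = bform p A u v"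
  have vu: "bform p A v u = c" using bform_sym[OF sym] abc by simp
  have q: "0 \<le> s\<^sup>2 * a + 2 * s * t * c + t\<^sup>2 * b" for s t
    using psd[of "\<lambda>i. s * u i + t * v i"]
    unfolding bform_lin_left bform_lin_right vu abc[symmetric] by (simp add: power2_eq_square algebra_simps)
  show ?thesis
  proof (cases "b = 0")
    case True
    have "c = 0"
    proof (rule ccontr)
      assume "c \<noteq> 0"
      with q[of 1 "- (a + 1) / (2 * c)"] show False by (simp add: True field_simps)
    qed
    then show ?thesis by (simp add: abc[symmetric] True)
  next
    case False
    then have "0 < b" using psd[of v] by (simp add: abc)
    moreover have "0 \<le> b * (a * b - c\<^sup>2)"
      using q[of b "-c"] by (simp add: power2_eq_square algebra_simps)
    ultimately show ?thesis unfolding abc[symmetric] by (simp add: zero_le_mult_iff)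
  qed
qed

lemma bform_image:
  "bform p A u v = (\<Sum>i<p. u i * (\<Sum>j<p. A i j * v j))"
  unfolding bform_def sum_distrib_left by (intro sum.cong refl) (simp add: mult_ac)

text \<open>If 0 \<le> A \<le> I then |A v|^2 \<le> v^T A v, by Cauchy-Schwarz for the form of
  \<open>A\<close> at A v and v. Hence |v - A v|^2 = |v|^2 - 2 v^T A v + |A v|^2 \<le>
  |v|^2.\<close>

lemma psd_contraction:
  assumes sym: "\<And>i j. i < p \<Longrightarrow> j < p \<Longrightarrow> A i j = A j i" and psd: "\<And>u. 0 \<le> bform p A u u"
    and le: "\<And>u. bform p A u u \<le> (\<Sum>i<p. (u i)\<^sup>2)"
  shows "(\<Sum>i<p. (v i - (\<Sum>j<p. A i j * v j))\<^sup>2) \<le> (\<Sum>i<p. (v i)\<^sup>2)"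
proof -
  define u where "u i = (\<Sum>j<p. A i j * v j)" for i
  define s where "s = (\<Sum>i<p. (u i)\<^sup>2)"
  have s: "0 \<le> s" by (auto simp: s_def intro: sum_nonneg)
  have uv: "bform p A u v = s" unfolding bform_image s_def u_def[symmetric] by (simp add: power2_eq_square)
  have "s\<^sup>2 \<le> bform p A u u * bform p A v v"
    using bform_Cauchy_Schwarz[OF sym psd, of u v] by (simp add: uv)
  also have "\<dots> \<le> s * bform p A v v" using le[of u] psd by (intro mult_right_mono) (auto simp: s_def)
  finally have "s * s \<le> s * bform p A v v" by (simp add: power2_eq_square)
  then have "s \<le> bform p A v v" using s psd[of v] by (cases "s = 0") (auto simp: mult_le_cancel_left)
  moreover have "(\<Sum>i<p. (v i - u i)\<^sup>2) = (\<Sum>i<p. (v i)\<^sup>2) - 2 * bform p A v v + s"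
    unfolding bform_image u_def[symmetric] s_def
    by (simp add: power2_diff sum.distrib sum_subtractf sum_distrib_left mult_ac)
  ultimately show ?thesis using psd[of v] unfolding u_def[symmetric] by linarith
qed

section \<open>Matrix powers and the binomial series of the square root\<close>

fun mpow :: "nat \<Rightarrow> (nat \<Rightarrow> nat \<Rightarrow> real) \<Rightarrow> nat \<Rightarrow> nat \<Rightarrow> nat \<Rightarrow> real" where
  "mpow p B 0 i j = (if i = j then 1 else 0)"
| "mpow p B (Suc k) i j = (\<Sum>l<p. B i l * mpow p B k l j)"

lemma mpow_add:
  "i < p \<Longrightarrow> (\<Sum>l<p. mpow p B a i l * mpow p B b l j) = mpow p B (a + b) i j"
proof (induction a arbitrary: i)
  case 0
  then show ?case by (simp add: if_distrib[of "\<lambda>x. x * _"] cong: if_cong)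
next
  case (Suc a)
  have "(\<Sum>l<p. mpow p B (Suc a) i l * mpow p B b l j)
     = (\<Sum>l<p. \<Sum>r<p. B i r * (mpow p B a r l * mpow p B b l j))"
    by (simp add: sum_distrib_left sum_distrib_right mult_ac)
  also have "\<dots> = (\<Sum>r<p. B i r * (\<Sum>l<p. mpow p B a r l * mpow p B b l j))"
    by (subst sum.swap) (simp add: sum_distrib_left)
  also have "\<dots> = (\<Sum>r<p. B i r * mpow p B (a + b) r j)"
    by (intro sum.cong refl) (simp add: Suc.IH)
  finally show ?case by simp
qed

lemma mpow_1: "j < p \<Longrightarrow> mpow p B (Suc 0) i j = B i j"
  by (simp add: if_distrib[of "\<lambda>x. _ * x"] cong: if_cong)

lemma mpow_Suc_right:
  "i < p \<Longrightarrow> j < p \<Longrightarrow> mpow p B (Suc k) i j = (\<Sum>l<p. mpow p B k i l * B l j)"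
  using mpow_add[of i p B k "Suc 0" j] by (simp add: mpow_1 del: mpow.simps(2))

lemma mpow_sym:
  assumes "\<And>i j. i < p \<Longrightarrow> j < p \<Longrightarrow> B i j = B j i"
  shows "i < p \<Longrightarrow> j < p \<Longrightarrow> mpow p B k i j = mpow p B k j i"
proof (induction k arbitrary: i j)
  case (Suc k)
  have "mpow p B (Suc k) i j = (\<Sum>l<p. mpow p B k i l * B l j)" by (rule mpow_Suc_right) fact+
  also have "\<dots> = (\<Sum>l<p. B j l * mpow p B k l i)"
    using Suc assms by (intro sum.cong refl) (simp add: mult.commute)
  finally show ?case by simp
qed auto

lemma mpow_contraction:
  assumes "\<And>v. (\<Sum>i<p. (\<Sum>j<p. B i j * v j)\<^sup>2) \<le> (\<Sum>i<p. (v i)\<^sup>2)"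
  shows "(\<Sum>i<p. (\<Sum>j<p. mpow p B k i j * v j)\<^sup>2) \<le> (\<Sum>i<p. (v i)\<^sup>2)"
proof (induction k)
  case 0
  show ?case by (simp add: if_distrib[of "\<lambda>x. x * _"] cong: if_cong)
next
  case (Suc k)
  have "(\<Sum>j<p. mpow p B (Suc k) i j * v j) = (\<Sum>l<p. B i l * (\<Sum>j<p. mpow p B k l j * v j))" for i
  proof -
    have "(\<Sum>j<p. mpow p B (Suc k) i j * v j) = (\<Sum>j<p. \<Sum>l<p. B i l * (mpow p B k l j * v j))"
      by (simp add: sum_distrib_left sum_distrib_right mult_ac)
    also have "\<dots> = (\<Sum>l<p. B i l * (\<Sum>j<p. mpow p B k l j * v j))"
      by (subst sum.swap) (simp add: sum_distrib_left)
    finally show ?thesis .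
  qed
  then have "(\<Sum>i<p. (\<Sum>j<p. mpow p B (Suc k) i j * v j)\<^sup>2) \<le> (\<Sum>l<p. (\<Sum>j<p. mpow p B k l j * v j)\<^sup>2)"
    using assms[of "\<lambda>l. \<Sum>j<p. mpow p B k l j * v j"] by simp
  with Suc.IH show ?case by linarith
qed

text \<open>An entry is a coordinate of the power applied to a standard basis vector, and powers of
  a contraction are contractions.\<close>

lemma mpow_le_1:
  assumes "\<And>v. (\<Sum>i<p. (\<Sum>j<p. B i j * v j)\<^sup>2) \<le> (\<Sum>i<p. (v i)\<^sup>2)" and ij: "i < p" "j < p"
  shows "\<bar>mpow p B k i j\<bar> \<le> 1"
proof -
  have "(mpow p B k i j)\<^sup>2 \<le> (\<Sum>i<p. (mpow p B k i j)\<^sup>2)" by (rule member_le_sum) (use ij in auto)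
  also have "\<dots> = (\<Sum>i<p. (\<Sum>l<p. mpow p B k i l * (if l = j then 1 else 0))\<^sup>2)"
    using ij by (simp add: if_distrib[of "\<lambda>x. _ * x"] cong: if_cong)
  also have "\<dots> \<le> (\<Sum>i<p. (if i = j then 1 else 0)\<^sup>2)" by (rule mpow_contraction) fact
  also have "\<dots> = 1" using ij by (simp add: if_distrib[of "\<lambda>x. x\<^sup>2"] cong: if_cong)
  finally show ?thesis by (simp add: abs_square_le_1)
qed

text \<open>Taylor coefficients of \<open>sqrt (1 - x)\<close>.\<close>

definition sqrt_coeff :: "nat \<Rightarrow> real" where
  "sqrt_coeff k = (1 / 2 gchoose k) * (- 1) ^ k"

lemma sqrt_coeff_Suc: "sqrt_coeff (Suc k) = sqrt_coeff k * ((real k - 1 / 2) / (real k + 1))"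
proof -
  have 1: "(1 / 2 gchoose Suc k :: real) = (1 / 2 gchoose k) * ((1 / 2 - real k) / (real k + 1))"
    by (simp add: gbinomial_prod_rev field_simps)
  have 2: "(1 / 2 - real k) / (real k + 1) = - 1 * ((real k - 1 / 2) / (real k + 1))"
    by (simp add: divide_simps)
  show ?thesis unfolding sqrt_coeff_def 1 2 power_Suc by (simp only: mult_ac)
qed

text \<open>The two claims need each other: the formula multiplies the partial sum by (2 n + 1) / (2
  n + 2) in each step, so it stays nonnegative, and this in turn fixes the sign of the next
  coefficient.\<close>

lemma sqrt_coeff_partial_sum:
  "sqrt_coeff (Suc n) = - (\<Sum>k\<le>n. sqrt_coeff k) / (2 * (real n + 1)) \<and> 0 \<le> (\<Sum>k\<le>n. sqrt_coeff k)"
proof (induction n)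
  case 0
  show ?case by (simp add: sqrt_coeff_Suc) (simp add: sqrt_coeff_def)
next
  case (Suc n)
  define e where "e = (\<Sum>k\<le>n. sqrt_coeff k)"
  have d: "sqrt_coeff (Suc n) = - e / (2 * (real n + 1))" and e: "0 \<le> e" using Suc by (auto simp: e_def)
  have s: "(\<Sum>k\<le>Suc n. sqrt_coeff k) = e * ((2 * real n + 1) / (2 * (real n + 1)))"
    by (simp add: e_def[symmetric] d field_simps)
  have "- e / (2 * (N + 1)) * ((1 + N - 1 / 2) / (1 + N + 1)) = - (e * ((2 * N + 1) / (2 * (N + 1)))) / (2 * (1 + N + 1))"
    if "0 \<le> N" for N :: real
    using that by (simp add: divide_simps)
  from this[of "real n"] show ?case unfolding s sqrt_coeff_Suc[of "Suc n"] d using e by simp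
qed

text \<open>The coefficients after the first are nonpositive and the partial sums nonnegative, so
  the absolute values of the later ones add up to at most 1. Convergence on the boundary of the unit
  disc matters: a singular \<open>S\<close> makes I - S / t a matrix of norm exactly 1.\<close>

lemma sqrt_coeff_tail:
  shows "summable (\<lambda>k. - sqrt_coeff (Suc k))" "(\<Sum>k. - sqrt_coeff (Suc k)) \<le> 1"
    "sqrt_coeff (Suc k) \<le> 0" "sqrt_coeff 0 = 1"
proof -
  show d0: "sqrt_coeff 0 = 1" by (simp add: sqrt_coeff_def)
  show neg: "sqrt_coeff (Suc k) \<le> 0" for k
    using sqrt_coeff_partial_sum[of k] by (simp add: divide_nonneg_pos)
  have part: "(\<Sum>k<n. - sqrt_coeff (Suc k)) \<le> 1" for n
  proof -
    have "(\<Sum>k\<le>n. sqrt_coeff k) = 1 + (\<Sum>k<n. sqrt_coeff (Suc k))"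
      by (simp add: lessThan_Suc_atMost[symmetric] sum.lessThan_Suc_shift d0 del: sum.lessThan_Suc)
    with sqrt_coeff_partial_sum[of n] show ?thesis by (simp add: sum_negf)
  qed
  show s: "summable (\<lambda>k. - sqrt_coeff (Suc k))"
    by (rule summableI_nonneg_bounded[OF _ part]) (simp add: neg)
  show "(\<Sum>k. - sqrt_coeff (Suc k)) \<le> 1" by (rule suminf_le_const[OF s part])
qed

lemma summable_sqrt_coeff: "summable (\<lambda>k. \<bar>sqrt_coeff k\<bar>)"
proof -
  have "(\<lambda>k. \<bar>sqrt_coeff (Suc k)\<bar>) = (\<lambda>k. - sqrt_coeff (Suc k))" using sqrt_coeff_tail(3) by auto
  then have "summable (\<lambda>k. \<bar>sqrt_coeff (Suc k)\<bar>)" using sqrt_coeff_tail(1) by simp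
  then show ?thesis by (subst (asm) summable_Suc_iff)
qed

text \<open>Vandermonde's identity with both upper arguments 1/2: the square of the series of sqrt
  (1 - x) is 1 - x.\<close>

lemma sqrt_coeff_convolution:
  "(\<Sum>k\<le>n. sqrt_coeff k * sqrt_coeff (n - k)) = (if n = 0 then 1 else if n = 1 then -1 else 0)"
proof -
  have "(\<Sum>k\<le>n. sqrt_coeff k * sqrt_coeff (n - k))
     = (\<Sum>k\<le>n. (1 / 2 gchoose k) * (1 / 2 gchoose (n - k)) * (- 1) ^ n)"
  proof (intro sum.cong refl)
    fix k assume "k \<in> {..n}"
    then have e: "(- 1 :: real) ^ n = (- 1) ^ k * (- 1) ^ (n - k)" by (simp flip: power_add)
    show "sqrt_coeff k * sqrt_coeff (n - k) = (1 / 2 gchoose k) * (1 / 2 gchoose (n - k)) * (- 1) ^ n"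
      unfolding sqrt_coeff_def e by (simp only: mult_ac)
  qed
  also have "\<dots> = (\<Sum>k = 0..n. (1 / 2 gchoose k) * (1 / 2 gchoose (n - k))) * (- 1) ^ n"
    by (simp add: sum_distrib_right atLeast0AtMost)
  also have "\<dots> = (1 gchoose n) * (- 1) ^ n" by (simp add: gbinomial_Vandermonde)
  also have "(1 gchoose n :: real) = of_nat (1 choose n)" by (simp add: binomial_gbinomial)
  also have "of_nat (1 choose n) * (- 1) ^ n = (if n = 0 then 1 else if n = 1 then -1 else (0::real))"
    by (cases n; cases "n - 1") auto
  finally show ?thesis .
qed

definition msqrt :: "nat \<Rightarrow> (nat \<Rightarrow> nat \<Rightarrow> real) \<Rightarrow> nat \<Rightarrow> nat \<Rightarrow> real" where
  "msqrt p B i j = (\<Sum>k. sqrt_coeff k * mpow p B k i j)"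

context
  fixes p :: nat and B :: "nat \<Rightarrow> nat \<Rightarrow> real"
  assumes contr: "\<And>v. (\<Sum>i<p. (\<Sum>j<p. B i j * v j)\<^sup>2) \<le> (\<Sum>i<p. (v i)\<^sup>2)"
begin

lemma summable_msqrt:
  assumes "i < p" "j < p"
  shows "summable (\<lambda>k. norm (sqrt_coeff k * mpow p B k i j))"
proof (rule summable_comparison_test'[OF summable_sqrt_coeff])
  show "norm (norm (sqrt_coeff k * mpow p B k i j)) \<le> \<bar>sqrt_coeff k\<bar>" for k
    using mpow_le_1[OF contr assms] by (simp add: abs_mult mult_left_le)
qed

lemma msqrt_sums:
  assumes "i < p" "j < p"
  shows "(\<lambda>k. sqrt_coeff k * mpow p B k i j) sums msqrt p B i j"
  unfolding msqrt_def by (rule summable_sums[OF summable_norm_cancel[OF summable_msqrt[OF assms]]])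

text \<open>In the Cauchy product of the series with itself only the powers 0 and 1 of
  \<open>B\<close> survive, by \<open>sqrt_coeff_convolution\<close>. Absolute convergence comes
  from the coefficients alone, the entries of the powers being bounded by 1.\<close>

lemma msqrt_square:
  assumes ij: "i < p" "j < p"
  shows "(\<Sum>l<p. msqrt p B i l * msqrt p B l j) = (if i = j then 1 else 0) - B i j"
proof -
  have s: "(\<lambda>n. \<Sum>k\<le>n. (sqrt_coeff k * mpow p B k i l) * (sqrt_coeff (n - k) * mpow p B (n - k) l j))
      sums (msqrt p B i l * msqrt p B l j)" if "l < p" for l
    unfolding msqrt_def using that ij by (intro Cauchy_product_sums summable_msqrt)
  have "(\<lambda>n. \<Sum>l<p. \<Sum>k\<le>n. (sqrt_coeff k * mpow p B k i l) * (sqrt_coeff (n - k) * mpow p B (n - k) l j))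
      sums (\<Sum>l<p. msqrt p B i l * msqrt p B l j)"
    by (intro sums_sum s) auto
  also have "(\<lambda>n. \<Sum>l<p. \<Sum>k\<le>n. (sqrt_coeff k * mpow p B k i l) * (sqrt_coeff (n - k) * mpow p B (n - k) l j))
     = (\<lambda>n. (if n = 0 then 1 else if n = 1 then -1 else 0) * mpow p B n i j)"
  proof
    fix n
    have "(\<Sum>l<p. \<Sum>k\<le>n. (sqrt_coeff k * mpow p B k i l) * (sqrt_coeff (n - k) * mpow p B (n - k) l j))
      = (\<Sum>k\<le>n. \<Sum>l<p. (sqrt_coeff k * mpow p B k i l) * (sqrt_coeff (n - k) * mpow p B (n - k) l j))"
      by (rule sum.swap)
    also have "\<dots> = (\<Sum>k\<le>n. sqrt_coeff k * sqrt_coeff (n - k) * (\<Sum>l<p. mpow p B k i l * mpow p B (n - k) l j))"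
      by (simp add: sum_distrib_left mult_ac)
    also have "\<dots> = (\<Sum>k\<le>n. sqrt_coeff k * sqrt_coeff (n - k) * mpow p B n i j)"
      by (intro sum.cong refl) (simp add: mpow_add[OF ij(1)])
    also have "\<dots> = (if n = 0 then 1 else if n = 1 then -1 else 0) * mpow p B n i j"
      by (simp only: sum_distrib_right[symmetric] sqrt_coeff_convolution)
    finally show "(\<Sum>l<p. \<Sum>k\<le>n. (sqrt_coeff k * mpow p B k i l) * (sqrt_coeff (n - k) * mpow p B (n - k) l j))
      = (if n = 0 then 1 else if n = 1 then -1 else 0) * mpow p B n i j" .
  qed
  finally have 1: "\<dots> sums (\<Sum>l<p. msqrt p B i l * msqrt p B l j)" .
  have "(\<lambda>n. (if n = 0 then 1 else if n = 1 then -1 else 0) * mpow p B n i j)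
    sums (\<Sum>n<2. (if n = 0 then 1 else if n = 1 then -1 else 0) * mpow p B n i j)"
    by (rule sums_finite) auto
  from sums_unique2[OF 1 this] show ?thesis
    using mpow_1[OF ij(2), of B i] by (simp add: eval_nat_numeral del: mpow.simps(2))
qed

text \<open>Every form v^T B^k v is at most |v|^2, its coefficient for k \<ge> 1 is nonpositive, and
  these coefficients sum to at least -1. The tail is therefore at least - |v|^2, which the term k =
  0 compensates.\<close>

lemma msqrt_psd: "0 \<le> bform p (msqrt p B) v v"
proof -
  define s where "s = (\<Sum>i<p. (v i)\<^sup>2)"
  have s: "0 \<le> s" by (auto simp: s_def intro: sum_nonneg)
  have bound: "bform p (mpow p B k) v v \<le> s" for k
  proof -
    have "(bform p (mpow p B k) v v)\<^sup>2 \<le> s * (\<Sum>i<p. (\<Sum>j<p. mpow p B k i j * v j)\<^sup>2)"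
      unfolding bform_image s_def by (rule Cauchy_Schwarz_ineq_sum)
    also have "\<dots> \<le> s * s" unfolding s_def
      by (intro mult_left_mono mpow_contraction contr) (auto intro: sum_nonneg)
    finally have "(bform p (mpow p B k) v v)\<^sup>2 \<le> s\<^sup>2" by (simp add: power2_eq_square)
    then show ?thesis using s by (rule power2_le_imp_le)
  qed
  have "(\<lambda>k. \<Sum>i<p. \<Sum>j<p. sqrt_coeff k * mpow p B k i j * (v i * v j)) sums bform p (msqrt p B) v v"
    unfolding bform_def
  proof (intro sums_sum sums_mult2)
    fix i j assume "i \<in> {..<p}" "j \<in> {..<p}"
    then show "(\<lambda>k. sqrt_coeff k * mpow p B k i j) sums msqrt p B i j" by (intro msqrt_sums) auto
  qed
  also have "(\<lambda>k. \<Sum>i<p. \<Sum>j<p. sqrt_coeff k * mpow p B k i j * (v i * v j))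
     = (\<lambda>k. sqrt_coeff k * bform p (mpow p B k) v v)"
    by (simp add: bform_def sum_distrib_left mult_ac)
  finally have a: "(\<lambda>k. sqrt_coeff k * bform p (mpow p B k) v v) sums bform p (msqrt p B) v v" .
  have b0: "bform p (mpow p B 0) v v = s"
    unfolding bform_image s_def by (simp add: if_distrib[of "\<lambda>x. x * _"] power2_eq_square cong: if_cong)
  have "(\<lambda>k. sqrt_coeff (Suc k) * bform p (mpow p B (Suc k)) v v) sums (bform p (msqrt p B) v v - s)"
    using a unfolding sums_Suc_iff[of "\<lambda>k. sqrt_coeff k * bform p (mpow p B k) v v"]
    by (simp only: b0 sqrt_coeff_tail(4)) simp
  note a1 = this
  have a2: "(\<lambda>k. sqrt_coeff (Suc k) * s) sums ((\<Sum>k. sqrt_coeff (Suc k)) * s)"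
    using summable_minus[OF sqrt_coeff_tail(1)] by (intro sums_mult2 summable_sums) simp
  have "(\<Sum>k. sqrt_coeff (Suc k)) * s \<le> bform p (msqrt p B) v v - s"
    by (rule sums_le[OF _ a2 a1]) (intro mult_left_mono_neg bound sqrt_coeff_tail(3))
  moreover have "-1 \<le> (\<Sum>k. sqrt_coeff (Suc k))"
    using sqrt_coeff_tail(2) suminf_minus[OF summable_minus[OF sqrt_coeff_tail(1)]] by simp
  then have "-1 * s \<le> (\<Sum>k. sqrt_coeff (Suc k)) * s" using s by (intro mult_right_mono) auto
  ultimately show ?thesis by simp
qed

text \<open>A matrix commuting with \<open>B\<close> commutes with its powers and, the sums over
  \<open>l\<close> being finite, with the series. Uniqueness of the root rests on this.\<close>

lemma msqrt_commute:
  assumes R: "\<And>i j. i < p \<Longrightarrow> j < p \<Longrightarrow> (\<Sum>l<p. R i l * B l j) = (\<Sum>l<p. B i l * R l j)"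
    and ij: "i < p" "j < p"
  shows "(\<Sum>l<p. R i l * msqrt p B l j) = (\<Sum>l<p. msqrt p B i l * R l j)"
proof -
  have c: "(\<Sum>l<p. R i l * mpow p B k l j) = (\<Sum>l<p. mpow p B k i l * R l j)" if "i < p" "j < p" for i j k
    using that
  proof (induction k arbitrary: i j)
    case 0
    then show ?case by (simp add: if_distrib[of "\<lambda>x. x * _"] if_distrib[of "\<lambda>x. _ * x"] cong: if_cong)
  next
    case (Suc k)
    have "(\<Sum>l<p. R i l * mpow p B (Suc k) l j) = (\<Sum>l<p. \<Sum>r<p. R i l * B l r * mpow p B k r j)"
      by (simp add: sum_distrib_left mult_ac)
    also have "\<dots> = (\<Sum>r<p. (\<Sum>l<p. R i l * B l r) * mpow p B k r j)"
      by (subst sum.swap) (simp add: sum_distrib_right)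
    also have "\<dots> = (\<Sum>r<p. (\<Sum>l<p. B i l * R l r) * mpow p B k r j)"
      using R[OF Suc.prems(1)] by (intro sum.cong refl) simp
    also have "\<dots> = (\<Sum>r<p. \<Sum>l<p. B i l * (R l r * mpow p B k r j))"
      by (simp add: sum_distrib_left sum_distrib_right mult_ac)
    also have "\<dots> = (\<Sum>l<p. B i l * (\<Sum>r<p. R l r * mpow p B k r j))"
      by (subst sum.swap) (simp add: sum_distrib_left)
    also have "\<dots> = (\<Sum>l<p. B i l * (\<Sum>r<p. mpow p B k l r * R r j))"
      using Suc by (intro sum.cong refl) simp
    also have "\<dots> = (\<Sum>l<p. \<Sum>r<p. B i l * mpow p B k l r * R r j)"
      by (simp add: sum_distrib_left mult_ac)
    also have "\<dots> = (\<Sum>r<p. mpow p B (Suc k) i r * R r j)"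
      by (subst sum.swap) (simp add: sum_distrib_right)
    finally show ?case .
  qed
  have "(\<lambda>k. \<Sum>l<p. R i l * (sqrt_coeff k * mpow p B k l j)) sums (\<Sum>l<p. R i l * msqrt p B l j)"
    using ij(2) by (intro sums_sum sums_mult msqrt_sums) simp_all
  moreover have "(\<lambda>k. \<Sum>l<p. (sqrt_coeff k * mpow p B k i l) * R l j) sums (\<Sum>l<p. msqrt p B i l * R l j)"
    using ij(1) by (intro sums_sum sums_mult2 msqrt_sums) simp_all
  moreover have "(\<Sum>l<p. R i l * (sqrt_coeff k * mpow p B k l j)) = (\<Sum>l<p. (sqrt_coeff k * mpow p B k i l) * R l j)" for k
    using arg_cong[OF c[OF ij, of k], of "(*) (sqrt_coeff k)"] by (simp add: sum_distrib_left mult_ac)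
  ultimately show ?thesis by (simp add: sums_unique2)
qed

end

text \<open>The root is given by the power series of \<open>sqrt (1 - x)\<close> at \<open>I - S / t\<close>, where \<open>t\<close> exceeds the norm
  of \<open>S\<close>. This yields existence, measurability in \<open>S\<close>, and commutation with every matrix commuting with
  \<open>S\<close>, hence uniqueness.\<close>

definition sqrt_scale :: "nat \<Rightarrow> real mat \<Rightarrow> real" where
  "sqrt_scale p S = 1 + (\<Sum>i<p. \<Sum>j<p. \<bar>S $$ (i, j)\<bar>)"

definition sqrt_defect :: "nat \<Rightarrow> real mat \<Rightarrow> nat \<Rightarrow> nat \<Rightarrow> real" where
  "sqrt_defect p S i j = (if i = j then 1 else 0) - S $$ (i, j) / sqrt_scale p S"

definition psd_root :: "nat \<Rightarrow> real mat \<Rightarrow> real mat" where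
  "psd_root p S = mat p p (\<lambda>(i, j). sqrt (sqrt_scale p S) * msqrt p (sqrt_defect p S) i j)"

lemma sqrt_scale_pos: "0 < sqrt_scale p S"
  unfolding sqrt_scale_def by (intro add_pos_nonneg sum_nonneg) auto

lemma psd_root_carrier [simp]: "psd_root p S \<in> carrier_mat p p"
  by (simp add: psd_root_def)

lemma psd_root_dim [simp]: "dim_row (psd_root p S) = p" "dim_col (psd_root p S) = p"
  by (simp_all add: psd_root_def)

text \<open>The sum of all |S_ij| bounds the form of \<open>S\<close> on unit vectors, so 0 \<le> S
  / t \<le> I and \<open>psd_contraction\<close> applies. The summand 1 in \<open>sqrt_scale\<close>
  keeps t positive for S = 0.\<close>

lemma sqrt_defect_contraction:
  assumes S: "sym_psd_mat p S"
  shows "(\<Sum>i<p. (\<Sum>j<p. sqrt_defect p S i j * v j)\<^sup>2) \<le> (\<Sum>i<p. (v i)\<^sup>2)"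
proof -
  define t where "t = sqrt_scale p S"
  have t: "0 < t" unfolding t_def by (rule sqrt_scale_pos)
  define A where "A i j = S $$ (i, j) / t" for i j
  have bf: "bform p A u u = (vec p u \<bullet> (S *\<^sub>v vec p u)) / t" for u
    by (simp add: quad_form_sum[OF sym_psd_matD(1)[OF S]] bform_def A_def sum_divide_distrib)
  have psd: "0 \<le> bform p A u u" for u
    unfolding bf using sym_psd_matD(3)[OF S, of "vec p u"] t by simp
  have le: "bform p A u u \<le> (\<Sum>i<p. (u i)\<^sup>2)" for u
  proof -
    define s where "s = (\<Sum>i<p. (u i)\<^sup>2)"
    have sq: "(u i)\<^sup>2 \<le> s" if "i < p" for i
      unfolding s_def by (rule member_le_sum) (use that in auto)
    have uu: "\<bar>u i * u j\<bar> \<le> s" if "i < p" "j < p" for i j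
      using sq[OF that(1)] sq[OF that(2)] sum_squares_bound[of "\<bar>u i\<bar>" "\<bar>u j\<bar>"]
      by (simp add: abs_mult)
    have s: "0 \<le> s" by (auto simp: s_def intro: sum_nonneg)
    have "(\<Sum>i<p. \<Sum>j<p. S $$ (i, j) * (u i * u j)) \<le> (\<Sum>i<p. \<Sum>j<p. \<bar>S $$ (i, j)\<bar> * s)"
    proof (intro sum_mono)
      fix i j assume "i \<in> {..<p}" "j \<in> {..<p}"
      then have "\<bar>S $$ (i, j) * (u i * u j)\<bar> \<le> \<bar>S $$ (i, j)\<bar> * s"
        unfolding abs_mult[of "S $$ (i, j)"] by (intro mult_left_mono uu) auto
      then show "S $$ (i, j) * (u i * u j) \<le> \<bar>S $$ (i, j)\<bar> * s" by linarith
    qed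
    also have "\<dots> \<le> t * s" using s
      by (simp add: t_def sqrt_scale_def sum_distrib_right[symmetric] distrib_right)
    finally show ?thesis using t
      by (simp add: bform_def A_def s_def sum_divide_distrib[symmetric] field_simps)
  qed
  have "(\<Sum>j<p. sqrt_defect p S i j * v j) = v i - (\<Sum>j<p. A i j * v j)" if "i < p" for i
    using that by (simp add: sqrt_defect_def A_def t_def left_diff_distrib sum_subtractf
        if_distrib[of "\<lambda>x. x * _"] cong: if_cong)
  then show ?thesis
    using psd_contraction[of p A v, OF _ psd le] sym_psd_matD(2)[OF S] by (simp add: A_def)
qed

lemma psd_root:
  assumes S: "sym_psd_mat p S"
  shows "sym_psd_mat p (psd_root p S)" "psd_root p S * psd_root p S = S"
    "R \<in> carrier_mat p p \<Longrightarrow> R * S = S * R \<Longrightarrow> R * psd_root p S = psd_root p S * R"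
proof -
  note Sc = sym_psd_matD(1)[OF S] and contr = sqrt_defect_contraction[OF S]
  define t where "t = sqrt_scale p S"
  have t: "0 < t" unfolding t_def by (rule sqrt_scale_pos)
  define X where "X = psd_root p S"
  define B where "B = sqrt_defect p S"
  have Xc: "X \<in> carrier_mat p p" by (simp add: X_def)
  have Xij: "X $$ (i, j) = sqrt t * msqrt p B i j" if "i < p" "j < p" for i j
    using that by (simp add: X_def psd_root_def t_def B_def)
  have "msqrt p B i j = msqrt p B j i" if "i < p" "j < p" for i j
    unfolding msqrt_def using mpow_sym[of p B i j] that sym_psd_matD(2)[OF S]
    by (simp add: B_def sqrt_defect_def)
  then have "X\<^sup>T = X" using Xc Xij by (intro eq_matI) auto
  moreover have "0 \<le> v \<bullet> (X *\<^sub>v v)" if v: "v \<in> carrier_vec p" for v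
  proof -
    have "v \<bullet> (X *\<^sub>v v) = sqrt t * bform p (msqrt p B) (\<lambda>i. v $ i) (\<lambda>i. v $ i)"
      unfolding quad_form_sum[OF Xc v v] bform_def sum_distrib_left
      by (intro sum.cong refl) (simp add: Xij)
    with msqrt_psd[OF contr] t show ?thesis by (simp add: B_def)
  qed
  ultimately show "sym_psd_mat p (psd_root p S)"
    using Xc by (auto simp: sym_psd_mat_def sym_mat_def X_def)
  show "psd_root p S * psd_root p S = S"
  proof (rule eq_matI)
    fix i j assume "i < dim_row S" "j < dim_col S"
    then have ij: "i < p" "j < p" using Sc by auto
    have "(X * X) $$ (i, j) = (\<Sum>l<p. (sqrt t * msqrt p B i l) * (sqrt t * msqrt p B l j))"
      unfolding mult_mat_sum[OF Xc Xc ij] using ij by (intro sum.cong refl) (simp add: Xij)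
    also have "\<dots> = t * (\<Sum>l<p. msqrt p B i l * msqrt p B l j)"
      unfolding sum_distrib_left using t by (intro sum.cong refl) simp
    also have "\<dots> = S $$ (i, j)"
      unfolding msqrt_square[OF contr ij, folded B_def] using t by (simp add: B_def sqrt_defect_def t_def)
    finally show "(psd_root p S * psd_root p S) $$ (i, j) = S $$ (i, j)" by (simp add: X_def)
  qed (use Sc in simp_all)
  show "R * psd_root p S = psd_root p S * R" if R: "R \<in> carrier_mat p p" and RS: "R * S = S * R"
  proof (rule eq_matI)
    have comm: "(\<Sum>l<p. R $$ (i, l) * B l j) = (\<Sum>l<p. B i l * R $$ (l, j))" if ij: "i < p" "j < p" for i j
    proof -
      have "(\<Sum>l<p. R $$ (i, l) * B l j) = R $$ (i, j) - (R * S) $$ (i, j) / t"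
        unfolding mult_mat_sum[OF R Sc ij] B_def sqrt_defect_def t_def[symmetric] using ij
        by (simp add: right_diff_distrib sum_subtractf sum_divide_distrib if_distrib[of "\<lambda>x. _ * x"] cong: if_cong)
      also have "\<dots> = (\<Sum>l<p. B i l * R $$ (l, j))"
        unfolding RS mult_mat_sum[OF Sc R ij] B_def sqrt_defect_def t_def[symmetric] using ij
        by (simp add: left_diff_distrib sum_subtractf sum_divide_distrib if_distrib[of "\<lambda>x. x * _"] cong: if_cong)
      finally show ?thesis .
    qed
    fix i j assume "i < dim_row (psd_root p S * R)" "j < dim_col (psd_root p S * R)"
    then have ij: "i < p" "j < p" using Xc R by (auto simp: X_def)
    have "(\<Sum>l<p. R $$ (i, l) * msqrt p B l j) = (\<Sum>l<p. msqrt p B i l * R $$ (l, j))"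
      using msqrt_commute[where p = p and B = B and R = "\<lambda>i j. R $$ (i, j)" and i = i and j = j] contr comm ij by (simp add: B_def)
    then have "sqrt t * (\<Sum>l<p. R $$ (i, l) * msqrt p B l j) = sqrt t * (\<Sum>l<p. msqrt p B i l * R $$ (l, j))"
      by simp
    then have "(R * X) $$ (i, j) = (X * R) $$ (i, j)"
      unfolding mult_mat_sum[OF R Xc ij] mult_mat_sum[OF Xc R ij]
      using ij by (simp add: Xij sum_distrib_left mult_ac)
    then show "(R * psd_root p S) $$ (i, j) = (psd_root p S * R) $$ (i, j)" by (simp add: X_def)
  qed (use Xc R in \<open>auto simp: X_def\<close>)
qed

text \<open>Cauchy-Schwarz for the form of \<open>X\<close> at y = X u and u gives |X u|^4 \<le>
  (y^T X y) (u^T X u) = 0.\<close>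

lemma psd_null:
  assumes X: "sym_psd_mat p X" and u: "u \<in> carrier_vec p" and 0: "u \<bullet> (X *\<^sub>v u) = 0"
  shows "X *\<^sub>v u = 0\<^sub>v p"
proof -
  note Xc = sym_psd_matD(1)[OF X]
  define A where "A i j = X $$ (i, j)" for i j
  have bf: "bform p A f h = vec p f \<bullet> (X *\<^sub>v vec p h)" for f h
    by (simp add: quad_form_sum[OF Xc] bform_def A_def)
  define y where "y = X *\<^sub>v u"
  have y: "y \<in> carrier_vec p" using Xc u by (simp add: y_def)
  have vec: "vec p (\<lambda>i. v $ i) = v" if "v \<in> carrier_vec p" for v :: "real vec" using that by auto
  have "(bform p A (\<lambda>i. y $ i) (\<lambda>i. u $ i))\<^sup>2 \<le>
      bform p A (\<lambda>i. y $ i) (\<lambda>i. y $ i) * bform p A (\<lambda>i. u $ i) (\<lambda>i. u $ i)"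
  proof (rule bform_Cauchy_Schwarz)
    show "0 \<le> bform p A f f" for f unfolding bf by (rule sym_psd_matD(3)[OF X]) simp
  qed (simp add: A_def sym_psd_matD(2)[OF X])
  then have "y \<bullet> y = 0" unfolding bf vec[OF u] vec[OF y] 0 by (simp add: y_def)
  then have "(\<Sum>i<p. (y $ i)\<^sup>2) = 0" using y by (simp add: scalar_prod_sum power2_eq_square)
  then have "\<forall>i\<in>{..<p}. (y $ i)\<^sup>2 = 0" by (subst (asm) sum_nonneg_eq_0_iff) auto
  then show ?thesis using y unfolding y_def[symmetric] by (intro eq_vecI) auto
qed

text \<open>\<open>R\<close> commutes with S = R^2, hence with X = \<open>psd_root p S\<close>. For
  u = X v - R v this gives (X + R) u = X^2 v - R^2 v = 0, so the nonnegative numbers u^T X u and u^T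
  R u vanish and X u = R u = 0. By symmetry |u|^2 = (X u)^T v - (R u)^T v = 0.\<close>

lemma psd_root_unique:
  assumes S: "sym_psd_mat p S" and R: "sym_psd_mat p R" and RR: "R * R = S"
  shows "R = psd_root p S"
proof -
  define X where "X = psd_root p S"
  note X = psd_root[OF S, folded X_def]
  note Rc = sym_psd_matD(1)[OF R] and Xc = sym_psd_matD(1)[OF X(1)]
  have "R * S = S * R" using Rc by (simp flip: RR add: assoc_mult_mat)
  note comm = X(3)[OF Rc this]
  have "X *\<^sub>v v = R *\<^sub>v v" if v: "v \<in> carrier_vec p" for v
  proof -
    have Xv: "X *\<^sub>v v \<in> carrier_vec p" and Rv: "R *\<^sub>v v \<in> carrier_vec p" using Xc Rc v by auto
    define u where "u = X *\<^sub>v v - R *\<^sub>v v"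
    have u: "u \<in> carrier_vec p" using Xv Rv by (simp add: u_def)
    have XX: "X *\<^sub>v (X *\<^sub>v v) = S *\<^sub>v v" and RRv: "R *\<^sub>v (R *\<^sub>v v) = S *\<^sub>v v"
      using X(2) RR Xc Rc v by (simp_all flip: assoc_mult_mat_vec)
    have XR: "X *\<^sub>v (R *\<^sub>v v) = R *\<^sub>v (X *\<^sub>v v)"
      using comm Xc Rc v by (simp flip: assoc_mult_mat_vec)
    have Xu: "X *\<^sub>v u = S *\<^sub>v v - X *\<^sub>v (R *\<^sub>v v)"
      unfolding u_def using mult_minus_distrib_mat_vec[OF Xc Xv Rv] XX by simp
    have Ru: "R *\<^sub>v u = X *\<^sub>v (R *\<^sub>v v) - S *\<^sub>v v"
      unfolding u_def using mult_minus_distrib_mat_vec[OF Rc Xv Rv] RRv XR by simp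
    have XRv: "X *\<^sub>v (R *\<^sub>v v) \<in> carrier_vec p" and Sv: "S *\<^sub>v v \<in> carrier_vec p"
      using Xc Rv sym_psd_matD(1)[OF S] v by auto
    have "a - b + (b - a) = 0\<^sub>v p" if "a \<in> carrier_vec p" "b \<in> carrier_vec p" for a b :: "real vec"
      using that by (intro eq_vecI) auto
    from this[OF Sv XRv] have sum0: "X *\<^sub>v u + R *\<^sub>v u = 0\<^sub>v p" unfolding Xu Ru .
    have "u \<bullet> (X *\<^sub>v u) + u \<bullet> (R *\<^sub>v u) = u \<bullet> (X *\<^sub>v u + R *\<^sub>v u)"
      using scalar_prod_add_distrib[OF u mult_mat_vec_carrier[OF Xc u] mult_mat_vec_carrier[OF Rc u]] by simp
    also have "\<dots> = 0" unfolding sum0 using u by simp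
    finally have "u \<bullet> (X *\<^sub>v u) + u \<bullet> (R *\<^sub>v u) = 0" .
    with sym_psd_matD(3)[OF X(1) u] sym_psd_matD(3)[OF R u]
    have "u \<bullet> (X *\<^sub>v u) = 0" "u \<bullet> (R *\<^sub>v u) = 0" by auto
    then have X0: "X *\<^sub>v u = 0\<^sub>v p" and R0: "R *\<^sub>v u = 0\<^sub>v p"
      using psd_null[OF X(1) u] psd_null[OF R u] by auto
    have tr: "u \<bullet> (A *\<^sub>v v) = 0" if A: "sym_psd_mat p A" and A0: "A *\<^sub>v u = 0\<^sub>v p" for A
    proof -
      note Ac = sym_psd_matD(1)[OF A]
      have "u \<bullet> (A *\<^sub>v v) = (\<Sum>i<p. \<Sum>j<p. A $$ (i, j) * (u $ i * v $ j))" by (rule quad_form_sum[OF Ac u v])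
      also have "\<dots> = (\<Sum>j<p. \<Sum>i<p. A $$ (i, j) * (u $ i * v $ j))" by (rule sum.swap)
      also have "\<dots> = (\<Sum>j<p. \<Sum>i<p. A $$ (j, i) * (v $ j * u $ i))"
        using sym_psd_matD(2)[OF A] by (intro sum.cong refl) (simp add: mult.commute)
      also have "\<dots> = v \<bullet> (A *\<^sub>v u)" by (rule quad_form_sum[OF Ac v u, symmetric])
      finally show ?thesis using A0 v by simp
    qed
    have "u \<bullet> u = u \<bullet> (X *\<^sub>v v) - u \<bullet> (R *\<^sub>v v)"
      using u Xv Rv by (subst (2) u_def) (simp add: scalar_prod_minus_distrib)
    also have "\<dots> = 0" using tr[OF X(1) X0] tr[OF R R0] by simp
    finally have "(\<Sum>i<p. (u $ i)\<^sup>2) = 0" using u by (simp add: scalar_prod_sum power2_eq_square)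
    then have "\<forall>i\<in>{..<p}. (u $ i)\<^sup>2 = 0" by (subst (asm) sum_nonneg_eq_0_iff) auto
    then have ui: "u $ i = 0" if "i < p" for i using that by simp
    show ?thesis
    proof (rule eq_vecI)
      fix i assume "i < dim_vec (R *\<^sub>v v)"
      then have "i < p" using Rc by simp
      with ui show "(X *\<^sub>v v) $ i = (R *\<^sub>v v) $ i"
        using index_minus_vec(1)[of i "R *\<^sub>v v" "X *\<^sub>v v"] carrier_vecD[OF Rv] \<open>i < p\<close>
        by (simp add: u_def del: index_mult_mat_vec)
    qed (use Xc Rc in auto)
  qed
  then have e: "X *\<^sub>v unit_vec p j = R *\<^sub>v unit_vec p j" for j by simp
  show ?thesis unfolding X_def[symmetric]
  proof (rule eq_matI)
    fix i j assume "i < dim_row X" "j < dim_col X"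
    then have ij: "i < p" "j < p" using Xc by auto
    have "(A *\<^sub>v unit_vec p j) $ i = A $$ (i, j)" if "A \<in> carrier_mat p p" for A :: "real mat"
      unfolding mult_mat_vec_sum[OF that unit_vec_carrier ij(1)] using ij
      by (simp add: unit_vec_def if_distrib[of "\<lambda>x. _ * x"] cong: if_cong)
    from this[OF Xc] this[OF Rc] e[of j] show "R $$ (i, j) = X $$ (i, j)" by simp
  qed (use Xc Rc in auto)
qed

lemma psd_sqrt_eq:
  assumes S: "sym_psd_mat p S"
  shows "psd_sqrt S = psd_root p S"
proof -
  have d: "dim_row S = p" using sym_psd_matD(1)[OF S] by simp
  show ?thesis unfolding psd_sqrt_def d
  proof (rule the_equality)
    show "sym_psd_mat p (psd_root p S) \<and> psd_root p S * psd_root p S = S"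
      by (rule conjI[OF psd_root(1,2)[OF S]])
    show "R = psd_root p S" if "sym_psd_mat p R \<and> R * R = S" for R
      by (rule psd_root_unique[OF S conjunct1[OF that] conjunct2[OF that]])
  qed
qed

text \<open>Up to the factor sqrt t each entry is a series of polynomials in the entries of
  \<open>S\<close> and 1 / t. Measurability is claimed on all matrices, also where the series may
  diverge and \<open>suminf\<close> carries no information.\<close>

lemma measurable_psd_root: "psd_root p \<in> measurable (mat_borel p p) (mat_borel p p)"
proof -
  have S: "(\<lambda>S. S $$ (i, j)) \<in> borel_measurable (mat_borel p p)" if "i < p" "j < p" for i j
    using measurable_mat_index[OF measurable_ident that] by simp
  have t: "sqrt_scale p \<in> borel_measurable (mat_borel p p)"
    unfolding sqrt_scale_def[abs_def] using S by (intro borel_measurable_add borel_measurable_sum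
      borel_measurable_abs borel_measurable_const) auto
  have B: "(\<lambda>S. sqrt_defect p S i j) \<in> borel_measurable (mat_borel p p)" if "i < p" "j < p" for i j
    unfolding sqrt_defect_def by (intro borel_measurable_diff borel_measurable_divide borel_measurable_const S t that)
  have m: "(\<lambda>S. mpow p (sqrt_defect p S) k i j) \<in> borel_measurable (mat_borel p p)" if "i < p" "j < p" for i j k
    using that
  proof (induction k arbitrary: i)
    case (Suc k)
    then show ?case by (simp, intro borel_measurable_sum borel_measurable_times B) auto
  qed simp
  have "(\<lambda>S. sqrt (sqrt_scale p S) * msqrt p (sqrt_defect p S) i j) \<in> borel_measurable (mat_borel p p)"
    if "i < p" "j < p" for i j
    unfolding msqrt_def
    by (intro borel_measurable_times measurable_compose[OF t borel_measurable_sqrt] borel_measurable_suminf borel_measurable_const m that)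
  then show ?thesis unfolding measurable_mat_borel_iff by (auto simp: psd_root_def)
qed

section \<open>Gaussian quadratic forms\<close>

lemma mat_trace_mult_sum:
  fixes X Y :: "real mat"
  assumes "X \<in> carrier_mat p p" "Y \<in> carrier_mat p p"
  shows "mat_trace (X * Y) = (\<Sum>i<p. \<Sum>k<p. X $$ (i, k) * Y $$ (k, i))"
  using carrier_matD(1)[OF assms(1)] unfolding mat_trace_def
  by (simp add: mult_mat_sum[OF assms] del: index_mult_mat(1))

lemma mat_trace_comm:
  fixes X Y :: "real mat"
  assumes "X \<in> carrier_mat p p" "Y \<in> carrier_mat p p"
  shows "mat_trace (X * Y) = mat_trace (Y * X)"
  unfolding mat_trace_mult_sum[OF assms] mat_trace_mult_sum[OF assms(2,1)]
  by (subst sum.swap) (simp add: mult.commute)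

text \<open>The form of \<open>A\<close> at T v is the form of B = T A T at v, so a Gaussian form in
  T v is governed by tr B and the Frobenius norm of B. By cyclicity tr B = tr(s A) and tr(B B) =
  tr(G G) with G = A s. The latter is at most the squared Frobenius norm of G, which is bounded
  column by column.\<close>

lemma sandwich_facts:
  assumes T: "sym_psd_mat p T" and s: "T * T = s" and A: "bounded_sym p C A"
  defines "B \<equiv> T * A * T"
  shows "B \<in> carrier_mat p p" "\<And>i j. i < p \<Longrightarrow> j < p \<Longrightarrow> B $$ (i, j) = B $$ (j, i)"
    "\<And>v. v \<in> carrier_vec p \<Longrightarrow> qform A (T *\<^sub>v v) = (\<Sum>i<p. \<Sum>j<p. B $$ (i, j) * (v $ i * v $ j))"
    "(\<Sum>i<p. B $$ (i, i)) = mat_trace (s * A)"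
    "(\<Sum>i<p. \<Sum>j<p. (B $$ (i, j))\<^sup>2) \<le> C\<^sup>2 * mat_trace (s * s)"
proof -
  note Tc = sym_psd_matD(1)[OF T]
  have Ac: "A \<in> carrier_mat p p" and At: "A\<^sup>T = A" using A by (auto simp: bounded_sym_def sym_mat_def)
  have Tt: "T\<^sup>T = T" using T by (auto simp: sym_psd_mat_def sym_mat_def)
  have sc: "s \<in> carrier_mat p p" and st: "s\<^sup>T = s" using Tc Tt by (auto simp: s[symmetric] transpose_mult)
  show Bc: "B \<in> carrier_mat p p" using Tc Ac by (simp add: B_def)
  have "B\<^sup>T = B" unfolding B_def using Tc Ac
    by (simp add: transpose_mult[of _ p p _ p] Tt At assoc_mult_mat[of _ p p _ p _ p])
  then show Bsym: "B $$ (i, j) = B $$ (j, i)" if "i < p" "j < p" for i j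
    using that Bc index_transpose_mat(1)[of i B j] by simp
  show "qform A (T *\<^sub>v v) = (\<Sum>i<p. \<Sum>j<p. B $$ (i, j) * (v $ i * v $ j))" if v: "v \<in> carrier_vec p" for v
  proof -
    have Tv: "T *\<^sub>v v \<in> carrier_vec p" and ATv: "A *\<^sub>v (T *\<^sub>v v) \<in> carrier_vec p" using Tc Ac v by auto
    have "(T *\<^sub>v v) \<bullet> (A *\<^sub>v (T *\<^sub>v v)) = v \<bullet> (T *\<^sub>v (A *\<^sub>v (T *\<^sub>v v)))"
      using transpose_vec_mult_scalar[OF Tc ATv v] Tt
        comm_scalar_prod[OF Tv ATv] comm_scalar_prod[OF v mult_mat_vec_carrier[OF Tc ATv]] by simp
    also have "T *\<^sub>v (A *\<^sub>v (T *\<^sub>v v)) = B *\<^sub>v v"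
      unfolding B_def using Tc Ac v by (simp add: assoc_mult_mat_vec[of _ p p _ p])
    finally show ?thesis unfolding qform_def quad_form_sum[OF Bc v v] .
  qed
  have "(\<Sum>i<p. B $$ (i, i)) = mat_trace (T * A * T)" using Tc by (simp add: mat_trace_def B_def)
  also have "\<dots> = mat_trace (T * (T * A))" using Tc Ac by (intro mat_trace_comm) auto
  also have "T * (T * A) = s * A" using Tc Ac by (simp add: s[symmetric] assoc_mult_mat[of _ p p _ p _ p])
  finally show "(\<Sum>i<p. B $$ (i, i)) = mat_trace (s * A)" .
  define G where "G = A * s"
  have Gc: "G \<in> carrier_mat p p" using Ac sc by (simp add: G_def)
  have "(\<Sum>i<p. \<Sum>j<p. (B $$ (i, j))\<^sup>2) = mat_trace (B * B)"
    unfolding mat_trace_mult_sum[OF Bc Bc] using Bsym by (simp add: power2_eq_square)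
  also have "B * B = T * (A * s * A * T)"
    unfolding B_def s[symmetric] using Tc Ac by (simp add: assoc_mult_mat[of _ p p _ p _ p])
  also have "mat_trace \<dots> = mat_trace (A * s * A * T * T)"
    using Tc Ac sc by (intro mat_trace_comm) auto
  also have "A * s * A * T * T = G * G"
    unfolding G_def s[symmetric] using Tc Ac by (simp add: assoc_mult_mat[of _ p p _ p _ p])
  also have "mat_trace (G * G) = (\<Sum>i<p. \<Sum>k<p. G $$ (i, k) * G $$ (k, i))"
    by (rule mat_trace_mult_sum[OF Gc Gc])
  also have "\<dots> \<le> (\<Sum>i<p. \<Sum>k<p. ((G $$ (i, k))\<^sup>2 + (G $$ (k, i))\<^sup>2) / 2)"
  proof (intro sum_mono)
    show "G $$ (i, k) * G $$ (k, i) \<le> ((G $$ (i, k))\<^sup>2 + (G $$ (k, i))\<^sup>2) / 2" for i k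
      using sum_squares_bound[of "G $$ (i, k)" "G $$ (k, i)"] by simp
  qed
  also have "\<dots> = ((\<Sum>i<p. \<Sum>k<p. (G $$ (i, k))\<^sup>2) + (\<Sum>i<p. \<Sum>k<p. (G $$ (k, i))\<^sup>2)) / 2"
    by (simp add: sum.distrib sum_divide_distrib[symmetric])
  also have "(\<Sum>i<p. \<Sum>k<p. (G $$ (i, k))\<^sup>2) = (\<Sum>i<p. \<Sum>k<p. (G $$ (k, i))\<^sup>2)" by (rule sum.swap)
  also have "((\<Sum>i<p. \<Sum>k<p. (G $$ (k, i))\<^sup>2) + (\<Sum>i<p. \<Sum>k<p. (G $$ (k, i))\<^sup>2)) / 2
    = (\<Sum>i<p. \<Sum>k<p. (G $$ (k, i))\<^sup>2)" by simp
  also have "\<dots> \<le> (\<Sum>i<p. C\<^sup>2 * (\<Sum>k<p. (s $$ (k, i))\<^sup>2))"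
  proof (intro sum_mono)
    fix i assume "i \<in> {..<p}"
    then have i: "i < p" by simp
    have c: "col s i \<in> carrier_vec p" using sc i by simp
    have "G $$ (k, i) = (A *\<^sub>v col s i) $ k" if "k < p" for k
      unfolding G_def using Ac sc i that by simp
    then have "(\<Sum>k<p. (G $$ (k, i))\<^sup>2) = (A *\<^sub>v col s i) \<bullet> (A *\<^sub>v col s i)"
      using mult_mat_vec_carrier[OF Ac c] by (simp add: scalar_prod_sum power2_eq_square del: index_mult_mat_vec)
    also have "\<dots> \<le> C\<^sup>2 * (col s i \<bullet> col s i)" using A c by (auto simp: bounded_sym_def)
    also have "col s i \<bullet> col s i = (\<Sum>k<p. (s $$ (k, i))\<^sup>2)"
      unfolding scalar_prod_sum[OF c] using sc i by (simp add: power2_eq_square)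
    finally show "(\<Sum>k<p. (G $$ (k, i))\<^sup>2) \<le> C\<^sup>2 * (\<Sum>k<p. (s $$ (k, i))\<^sup>2)" .
  qed
  also have "\<dots> = C\<^sup>2 * mat_trace (s * s)"
  proof -
    have "s $$ (k, i) = s $$ (i, k)" if "i < p" "k < p" for i k
      using st that sc index_transpose_mat(1)[of i s k] by simp
    then have "(\<Sum>i<p. \<Sum>k<p. (s $$ (k, i))\<^sup>2) = mat_trace (s * s)"
      unfolding mat_trace_mult_sum[OF sc sc] by (simp add: power2_eq_square)
    then show ?thesis by (simp add: sum_distrib_left[symmetric])
  qed
  finally show "(\<Sum>i<p. \<Sum>j<p. (B $$ (i, j))\<^sup>2) \<le> C\<^sup>2 * mat_trace (s * s)" .
qed

section \<open>Moments of independent standard normal variables\<close>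

text \<open>Allows a monomial with possibly coinciding indices to be written as a product of powers
  of distinct independent variables.\<close>

lemma prod_power_of_bool:
  fixes f :: "nat \<Rightarrow> real"
  assumes "b < n"
  shows "(\<Prod>a<n. f a ^ of_bool (a = b)) = f b"
proof -
  have "(\<Prod>a<n. f a ^ of_bool (a = b)) = (\<Prod>a<n. if a = b then f a else 1)"
    by (intro prod.cong) auto
  then show ?thesis using assms by simp
qed

definition normal_moment :: "nat \<Rightarrow> real" where
  "normal_moment k = (\<integral>x. std_normal_density x * x ^ k \<partial>lborel)"

lemma normal_moment_small:
  "normal_moment 0 = 1" "normal_moment (Suc 0) = 0" "normal_moment 2 = 1" "normal_moment 3 = 0"
  "normal_moment 4 = 3"
  using integral_std_normal_moment_even[of 0] integral_std_normal_moment_even[of 1]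
    integral_std_normal_moment_even[of 2] integral_std_normal_moment_odd[of 0]
    integral_std_normal_moment_odd[of 1]
  by (simp_all add: normal_moment_def fact_numeral)

context prob_space
begin

context
  fixes X :: "nat \<Rightarrow> 'a \<Rightarrow> real" and n :: nat
  assumes indep: "indep_vars (\<lambda>_. borel) X {..<n}"
    and dist: "\<And>i. i < n \<Longrightarrow> distributed M lborel (X i) std_normal_density"
begin

lemma normal_product_moment:
  "has_bochner_integral M (\<lambda>\<omega>. \<Prod>a<n. X a \<omega> ^ c a) (\<Prod>a<n. normal_moment (c a))"
proof -
  have i: "integrable M (\<lambda>\<omega>. X a \<omega> ^ c a)" if "a < n" for a
    using distributed_integrable[OF dist[OF that], of "\<lambda>x. x ^ c a"] integrable_std_normal_moment
    by simp
  have e: "(\<integral>\<omega>. X a \<omega> ^ c a \<partial>M) = normal_moment (c a)" if "a < n" for a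
    using distributed_integral[OF dist[OF that], of "\<lambda>x. x ^ c a"] by (simp add: normal_moment_def)
  have ind: "indep_vars (\<lambda>_. borel) (\<lambda>a \<omega>. X a \<omega> ^ c a) {..<n}"
    by (rule indep_vars_compose2[OF indep]) auto
  show ?thesis
    unfolding has_bochner_integral_iff
    using indep_vars_integrable[OF finite_lessThan ind] indep_vars_lebesgue_integral[OF finite_lessThan ind] i e
    by simp
qed

text \<open>Isserlis' formula for four factors. The exponent \<open>c a\<close> counts how often
  \<open>a\<close> occurs among the indices; the moments 0, 1, 0, 3 of orders 1 to 4 then settle
  every pattern of coincidences.\<close>

lemma normal_fourth_moment:
  assumes "i < n" "j < n" "k < n" "l < n"
  shows "has_bochner_integral M (\<lambda>\<omega>. (X i \<omega> * X j \<omega>) * (X k \<omega> * X l \<omega>))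
    (of_bool (i = j \<and> k = l) + of_bool (i = k \<and> j = l) + of_bool (i = l \<and> j = k))"
proof -
  define c :: "nat \<Rightarrow> nat" where "c a = of_bool (a = i) + of_bool (a = j) + of_bool (a = k) + of_bool (a = l)" for a
  have 1: "(\<Prod>a<n. X a \<omega> ^ c a) = (X i \<omega> * X j \<omega>) * (X k \<omega> * X l \<omega>)" for \<omega>
    unfolding c_def power_add prod.distrib by (simp only: prod_power_of_bool assms mult.assoc)
  have "(\<Prod>a<n. normal_moment (c a)) = (\<Prod>a\<in>{i, j, k, l}. normal_moment (c a))"
    by (rule prod.mono_neutral_right) (use assms in \<open>auto simp: c_def normal_moment_small\<close>)
  also have "\<dots> = of_bool (i = j \<and> k = l) + of_bool (i = k \<and> j = l) + of_bool (i = l \<and> j = k)"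
  proof -
    have s: "normal_moment (Suc (Suc 0)) = 1" "normal_moment (Suc (Suc (Suc 0))) = 0"
      "normal_moment (Suc (Suc (Suc (Suc 0)))) = 3"
      using normal_moment_small(3-5) by (simp_all add: eval_nat_numeral)
    show ?thesis
      by (cases "i = j"; cases "i = k"; cases "i = l"; cases "j = k"; cases "j = l"; cases "k = l")
        (simp_all add: c_def normal_moment_small s prod.insert_if del: prod.insert)
  qed
  finally show ?thesis using normal_product_moment[of c] unfolding 1 by simp
qed

lemma normal_second_moment:
  assumes "i < n" "j < n"
  shows "has_bochner_integral M (\<lambda>\<omega>. X i \<omega> * X j \<omega>) (of_bool (i = j))"
proof -
  define c :: "nat \<Rightarrow> nat" where "c a = of_bool (a = i) + of_bool (a = j)" for a
  have 1: "(\<Prod>a<n. X a \<omega> ^ c a) = X i \<omega> * X j \<omega>" for \<omega>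
    unfolding c_def power_add prod.distrib by (simp only: prod_power_of_bool assms mult.assoc)
  have "(\<Prod>a<n. normal_moment (c a)) = (\<Prod>a\<in>{i, j}. normal_moment (c a))"
    by (rule prod.mono_neutral_right) (use assms in \<open>auto simp: c_def normal_moment_small\<close>)
  also have "\<dots> = of_bool (i = j)"
  proof -
    have s: "normal_moment (Suc (Suc 0)) = 1"
      using normal_moment_small(3) by (simp_all add: eval_nat_numeral)
    show ?thesis by (cases "i = j") (simp_all add: c_def normal_moment_small s)
  qed
  finally show ?thesis using normal_product_moment[of c] unfolding 1 by simp
qed

lemma normal_linear_second_moment:
  "has_bochner_integral M (\<lambda>\<omega>. (\<Sum>i<n. b i * X i \<omega>)\<^sup>2) (\<Sum>i<n. (b i)\<^sup>2)"
proof -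
  have "has_bochner_integral M (\<lambda>\<omega>. \<Sum>i<n. \<Sum>j<n. (b i * b j) * (X i \<omega> * X j \<omega>))
     (\<Sum>i<n. \<Sum>j<n. (b i * b j) * of_bool (i = j))"
    by (intro has_bochner_integral_sum has_bochner_integral_mult_right normal_second_moment) auto
  also have "(\<lambda>\<omega>. \<Sum>i<n. \<Sum>j<n. (b i * b j) * (X i \<omega> * X j \<omega>)) = (\<lambda>\<omega>. (\<Sum>i<n. b i * X i \<omega>)\<^sup>2)"
    by (simp add: power2_eq_square sum_product mult_ac)
  also have "(\<Sum>i<n. \<Sum>j<n. (b i * b j) * of_bool (i = j)) = (\<Sum>i<n. (b i)\<^sup>2)"
    by (intro sum.cong refl) (simp add: of_bool_def if_distrib[of "\<lambda>x. _ * x"] power2_eq_square cong: if_cong)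
  finally show ?thesis .
qed

text \<open>In the mean of Q^2 the pairing i = j, k = l gives (tr B)^2, and each of the other two
  gives the squared Frobenius norm, the last one through symmetry of \<open>B\<close>. Subtracting
  (tr B)^2 leaves twice that norm.\<close>

lemma normal_quadratic_variance:
  assumes sym: "\<And>i j. i < n \<Longrightarrow> j < n \<Longrightarrow> B i j = B j i"
  shows "has_bochner_integral M (\<lambda>\<omega>. ((\<Sum>i<n. \<Sum>j<n. B i j * (X i \<omega> * X j \<omega>)) - (\<Sum>i<n. B i i))\<^sup>2)
     (2 * (\<Sum>i<n. \<Sum>j<n. (B i j)\<^sup>2))"
proof -
  define Q where "Q \<omega> = (\<Sum>i<n. \<Sum>j<n. B i j * (X i \<omega> * X j \<omega>))" for \<omega>
  define t where "t = (\<Sum>i<n. B i i)"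
  have "has_bochner_integral M Q (\<Sum>i<n. \<Sum>j<n. B i j * of_bool (i = j))"
    unfolding Q_def[abs_def]
    by (intro has_bochner_integral_sum has_bochner_integral_mult_right normal_second_moment) auto
  also have "(\<Sum>i<n. \<Sum>j<n. B i j * of_bool (i = j)) = t"
    unfolding t_def by (intro sum.cong refl) (simp add: of_bool_def if_distrib[of "\<lambda>x. _ * x"] cong: if_cong)
  finally have E1: "has_bochner_integral M Q t" .
  have "has_bochner_integral M (\<lambda>\<omega>. \<Sum>i<n. \<Sum>j<n. \<Sum>k<n. \<Sum>l<n. (B i j * B k l) * ((X i \<omega> * X j \<omega>) * (X k \<omega> * X l \<omega>)))
     (\<Sum>i<n. \<Sum>j<n. \<Sum>k<n. \<Sum>l<n. (B i j * B k l) *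
       (of_bool (i = j \<and> k = l) + of_bool (i = k \<and> j = l) + of_bool (i = l \<and> j = k)))"
    by (intro has_bochner_integral_sum has_bochner_integral_mult_right normal_fourth_moment) auto
  also have "(\<lambda>\<omega>. \<Sum>i<n. \<Sum>j<n. \<Sum>k<n. \<Sum>l<n. (B i j * B k l) * ((X i \<omega> * X j \<omega>) * (X k \<omega> * X l \<omega>)))
     = (\<lambda>\<omega>. (Q \<omega>)\<^sup>2)"
  proof
    fix \<omega>
    have "(Q \<omega>)\<^sup>2 = (\<Sum>i<n. \<Sum>j<n. (B i j * (X i \<omega> * X j \<omega>)) * Q \<omega>)"
      unfolding power2_eq_square by (subst (1) Q_def) (simp only: sum_distrib_right)
    also have "\<dots> = (\<Sum>i<n. \<Sum>j<n. \<Sum>k<n. \<Sum>l<n. (B i j * B k l) * ((X i \<omega> * X j \<omega>) * (X k \<omega> * X l \<omega>)))"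
      by (intro sum.cong refl) (simp add: Q_def sum_distrib_left mult_ac)
    finally show "(\<Sum>i<n. \<Sum>j<n. \<Sum>k<n. \<Sum>l<n. (B i j * B k l) * ((X i \<omega> * X j \<omega>) * (X k \<omega> * X l \<omega>))) = (Q \<omega>)\<^sup>2" ..
  qed
  also have "(\<Sum>i<n. \<Sum>j<n. \<Sum>k<n. \<Sum>l<n. (B i j * B k l) *
       (of_bool (i = j \<and> k = l) + of_bool (i = k \<and> j = l) + of_bool (i = l \<and> j = k)))
     = t\<^sup>2 + 2 * (\<Sum>i<n. \<Sum>j<n. (B i j)\<^sup>2)"
  proof -
    have inner: "(\<Sum>k<n. \<Sum>l<n. (B i j * B k l) *
       (of_bool (i = j \<and> k = l) + of_bool (i = k \<and> j = l) + of_bool (i = l \<and> j = k)))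
      = of_bool (i = j) * B i j * t + 2 * (B i j)\<^sup>2" if ij: "i < n" "j < n" for i j
    proof -
      have d: "(\<Sum>k<n. \<Sum>l<n. f k l * of_bool (a = k \<and> b = l)) = f a b" if "a < n" "b < n" for a b and f :: "nat \<Rightarrow> nat \<Rightarrow> real"
      proof -
        have "(\<Sum>k<n. \<Sum>l<n. f k l * of_bool (a = k \<and> b = l)) = (\<Sum>k<n. if a = k then (\<Sum>l<n. if b = l then f k l else 0) else 0)"
          by (intro sum.cong refl) (auto intro!: sum.cong sum.neutral)
        then show ?thesis using that by simp
      qed
      have bools: "x * (of_bool (a \<and> b) + of_bool (c \<and> d) + of_bool (e \<and> f))
          = of_bool a * (x * of_bool b) + x * of_bool (c \<and> d) + x * of_bool (f \<and> e)" for a b c d e f and x :: real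
        by (simp only: of_bool_conj distrib_left mult_ac)
      have d2: "(\<Sum>k<n. \<Sum>l<n. f k l * of_bool (k = l)) = (\<Sum>k<n. f k k)" for f :: "nat \<Rightarrow> nat \<Rightarrow> real"
        by (intro sum.cong refl) (simp add: of_bool_def if_distrib[of "\<lambda>x. _ * x"] cong: if_cong)
      have "(\<Sum>k<n. \<Sum>l<n. (B i j * B k l) *
       (of_bool (i = j \<and> k = l) + of_bool (i = k \<and> j = l) + of_bool (i = l \<and> j = k)))
       = of_bool (i = j) * (\<Sum>k<n. \<Sum>l<n. (B i j * B k l) * of_bool (k = l))
        + (\<Sum>k<n. \<Sum>l<n. (B i j * B k l) * of_bool (i = k \<and> j = l))
        + (\<Sum>k<n. \<Sum>l<n. (B i j * B k l) * of_bool (j = k \<and> i = l))"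
        unfolding sum_distrib_left sum.distrib[symmetric]
        by (intro sum.cong refl) (rule bools)
      also have "\<dots> = of_bool (i = j) * (\<Sum>k<n. B i j * B k k) + B i j * B i j + B i j * B j i"
        unfolding d[OF ij] d[OF ij(2,1)] d2 ..
      also have "\<dots> = of_bool (i = j) * B i j * t + 2 * (B i j)\<^sup>2"
        using sym[OF ij] by (simp add: t_def sum_distrib_left[symmetric] power2_eq_square)
      finally show ?thesis .
    qed
    have "(\<Sum>i<n. \<Sum>j<n. \<Sum>k<n. \<Sum>l<n. (B i j * B k l) *
       (of_bool (i = j \<and> k = l) + of_bool (i = k \<and> j = l) + of_bool (i = l \<and> j = k)))
      = (\<Sum>i<n. \<Sum>j<n. of_bool (i = j) * B i j * t + 2 * (B i j)\<^sup>2)"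
      by (intro sum.cong refl inner) auto
    also have "\<dots> = (\<Sum>i<n. B i i * t) + 2 * (\<Sum>i<n. \<Sum>j<n. (B i j)\<^sup>2)"
      by (simp add: sum.distrib sum_distrib_left of_bool_def if_distrib[of "\<lambda>x. x * _"] cong: if_cong)
    finally show ?thesis by (simp add: t_def sum_distrib_right[symmetric] power2_eq_square)
  qed
  finally have E2: "has_bochner_integral M (\<lambda>\<omega>. (Q \<omega>)\<^sup>2) (t\<^sup>2 + 2 * (\<Sum>i<n. \<Sum>j<n. (B i j)\<^sup>2))" .
  have "has_bochner_integral M (\<lambda>\<omega>. (Q \<omega>)\<^sup>2 - 2 * t * Q \<omega> + t\<^sup>2)
    (t\<^sup>2 + 2 * (\<Sum>i<n. \<Sum>j<n. (B i j)\<^sup>2) - 2 * t * t + t\<^sup>2)"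
    by (intro has_bochner_integral_add has_bochner_integral_diff E2 has_bochner_integral_mult_right E1)
      (simp add: has_bochner_integral_iff prob_space)
  then show ?thesis unfolding Q_def[symmetric] t_def[symmetric]
    by (simp add: power2_diff power2_eq_square algebra_simps)
qed

end

end

section \<open>Spectral norm and second moments\<close>

lemma scalar_prod_Cauchy_Schwarz:
  fixes v w :: "real vec"
  assumes "v \<in> carrier_vec p" "w \<in> carrier_vec p"
  shows "(v \<bullet> w)\<^sup>2 \<le> (v \<bullet> v) * (w \<bullet> w)"
  using Cauchy_Schwarz_ineq_sum[of "\<lambda>i. v $ i" "\<lambda>i. w $ i" "{..<p}"] assms
  by (simp add: scalar_prod_sum power2_eq_square)

lemma spectral_norm_le:
  assumes A: "A \<in> carrier_mat p p" and C: "0 \<le> C"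
    and le: "\<And>v. v \<in> carrier_vec p \<Longrightarrow> (A *\<^sub>v v) \<bullet> (A *\<^sub>v v) \<le> C\<^sup>2 * (v \<bullet> v)"
  shows "spectral_norm A \<le> C"
  unfolding spectral_norm_def
proof (rule cSUP_least)
  have "0\<^sub>v (dim_col A) \<in> {v \<in> carrier_vec (dim_col A). v \<bullet> v \<le> (1::real)}" by simp
  then show "{v \<in> carrier_vec (dim_col A). v \<bullet> v \<le> (1::real)} \<noteq> {}" by blast
  fix v assume v: "v \<in> {v \<in> carrier_vec (dim_col A). v \<bullet> v \<le> (1::real)}"
  then have "(A *\<^sub>v v) \<bullet> (A *\<^sub>v v) \<le> C\<^sup>2 * (v \<bullet> v)" using le A by auto
  also have "\<dots> \<le> C\<^sup>2 * 1" using v by (intro mult_left_mono) auto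
  finally show "sqrt ((A *\<^sub>v v) \<bullet> (A *\<^sub>v v)) \<le> C"
    using C by (intro real_le_lsqrt) auto
qed

text \<open>The supremum says something only once the values are known to be bounded above, which
  the Frobenius norm provides. A vector of positive length is then rescaled to length 1; for v = 0
  the Frobenius bound is used again.\<close>

lemma spectral_norm_bound:
  assumes A: "A \<in> carrier_mat p p" and v: "v \<in> carrier_vec p"
  shows "(A *\<^sub>v v) \<bullet> (A *\<^sub>v v) \<le> (spectral_norm A)\<^sup>2 * (v \<bullet> v)" "0 \<le> spectral_norm A"
proof -
  let ?U = "{v \<in> carrier_vec (dim_col A). v \<bullet> v \<le> (1::real)}"
  define F where "F = (\<Sum>i<p. row A i \<bullet> row A i)"
  have F: "0 \<le> F" unfolding F_def by (intro sum_nonneg scalar_prod_self_nonneg)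
  have Fb: "(A *\<^sub>v u) \<bullet> (A *\<^sub>v u) \<le> F * (u \<bullet> u)" if u: "u \<in> carrier_vec p" for u
  proof -
    have "(A *\<^sub>v u) \<bullet> (A *\<^sub>v u) = (\<Sum>i<p. (row A i \<bullet> u)\<^sup>2)"
      using A u by (subst scalar_prod_sum[of _ p]) (auto simp: power2_eq_square)
    also have "\<dots> \<le> (\<Sum>i<p. (row A i \<bullet> row A i) * (u \<bullet> u))"
      using A u by (intro sum_mono scalar_prod_Cauchy_Schwarz[of _ p]) auto
    finally show ?thesis by (simp add: F_def sum_distrib_right)
  qed
  have bdd: "bdd_above ((\<lambda>v. sqrt ((A *\<^sub>v v) \<bullet> (A *\<^sub>v v))) ` ?U)"
  proof (rule bdd_aboveI2[of _ _ "sqrt F"])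
    fix u assume u: "u \<in> ?U"
    then have "(A *\<^sub>v u) \<bullet> (A *\<^sub>v u) \<le> F * (u \<bullet> u)" using Fb A by auto
    also have "\<dots> \<le> F * 1" using u F by (intro mult_left_mono) auto
    finally show "sqrt ((A *\<^sub>v u) \<bullet> (A *\<^sub>v u)) \<le> sqrt F" by simp
  qed
  have up: "sqrt ((A *\<^sub>v u) \<bullet> (A *\<^sub>v u)) \<le> spectral_norm A" if "u \<in> ?U" for u
    unfolding spectral_norm_def by (rule cSUP_upper[OF that bdd])
  have "0\<^sub>v (dim_col A) \<in> ?U" by simp
  from up[OF this] show s0: "0 \<le> spectral_norm A"
    by (meson order_trans real_sqrt_ge_zero scalar_prod_self_nonneg)
  show "(A *\<^sub>v v) \<bullet> (A *\<^sub>v v) \<le> (spectral_norm A)\<^sup>2 * (v \<bullet> v)"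
  proof (cases "v \<bullet> v = 0")
    case True
    then show ?thesis using Fb[OF v] by simp
  next
    case False
    then have vv: "0 < v \<bullet> v" using scalar_prod_self_nonneg[of v] by linarith
    define c where "c = 1 / sqrt (v \<bullet> v)"
    have c2: "c * c = 1 / (v \<bullet> v)" using vv by (simp add: c_def)
    have Av: "A *\<^sub>v v \<in> carrier_vec p" using A v by simp
    have "(c \<cdot>\<^sub>v v) \<bullet> (c \<cdot>\<^sub>v v) = c * c * (v \<bullet> v)" using v by simp
    then have "c \<cdot>\<^sub>v v \<in> ?U" using A v vv by (simp add: c2)
    from up[OF this] have "sqrt ((A *\<^sub>v (c \<cdot>\<^sub>v v)) \<bullet> (A *\<^sub>v (c \<cdot>\<^sub>v v))) \<le> spectral_norm A" .
    moreover have "(A *\<^sub>v (c \<cdot>\<^sub>v v)) \<bullet> (A *\<^sub>v (c \<cdot>\<^sub>v v)) = c * c * ((A *\<^sub>v v) \<bullet> (A *\<^sub>v v))"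
      unfolding mult_mat_vec[OF A v] using Av by simp
    ultimately have "sqrt (((A *\<^sub>v v) \<bullet> (A *\<^sub>v v)) / (v \<bullet> v)) \<le> spectral_norm A" by (simp add: c2)
    then have "((A *\<^sub>v v) \<bullet> (A *\<^sub>v v)) / (v \<bullet> v) \<le> (spectral_norm A)\<^sup>2"
      by (rule sqrt_le_D)
    then show ?thesis using vv by (simp add: field_simps)
  qed
qed

lemma quad_form_le_spectral_norm:
  assumes A: "A \<in> carrier_mat p p" and v: "v \<in> carrier_vec p"
  shows "v \<bullet> (A *\<^sub>v v) \<le> spectral_norm A * (v \<bullet> v)"
proof -
  have "(v \<bullet> (A *\<^sub>v v))\<^sup>2 \<le> (v \<bullet> v) * ((A *\<^sub>v v) \<bullet> (A *\<^sub>v v))"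
    using A v by (intro scalar_prod_Cauchy_Schwarz[of _ p]) auto
  also have "\<dots> \<le> (v \<bullet> v) * ((spectral_norm A)\<^sup>2 * (v \<bullet> v))"
    by (intro mult_left_mono spectral_norm_bound[OF A v] scalar_prod_self_nonneg)
  finally have "(v \<bullet> (A *\<^sub>v v))\<^sup>2 \<le> (spectral_norm A * (v \<bullet> v))\<^sup>2"
    by (simp add: power2_eq_square mult_ac)
  then show ?thesis
    by (rule power2_le_imp_le)
      (intro mult_nonneg_nonneg spectral_norm_bound(2)[OF A v] scalar_prod_self_nonneg)
qed

section \<open>Second-moment bounds\<close>

text \<open>Expresses E X X^T \<le> l I and E |X|^2 \<le> t; the bounds \<open>l\<close> and
  \<open>t\<close> become the two factors of (A6). Nonnegative integrals let the condition include
  integrability.\<close>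

definition second_moment_le :: "'a measure \<Rightarrow> nat \<Rightarrow> ('a \<Rightarrow> real vec) \<Rightarrow> real \<Rightarrow> real \<Rightarrow> bool" where
  "second_moment_le M q X l t \<longleftrightarrow> X \<in> measurable M (vec_borel q) \<and>
     (\<forall>a\<in>carrier_vec q. (\<integral>\<^sup>+\<omega>. ennreal ((a \<bullet> X \<omega>)\<^sup>2) \<partial>M) \<le> ennreal (l * (a \<bullet> a))) \<and>
     (\<integral>\<^sup>+\<omega>. ennreal (X \<omega> \<bullet> X \<omega>) \<partial>M) \<le> ennreal t"

text \<open>The identity for all \<open>a\<close> says that \<open>E\<close> acts as the
  second-moment matrix. Unit vectors turn it into E |X|^2 = tr E, and the spectral norm bounds its
  form.\<close>

lemma second_moment_leI:
  assumes X: "X \<in> measurable M (vec_borel q)" and E: "E \<in> carrier_mat q q"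
    and eq: "\<And>a. a \<in> carrier_vec q \<Longrightarrow> (\<integral>\<^sup>+\<omega>. ennreal ((a \<bullet> X \<omega>)\<^sup>2) \<partial>M) = ennreal (a \<bullet> (E *\<^sub>v a))"
    and nonneg: "\<And>i. i < q \<Longrightarrow> 0 \<le> E $$ (i, i)"
  shows "second_moment_le M q X (spectral_norm E) (mat_trace E)"
proof -
  have Xc: "X \<omega> \<in> carrier_vec q" if "\<omega> \<in> space M" for \<omega> using X that by (auto simp: measurable_vec_borel_iff)
  have "(\<integral>\<^sup>+\<omega>. ennreal ((a \<bullet> X \<omega>)\<^sup>2) \<partial>M) \<le> ennreal (spectral_norm E * (a \<bullet> a))" if a: "a \<in> carrier_vec q" for a
    unfolding eq[OF a] by (intro ennreal_leI quad_form_le_spectral_norm[OF E a])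
  moreover have "(\<integral>\<^sup>+\<omega>. ennreal (X \<omega> \<bullet> X \<omega>) \<partial>M) = ennreal (mat_trace E)"
  proof -
    have u: "unit_vec q i \<bullet> v = v $ i" if "i < q" "v \<in> carrier_vec q" for i and v :: "real vec"
      using that by simp
    have "(\<integral>\<^sup>+\<omega>. ennreal (X \<omega> \<bullet> X \<omega>) \<partial>M) = (\<integral>\<^sup>+\<omega>. (\<Sum>i<q. ennreal ((X \<omega> $ i)\<^sup>2)) \<partial>M)"
      by (intro nn_integral_cong) (simp add: scalar_prod_sum[OF Xc] power2_eq_square sum_ennreal)
    also have "\<dots> = (\<Sum>i<q. \<integral>\<^sup>+\<omega>. ennreal ((X \<omega> $ i)\<^sup>2) \<partial>M)"
      using X by (intro nn_integral_sum measurable_compose[OF _ measurable_ennreal]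
          borel_measurable_power measurable_vec_index) auto
    also have "\<dots> = (\<Sum>i<q. ennreal (E $$ (i, i)))"
    proof (intro sum.cong refl)
      fix i assume "i \<in> {..<q}"
      then have i: "i < q" by simp
      have "(\<integral>\<^sup>+\<omega>. ennreal ((X \<omega> $ i)\<^sup>2) \<partial>M) = (\<integral>\<^sup>+\<omega>. ennreal ((unit_vec q i \<bullet> X \<omega>)\<^sup>2) \<partial>M)"
        by (intro nn_integral_cong) (simp add: u[OF i Xc])
      also have "\<dots> = ennreal (unit_vec q i \<bullet> (E *\<^sub>v unit_vec q i))" by (rule eq) simp
      also have "unit_vec q i \<bullet> (E *\<^sub>v unit_vec q i) = E $$ (i, i)"
        using E i by (subst u) auto
      finally show "(\<integral>\<^sup>+\<omega>. ennreal ((X \<omega> $ i)\<^sup>2) \<partial>M) = ennreal (E $$ (i, i))" .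
    qed
    also have "\<dots> = ennreal (mat_trace E)"
      using E nonneg by (subst sum_ennreal) (auto simp: mat_trace_def)
    finally show ?thesis .
  qed
  ultimately show ?thesis using X by (auto simp: second_moment_le_def)
qed

lemma second_moment_outer_prod:
  assumes X: "X \<in> measurable M (vec_borel q)" and int: "integrable_mat q M (\<lambda>\<omega>. outer_prod (X \<omega>))"
  shows "second_moment_le M q X (spectral_norm (mat_expectation q M (\<lambda>\<omega>. outer_prod (X \<omega>))))
    (mat_trace (mat_expectation q M (\<lambda>\<omega>. outer_prod (X \<omega>))))"
proof (rule second_moment_leI[OF X])
  have Xc: "X \<omega> \<in> carrier_vec q" if "\<omega> \<in> space M" for \<omega> using X that by (auto simp: measurable_vec_borel_iff)
  define E where "E = mat_expectation q M (\<lambda>\<omega>. outer_prod (X \<omega>))"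
  show Ec: "mat_expectation q M (\<lambda>\<omega>. outer_prod (X \<omega>)) \<in> carrier_mat q q" by (simp add: mat_expectation_def)
  have o: "outer_prod (X \<omega>) $$ (i, j) = X \<omega> $ i * X \<omega> $ j" if "\<omega> \<in> space M" "i < q" "j < q" for \<omega> i j
    using Xc[OF that(1)] that by (simp add: outer_prod_def)
  have Eij: "E $$ (i, j) = (\<integral>\<omega>. X \<omega> $ i * X \<omega> $ j \<partial>M)" if "i < q" "j < q" for i j
    unfolding E_def mat_expectation_def using that by (simp add: o cong: Bochner_Integration.integral_cong)
  have I: "integrable M (\<lambda>\<omega>. X \<omega> $ i * X \<omega> $ j)" if "i < q" "j < q" for i j
  proof -
    have "integrable M (\<lambda>\<omega>. outer_prod (X \<omega>) $$ (i, j))" using int that by (auto simp: integrable_mat_def)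
    then show ?thesis by (rule Bochner_Integration.integrable_cong[THEN iffD1, OF refl, rotated]) (simp add: o that)
  qed
  show "0 \<le> mat_expectation q M (\<lambda>\<omega>. outer_prod (X \<omega>)) $$ (i, i)" if "i < q" for i
    unfolding E_def[symmetric] Eij[OF that that] by simp
  fix a :: "real vec" assume a: "a \<in> carrier_vec q"
  define f where "f \<omega> = (\<Sum>i<q. \<Sum>j<q. (a $ i * a $ j) * (X \<omega> $ i * X \<omega> $ j))" for \<omega>
  have f: "(a \<bullet> X \<omega>)\<^sup>2 = f \<omega>" if "\<omega> \<in> space M" for \<omega>
    unfolding f_def scalar_prod_sum[OF Xc[OF that]] power2_eq_square sum_product
    by (intro sum.cong refl) (simp add: mult_ac)
  have hf: "has_bochner_integral M f (\<Sum>i<q. \<Sum>j<q. (a $ i * a $ j) * E $$ (i, j))"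
    unfolding f_def[abs_def]
    by (intro has_bochner_integral_sum has_bochner_integral_mult_right)
      (simp add: has_bochner_integral_iff I Eij)
  have int_f: "integrable M f" using hf by (simp add: has_bochner_integral_iff)
  have "(\<integral>\<^sup>+\<omega>. ennreal ((a \<bullet> X \<omega>)\<^sup>2) \<partial>M) = (\<integral>\<^sup>+\<omega>. ennreal (f \<omega>) \<partial>M)"
    by (intro nn_integral_cong) (simp add: f)
  also have "\<dots> = ennreal (\<integral>\<omega>. f \<omega> \<partial>M)"
    by (intro nn_integral_eq_integral int_f AE_I2) (simp flip: f)
  also have "(\<integral>\<omega>. f \<omega> \<partial>M) = (\<Sum>i<q. \<Sum>j<q. (a $ i * a $ j) * E $$ (i, j))"
    by (rule has_bochner_integral_integral_eq[OF hf])
  also have "\<dots> = a \<bullet> (E *\<^sub>v a)"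
    unfolding quad_form_sum[OF Ec[folded E_def] a a] by (simp add: mult_ac)
  finally show "(\<integral>\<^sup>+\<omega>. ennreal ((a \<bullet> X \<omega>)\<^sup>2) \<partial>M)
    = ennreal (a \<bullet> (mat_expectation q M (\<lambda>\<omega>. outer_prod (X \<omega>)) *\<^sub>v a))" by (simp add: E_def)
qed

text \<open>Independence makes the joint law a product measure, and Tonelli's theorem then freezes
  \<open>Y\<close> at a separate sample point \<omega>' while \<open>X\<close> is averaged. In this
  way \<Sigma> is held fixed under Gaussian averages.\<close>

lemma indep_rv_nn_integral:
  assumes "prob_space M" and ind: "indep_rv M A X B Y" and f: "f \<in> borel_measurable (A \<Otimes>\<^sub>M B)"
  shows "(\<integral>\<^sup>+\<omega>. f (X \<omega>, Y \<omega>) \<partial>M) = (\<integral>\<^sup>+\<omega>'. \<integral>\<^sup>+\<omega>. f (X \<omega>, Y \<omega>') \<partial>M \<partial>M)"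
proof -
  interpret prob_space M by fact
  have X: "X \<in> measurable M A" and Y: "Y \<in> measurable M B"
    and iset: "indep_set {X -` S \<inter> space M | S. S \<in> sets A} {Y -` S \<inter> space M | S. S \<in> sets B}"
    using ind by (auto simp: indep_rv_def)
  interpret PX: prob_space "distr M A X" by (rule prob_space_distr[OF X])
  interpret PY: prob_space "distr M B Y" by (rule prob_space_distr[OF Y])
  interpret PXY: pair_sigma_finite "distr M A X" "distr M B Y" ..
  have XY: "(\<lambda>\<omega>. (X \<omega>, Y \<omega>)) \<in> measurable M (A \<Otimes>\<^sub>M B)" using X Y by simp
  have D: "distr M A X \<Otimes>\<^sub>M distr M B Y = distr M (A \<Otimes>\<^sub>M B) (\<lambda>\<omega>. (X \<omega>, Y \<omega>))"
  proof (rule pair_measure_eqI)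
    fix a b assume ab: "a \<in> sets (distr M A X)" "b \<in> sets (distr M B Y)"
    then have ab': "a \<in> sets A" "b \<in> sets B" by auto
    have "prob ((X -` a \<inter> space M) \<inter> (Y -` b \<inter> space M)) = prob (X -` a \<inter> space M) * prob (Y -` b \<inter> space M)"
      by (rule indep_setD[OF iset]) (use ab' in auto)
    moreover have "(\<lambda>\<omega>. (X \<omega>, Y \<omega>)) -` (a \<times> b) \<inter> space M = (X -` a \<inter> space M) \<inter> (Y -` b \<inter> space M)" by auto
    ultimately show "emeasure (distr M A X) a * emeasure (distr M B Y) b
        = emeasure (distr M (A \<Otimes>\<^sub>M B) (\<lambda>\<omega>. (X \<omega>, Y \<omega>))) (a \<times> b)"
      using ab' X Y XY by (simp add: emeasure_distr emeasure_eq_measure ennreal_mult')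
  qed (auto intro: PX.sigma_finite_measure_axioms PY.sigma_finite_measure_axioms)
  have f': "f \<in> borel_measurable (distr M A X \<Otimes>\<^sub>M distr M B Y)"
    using f by (simp cong: measurable_cong_sets)
  have "(\<integral>\<^sup>+\<omega>. f (X \<omega>, Y \<omega>) \<partial>M) = (\<integral>\<^sup>+x. f x \<partial>distr M (A \<Otimes>\<^sub>M B) (\<lambda>\<omega>. (X \<omega>, Y \<omega>)))"
    using XY f by (simp add: nn_integral_distr)
  also have "\<dots> = (\<integral>\<^sup>+y. \<integral>\<^sup>+x. f (x, y) \<partial>distr M A X \<partial>distr M B Y)"
    unfolding D[symmetric] by (rule PXY.nn_integral_snd[OF f', symmetric])
  also have "\<dots> = (\<integral>\<^sup>+\<omega>'. \<integral>\<^sup>+x. f (x, Y \<omega>') \<partial>distr M A X \<partial>M)"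
  proof (rule nn_integral_distr[OF Y])
    have "(\<lambda>y. \<integral>\<^sup>+x. case_prod (\<lambda>y x. f (x, y)) (y, x) \<partial>distr M A X) \<in> borel_measurable (distr M B Y)"
      by (rule PX.borel_measurable_nn_integral_fst) (use measurable_pair_swap[OF f'] in \<open>simp add: case_prod_beta\<close>)
    then show "(\<lambda>y. \<integral>\<^sup>+x. f (x, y) \<partial>distr M A X) \<in> borel_measurable (distr M B Y)" by simp
  qed
  also have "\<dots> = (\<integral>\<^sup>+\<omega>'. \<integral>\<^sup>+\<omega>. f (X \<omega>, Y \<omega>') \<partial>M \<partial>M)"
  proof (intro nn_integral_cong nn_integral_distr[OF X])
    fix \<omega>' assume "\<omega>' \<in> space M"
    then have "Y \<omega>' \<in> space B" using Y by (rule measurable_space[rotated])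
    then show "(\<lambda>x. f (x, Y \<omega>')) \<in> borel_measurable (distr M A X)"
      using measurable_compose[OF measurable_Pair2' f] by (simp cong: measurable_cong_sets)
  qed
  finally show ?thesis .
qed

lemma psd_diag_nonneg:
  assumes S: "sym_psd_mat q S" and i: "i < q"
  shows "0 \<le> S $$ (i, i)"
proof -
  have "0 \<le> unit_vec q i \<bullet> (S *\<^sub>v unit_vec q i)" by (rule sym_psd_matD(3)[OF S]) simp
  also have "\<dots> = S $$ (i, i)" using sym_psd_matD(1)[OF S] i by (simp add: scalar_prod_left_unit)
  finally show ?thesis .
qed

section \<open>Gaussian vectors with random covariance\<close>

text \<open>Conditionally on \<Sigma> the vector \<open>z\<close> is Gaussian with covariance
  \<Sigma>. The locale holds the data of a single dimension \<open>q\<close>.\<close>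

locale gaussian_mixture = prob_space M for M :: "'a measure" +
  fixes q :: nat and \<Sigma> :: "'a \<Rightarrow> real mat" and w z :: "'a \<Rightarrow> real vec"
  assumes Sigma_meas: "\<Sigma> \<in> measurable M (mat_borel q q)"
    and Sigma_psd: "\<And>\<omega>. \<omega> \<in> space M \<Longrightarrow> sym_psd_mat q (\<Sigma> \<omega>)"
    and Sigma_int: "integrable_mat q M \<Sigma>"
    and w_normal: "std_normal_vec q M w"
    and w_indep: "indep_rv M (vec_borel q) w (mat_borel q q) \<Sigma>"
    and z_eq: "\<And>\<omega>. \<omega> \<in> space M \<Longrightarrow> z \<omega> = psd_sqrt (\<Sigma> \<omega>) *\<^sub>v w \<omega>"
begin

abbreviation T where "T \<equiv> psd_root q"

lemma w_meas: "w \<in> measurable M (vec_borel q)"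
  using w_normal by (simp add: std_normal_vec_def)

lemma w_carrier: "\<omega> \<in> space M \<Longrightarrow> w \<omega> \<in> carrier_vec q"
  using w_meas by (auto simp: measurable_vec_borel_iff)

lemma Sigma_carrier: "\<omega> \<in> space M \<Longrightarrow> \<Sigma> \<omega> \<in> carrier_mat q q"
  using Sigma_psd by (rule sym_psd_matD)

lemma w_coords:
  "indep_vars (\<lambda>_. borel) (\<lambda>i \<omega>. w \<omega> $ i) {..<q}"
  "\<And>i. i < q \<Longrightarrow> distributed M lborel (\<lambda>\<omega>. w \<omega> $ i) std_normal_density"
  using w_normal by (auto simp: std_normal_vec_def)

lemma z_index: "\<omega> \<in> space M \<Longrightarrow> i < q \<Longrightarrow> z \<omega> $ i = (\<Sum>k<q. T (\<Sigma> \<omega>) $$ (i, k) * w \<omega> $ k)"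
  using mult_mat_vec_sum[OF psd_root_carrier w_carrier]
  by (simp add: z_eq psd_sqrt_eq[OF Sigma_psd] del: index_mult_mat_vec)

lemma z_carrier: "\<omega> \<in> space M \<Longrightarrow> z \<omega> \<in> carrier_vec q"
  using w_carrier by (simp add: z_eq psd_sqrt_eq[OF Sigma_psd] mult_mat_vec_carrier[of _ q q])

lemma T_meas: "i < q \<Longrightarrow> k < q \<Longrightarrow> (\<lambda>\<omega>. T (\<Sigma> \<omega>) $$ (i, k)) \<in> borel_measurable M"
  by (rule measurable_mat_index[OF measurable_compose[OF Sigma_meas measurable_psd_root]])

lemma z_meas: "z \<in> measurable M (vec_borel q)"
  unfolding measurable_vec_borel_iff
proof safe
  fix i assume i: "i < q"
  have "(\<lambda>\<omega>. \<Sum>k<q. T (\<Sigma> \<omega>) $$ (i, k) * w \<omega> $ k) \<in> borel_measurable M"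
    using i by (intro borel_measurable_sum borel_measurable_times T_meas measurable_vec_index[OF w_meas]) auto
  then show "(\<lambda>\<omega>. z \<omega> $ i) \<in> borel_measurable M"
    by (subst measurable_cong[OF z_index[OF _ i]])
qed (rule z_carrier)

lemma pair_meas:
  shows "k < q \<Longrightarrow> (\<lambda>x. fst x $ k) \<in> borel_measurable (vec_borel q \<Otimes>\<^sub>M mat_borel q q)"
    "i < q \<Longrightarrow> k < q \<Longrightarrow> (\<lambda>x. T (snd x) $$ (i, k)) \<in> borel_measurable (vec_borel q \<Otimes>\<^sub>M mat_borel q q)"
    "i < q \<Longrightarrow> k < q \<Longrightarrow> (\<lambda>x. snd x $$ (i, k)) \<in> borel_measurable (vec_borel q \<Otimes>\<^sub>M mat_borel q q)"
  by (rule measurable_vec_index[OF measurable_fst] measurable_mat_index[OF measurable_snd]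
      measurable_mat_index[OF measurable_compose[OF measurable_snd measurable_psd_root]]; assumption)+

text \<open>For frozen \<Sigma> the variable a^T z is a linear form in \<open>w\<close> with second
  moment |\<Sigma>^(1/2) a|^2 = a^T \<Sigma> a. Averaging over \<Sigma> identifies E z z^T with E
  \<Sigma>.\<close>

lemma second_moment_z:
  "second_moment_le M q z (spectral_norm (mat_expectation q M \<Sigma>)) (mat_trace (mat_expectation q M \<Sigma>))"
proof (rule second_moment_leI[OF z_meas])
  define E where "E = mat_expectation q M \<Sigma>"
  show Ec: "mat_expectation q M \<Sigma> \<in> carrier_mat q q" by (simp add: mat_expectation_def)
  have Eij: "E $$ (i, j) = (\<integral>\<omega>. \<Sigma> \<omega> $$ (i, j) \<partial>M)" if "i < q" "j < q" for i j
    using that by (simp add: E_def mat_expectation_def)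
  have diag: "0 \<le> \<Sigma> \<omega> $$ (i, i)" if "\<omega> \<in> space M" "i < q" for \<omega> i
    using that by (intro psd_diag_nonneg[OF Sigma_psd])
  show "0 \<le> mat_expectation q M \<Sigma> $$ (i, i)" if "i < q" for i
    unfolding E_def[symmetric] Eij[OF that that] using diag that by (intro integral_nonneg_AE AE_I2) auto
  fix a :: "real vec" assume a: "a \<in> carrier_vec q"
  define b where "b s k = (\<Sum>i<q. T s $$ (i, k) * a $ i)" for s k
  define f where "f x = ennreal ((\<Sum>k<q. b (snd x) k * fst x $ k)\<^sup>2)" for x
  have fm: "f \<in> borel_measurable (vec_borel q \<Otimes>\<^sub>M mat_borel q q)"
    unfolding f_def[abs_def] b_def
    by (intro measurable_compose[OF _ measurable_ennreal] borel_measurable_power borel_measurable_sum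
        borel_measurable_times borel_measurable_const pair_meas) auto
  have az: "a \<bullet> z \<omega> = (\<Sum>k<q. b (\<Sigma> \<omega>) k * w \<omega> $ k)" if \<omega>: "\<omega> \<in> space M" for \<omega>
  proof -
    have "a \<bullet> z \<omega> = (\<Sum>i<q. \<Sum>k<q. T (\<Sigma> \<omega>) $$ (i, k) * a $ i * w \<omega> $ k)"
      unfolding scalar_prod_sum[OF z_carrier[OF \<omega>]]
      by (intro sum.cong refl) (simp add: z_index[OF \<omega>] sum_distrib_left mult_ac)
    also have "\<dots> = (\<Sum>k<q. b (\<Sigma> \<omega>) k * w \<omega> $ k)"
      by (subst sum.swap) (simp add: b_def sum_distrib_right)
    finally show ?thesis .
  qed
  have quad: "(\<Sum>k<q. (b (\<Sigma> \<omega>) k)\<^sup>2) = a \<bullet> (\<Sigma> \<omega> *\<^sub>v a)" if \<omega>: "\<omega> \<in> space M" for \<omega>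
  proof -
    note T = psd_root[OF Sigma_psd[OF \<omega>]]
    have "\<Sigma> \<omega> $$ (i, j) = (\<Sum>l<q. T (\<Sigma> \<omega>) $$ (i, l) * T (\<Sigma> \<omega>) $$ (j, l))" if ij: "i < q" "j < q" for i j
      using mult_mat_sum[OF psd_root_carrier psd_root_carrier ij, of "\<Sigma> \<omega>" "\<Sigma> \<omega>"] T(2) sym_psd_matD(2)[OF T(1)] ij
      by simp
    then show ?thesis unfolding b_def
      by (subst sum_outer_psd[OF Sigma_carrier[OF \<omega>] _ a, where r = "\<lambda>l i. T (\<Sigma> \<omega>) $$ (i, l)"]) auto
  qed
  have "(\<integral>\<^sup>+\<omega>. ennreal ((a \<bullet> z \<omega>)\<^sup>2) \<partial>M) = (\<integral>\<^sup>+\<omega>. f (w \<omega>, \<Sigma> \<omega>) \<partial>M)"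
    by (intro nn_integral_cong) (simp add: f_def az)
  also have "\<dots> = (\<integral>\<^sup>+\<omega>'. \<integral>\<^sup>+\<omega>. f (w \<omega>, \<Sigma> \<omega>') \<partial>M \<partial>M)"
    by (rule indep_rv_nn_integral[OF prob_space_axioms w_indep fm])
  also have "\<dots> = (\<integral>\<^sup>+\<omega>'. ennreal (a \<bullet> (\<Sigma> \<omega>' *\<^sub>v a)) \<partial>M)"
  proof (intro nn_integral_cong)
    fix \<omega>' assume \<omega>': "\<omega>' \<in> space M"
    have hb: "has_bochner_integral M (\<lambda>\<omega>. (\<Sum>k<q. b (\<Sigma> \<omega>') k * w \<omega> $ k)\<^sup>2) (\<Sum>k<q. (b (\<Sigma> \<omega>') k)\<^sup>2)"
      by (rule normal_linear_second_moment[OF w_coords])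
    have "(\<integral>\<^sup>+\<omega>. f (w \<omega>, \<Sigma> \<omega>') \<partial>M) = ennreal (\<integral>\<omega>. (\<Sum>k<q. b (\<Sigma> \<omega>') k * w \<omega> $ k)\<^sup>2 \<partial>M)"
      unfolding f_def fst_conv snd_conv using hb
      by (intro nn_integral_eq_integral) (auto simp: has_bochner_integral_iff)
    then show "(\<integral>\<^sup>+\<omega>. f (w \<omega>, \<Sigma> \<omega>') \<partial>M) = ennreal (a \<bullet> (\<Sigma> \<omega>' *\<^sub>v a))"
      by (simp only: has_bochner_integral_integral_eq[OF hb] quad[OF \<omega>'])
  qed
  also have "\<dots> = ennreal (a \<bullet> (E *\<^sub>v a))"
  proof -
    define h where "h \<omega> = (\<Sum>i<q. \<Sum>j<q. (a $ i * a $ j) * \<Sigma> \<omega> $$ (i, j))" for \<omega>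
    have h: "a \<bullet> (\<Sigma> \<omega> *\<^sub>v a) = h \<omega>" if "\<omega> \<in> space M" for \<omega>
      unfolding quad_form_sum[OF Sigma_carrier[OF that] a a] h_def by (simp add: mult_ac)
    have hb: "has_bochner_integral M h (\<Sum>i<q. \<Sum>j<q. (a $ i * a $ j) * E $$ (i, j))"
      unfolding h_def[abs_def] using Sigma_int
      by (intro has_bochner_integral_sum has_bochner_integral_mult_right)
        (simp add: has_bochner_integral_iff integrable_mat_def Eij)
    have "(\<integral>\<^sup>+\<omega>. ennreal (a \<bullet> (\<Sigma> \<omega> *\<^sub>v a)) \<partial>M) = (\<integral>\<^sup>+\<omega>. ennreal (h \<omega>) \<partial>M)"
      by (intro nn_integral_cong) (simp add: h)
    also have "\<dots> = ennreal (\<integral>\<omega>. h \<omega> \<partial>M)"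
      using hb sym_psd_matD(3)[OF Sigma_psd a] h
      by (intro nn_integral_eq_integral AE_I2) (auto simp: has_bochner_integral_iff)
    also have "(\<integral>\<omega>. h \<omega> \<partial>M) = a \<bullet> (E *\<^sub>v a)"
      unfolding has_bochner_integral_integral_eq[OF hb] quad_form_sum[OF Ec[folded E_def] a a]
      by (simp add: mult_ac)
    finally show ?thesis .
  qed
  finally show "(\<integral>\<^sup>+\<omega>. ennreal ((a \<bullet> z \<omega>)\<^sup>2) \<partial>M) = ennreal (a \<bullet> (mat_expectation q M \<Sigma> *\<^sub>v a))"
    by (simp add: E_def)
qed

lemma trace_sq_meas: "(\<lambda>\<omega>. mat_trace (\<Sigma> \<omega> * \<Sigma> \<omega>)) \<in> borel_measurable M"
proof -
  have "(\<lambda>\<omega>. \<Sum>i<q. \<Sum>k<q. \<Sigma> \<omega> $$ (i, k) * \<Sigma> \<omega> $$ (k, i)) \<in> borel_measurable M"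
    by (intro borel_measurable_sum borel_measurable_times measurable_mat_index[OF Sigma_meas]) auto
  then show ?thesis by (subst measurable_cong[OF mat_trace_mult_sum[OF Sigma_carrier Sigma_carrier]])
qed

lemma qform_dev_meas:
  assumes A: "A \<in> carrier_mat q q" and X: "X \<in> measurable M (vec_borel q)"
  shows "(\<lambda>\<omega>. qform A (X \<omega>) - mat_trace (\<Sigma> \<omega> * A)) \<in> borel_measurable M"
proof -
  have Xc: "X \<omega> \<in> carrier_vec q" if "\<omega> \<in> space M" for \<omega> using X that by (auto simp: measurable_vec_borel_iff)
  have "(\<lambda>\<omega>. (\<Sum>i<q. \<Sum>j<q. A $$ (i, j) * (X \<omega> $ i * X \<omega> $ j))
      - (\<Sum>i<q. \<Sum>k<q. \<Sigma> \<omega> $$ (i, k) * A $$ (k, i))) \<in> borel_measurable M"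
    by (intro borel_measurable_diff borel_measurable_sum borel_measurable_times borel_measurable_const
        measurable_mat_index[OF Sigma_meas] measurable_vec_index[OF X]) auto
  then show ?thesis
    by (rule measurable_cong[THEN iffD2, rotated])
      (simp add: qform_def quad_form_sum[OF A Xc Xc] mat_trace_mult_sum[OF Sigma_carrier A])
qed

text \<open>Chebyshev's inequality for frozen \<Sigma>, where the variance is at most 2 C^2
  tr(\<Sigma>^2). Since (A2) controls tr(\<Sigma>^2) only in probability, the event where it exceeds
  \<open>d\<close> is split off.\<close>

lemma qform_z_concentration:
  assumes A: "bounded_sym q C A" and r: "0 < r" and d: "0 \<le> d"
  shows "prob {\<omega> \<in> space M. r < \<bar>qform A (z \<omega>) - mat_trace (\<Sigma> \<omega> * A)\<bar>}
     \<le> prob {\<omega> \<in> space M. d < mat_trace (\<Sigma> \<omega> * \<Sigma> \<omega>)} + 2 * C\<^sup>2 * d / r\<^sup>2"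
proof -
  have Ac: "A \<in> carrier_mat q q" using A by (auto simp: bounded_sym_def sym_mat_def)
  define t where "t s = (\<Sum>i<q. \<Sum>k<q. s $$ (i, k) * s $$ (k, i))" for s :: "real mat"
  define B where "B s = T s * A * T s" for s
  define u where "u x i = (\<Sum>k<q. T (snd x) $$ (i, k) * fst x $ k)" for x :: "real vec \<times> real mat" and i
  define g where "g x = (\<Sum>i<q. \<Sum>j<q. A $$ (i, j) * (u x i * u x j))
     - (\<Sum>i<q. \<Sum>k<q. snd x $$ (i, k) * A $$ (k, i))" for x
  \<comment> \<open>Truncation to tr(\<Sigma>^2) \<le> d keeps the mean at most 2 C^2 d. The
    coordinates of \<open>z\<close> are spelled out in \<open>u\<close>, so that measurability on
    the product space reduces to \<open>pair_meas\<close>.\<close>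
  define f where "f x = (if t (snd x) \<le> d then ennreal ((g x)\<^sup>2) else 0)" for x
  have tS: "t (\<Sigma> \<omega>) = mat_trace (\<Sigma> \<omega> * \<Sigma> \<omega>)" if "\<omega> \<in> space M" for \<omega>
    unfolding t_def mat_trace_mult_sum[OF Sigma_carrier[OF that] Sigma_carrier[OF that]] ..
  have tm: "(\<lambda>x. t (snd x)) \<in> borel_measurable (vec_borel q \<Otimes>\<^sub>M mat_borel q q)"
    unfolding t_def by (intro borel_measurable_sum borel_measurable_times pair_meas) auto
  have gm: "g \<in> borel_measurable (vec_borel q \<Otimes>\<^sub>M mat_borel q q)"
    unfolding g_def[abs_def] u_def
    by (intro borel_measurable_diff borel_measurable_sum borel_measurable_times borel_measurable_const pair_meas) auto
  have fm: "f \<in> borel_measurable (vec_borel q \<Otimes>\<^sub>M mat_borel q q)"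
    unfolding f_def[abs_def] using tm gm by (intro measurable_If) auto
  have g: "g (v, \<Sigma> \<omega>) = qform A (T (\<Sigma> \<omega>) *\<^sub>v v) - mat_trace (\<Sigma> \<omega> * A)"
    if \<omega>: "\<omega> \<in> space M" and v: "v \<in> carrier_vec q" for v \<omega>
  proof -
    have c: "T (\<Sigma> \<omega>) *\<^sub>v v \<in> carrier_vec q" using v by (simp add: mult_mat_vec_carrier[of _ q q])
    have ui: "(T (\<Sigma> \<omega>) *\<^sub>v v) $ i = u (v, \<Sigma> \<omega>) i" if "i < q" for i
      unfolding u_def using mult_mat_vec_sum[OF psd_root_carrier v that] by simp
    show ?thesis
      unfolding g_def qform_def quad_form_sum[OF Ac c c] mat_trace_mult_sum[OF Sigma_carrier[OF \<omega>] Ac]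
      by (simp add: ui del: index_mult_mat_vec)
  qed
  have inner: "(\<integral>\<^sup>+\<omega>. f (w \<omega>, \<Sigma> \<omega>') \<partial>M) \<le> ennreal (2 * C\<^sup>2 * d)" if \<omega>': "\<omega>' \<in> space M" for \<omega>'
  proof (cases "t (\<Sigma> \<omega>') \<le> d")
    case True
    note T = psd_root[OF Sigma_psd[OF \<omega>']]
    note s = sandwich_facts[OF T(1,2) A, folded B_def]
    have hb: "has_bochner_integral M (\<lambda>\<omega>. ((\<Sum>i<q. \<Sum>j<q. B (\<Sigma> \<omega>') $$ (i, j) * (w \<omega> $ i * w \<omega> $ j))
      - (\<Sum>i<q. B (\<Sigma> \<omega>') $$ (i, i)))\<^sup>2) (2 * (\<Sum>i<q. \<Sum>j<q. (B (\<Sigma> \<omega>') $$ (i, j))\<^sup>2))"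
      by (rule normal_quadratic_variance[OF w_coords]) (simp_all add: s(2))
    have "(\<integral>\<^sup>+\<omega>. f (w \<omega>, \<Sigma> \<omega>') \<partial>M) = (\<integral>\<^sup>+\<omega>. ennreal (((\<Sum>i<q. \<Sum>j<q. B (\<Sigma> \<omega>') $$ (i, j) * (w \<omega> $ i * w \<omega> $ j))
      - (\<Sum>i<q. B (\<Sigma> \<omega>') $$ (i, i)))\<^sup>2) \<partial>M)"
      using True by (intro nn_integral_cong) (simp add: f_def g[OF \<omega>' w_carrier] s(3)[OF w_carrier] s(4))
    also have "\<dots> = ennreal (2 * (\<Sum>i<q. \<Sum>j<q. (B (\<Sigma> \<omega>') $$ (i, j))\<^sup>2))"
      unfolding has_bochner_integral_integral_eq[OF hb, symmetric] using hb
      by (intro nn_integral_eq_integral) (auto simp: has_bochner_integral_iff)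
    also have "\<dots> \<le> ennreal (2 * (C\<^sup>2 * d))"
    proof (intro ennreal_leI mult_left_mono)
      have "C\<^sup>2 * mat_trace (\<Sigma> \<omega>' * \<Sigma> \<omega>') \<le> C\<^sup>2 * d" using True tS[OF \<omega>'] by (intro mult_left_mono) auto
      with s(5) show "(\<Sum>i<q. \<Sum>j<q. (B (\<Sigma> \<omega>') $$ (i, j))\<^sup>2) \<le> C\<^sup>2 * d" by linarith
    qed simp
    finally show ?thesis by (simp add: mult_ac)
  qed (simp add: f_def)
  have "(\<integral>\<^sup>+\<omega>. f (w \<omega>, \<Sigma> \<omega>) \<partial>M) = (\<integral>\<^sup>+\<omega>'. \<integral>\<^sup>+\<omega>. f (w \<omega>, \<Sigma> \<omega>') \<partial>M \<partial>M)"
    by (rule indep_rv_nn_integral[OF prob_space_axioms w_indep fm])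
  also have "\<dots> \<le> (\<integral>\<^sup>+\<omega>'. ennreal (2 * C\<^sup>2 * d) \<partial>M)" by (intro nn_integral_mono inner)
  also have "\<dots> = ennreal (2 * C\<^sup>2 * d)" by (simp add: emeasure_space_1)
  finally have ub: "(\<integral>\<^sup>+\<omega>. f (w \<omega>, \<Sigma> \<omega>) \<partial>M) \<le> ennreal (2 * C\<^sup>2 * d)" .
  have m2: "(\<lambda>\<omega>. f (w \<omega>, \<Sigma> \<omega>)) \<in> borel_measurable M"
    by (rule measurable_compose[OF measurable_Pair[OF w_meas Sigma_meas] fm])
  define S1 where "S1 = {\<omega> \<in> space M. d < mat_trace (\<Sigma> \<omega> * \<Sigma> \<omega>)}"
  define S2 where "S2 = {\<omega> \<in> space M. ennreal (r\<^sup>2) \<le> f (w \<omega>, \<Sigma> \<omega>)}"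
  have S: "S1 \<in> events" "S2 \<in> events" unfolding S1_def S2_def using trace_sq_meas m2 by auto
  have "ennreal (r\<^sup>2) * emeasure M S2 = (\<integral>\<^sup>+\<omega>. ennreal (r\<^sup>2) * indicator S2 \<omega> \<partial>M)"
    using S by (simp add: nn_integral_cmult_indicator)
  also have "\<dots> \<le> (\<integral>\<^sup>+\<omega>. f (w \<omega>, \<Sigma> \<omega>) \<partial>M)"
    by (intro nn_integral_mono) (auto simp: S2_def split: split_indicator)
  also note ub
  finally have "ennreal (r\<^sup>2 * prob S2) \<le> ennreal (2 * C\<^sup>2 * d)"
    by (simp add: emeasure_eq_measure ennreal_mult')
  then have "r\<^sup>2 * prob S2 \<le> 2 * C\<^sup>2 * d" using d by (subst (asm) ennreal_le_iff) auto
  then have p2: "prob S2 \<le> 2 * C\<^sup>2 * d / r\<^sup>2" using r by (simp add: field_simps)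
  have sub: "{\<omega> \<in> space M. r < \<bar>qform A (z \<omega>) - mat_trace (\<Sigma> \<omega> * A)\<bar>} \<subseteq> S1 \<union> S2"
  proof
    fix \<omega> assume \<omega>: "\<omega> \<in> {\<omega> \<in> space M. r < \<bar>qform A (z \<omega>) - mat_trace (\<Sigma> \<omega> * A)\<bar>}"
    then have sp: "\<omega> \<in> space M" by simp
    show "\<omega> \<in> S1 \<union> S2"
    proof (cases "t (\<Sigma> \<omega>) \<le> d")
      case True
      have "g (w \<omega>, \<Sigma> \<omega>) = qform A (z \<omega>) - mat_trace (\<Sigma> \<omega> * A)"
        by (simp add: g[OF sp w_carrier[OF sp]] z_eq[OF sp] psd_sqrt_eq[OF Sigma_psd[OF sp]])
      then have "r \<le> \<bar>g (w \<omega>, \<Sigma> \<omega>)\<bar>" using \<omega> by simp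
      then have "r\<^sup>2 \<le> (g (w \<omega>, \<Sigma> \<omega>))\<^sup>2" using r by (simp flip: abs_le_square_iff)
      then show ?thesis using True sp by (simp add: S2_def f_def)
    next
      case False
      then show ?thesis using sp tS[OF sp] by (simp add: S1_def)
    qed
  qed
  have "prob {\<omega> \<in> space M. r < \<bar>qform A (z \<omega>) - mat_trace (\<Sigma> \<omega> * A)\<bar>} \<le> prob (S1 \<union> S2)"
    using sub S by (intro finite_measure_mono) auto
  also have "\<dots> \<le> prob S1 + prob S2" using S by (rule measure_Un_le)
  finally show ?thesis using p2 by (simp add: S1_def)
qed

end

text \<open>The hypothesis on sequences of matrices is uniform over matrices of bounded norm, since for each
  \<open>q\<close> it may be applied to a worst matrix. A symmetric \<open>A\<close> is the difference of the positive
  semi-definite matrices \<open>A + C I\<close> and \<open>C I\<close>.\<close>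

lemma qform_swap_in_prob:
  fixes M :: "nat \<Rightarrow> 'a measure"
  assumes mix: "\<And>q. 1 \<le> q \<Longrightarrow> gaussian_mixture (M q) q (\<Sigma> q) (w q) (z q)"
    and y: "\<And>q. 1 \<le> q \<Longrightarrow> y q \<in> measurable (M q) (vec_borel q)"
    and A1: "\<And>A :: nat \<Rightarrow> real mat.
          (\<forall>q\<ge>1. sym_psd_mat q (A q)) \<Longrightarrow> (\<exists>C. \<forall>q\<ge>1. spectral_norm (A q) \<le> C) \<Longrightarrow>
          tendsto_0_in_prob M
            (\<lambda>q \<omega>. (y q \<omega> \<bullet> (A q *\<^sub>v y q \<omega>) - mat_trace (\<Sigma> q \<omega> * A q)) / real q)"
    and A2: "tendsto_0_in_prob M (\<lambda>q \<omega>. mat_trace (\<Sigma> q \<omega> * \<Sigma> q \<omega>) / (real q)\<^sup>2)"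
    and C: "0 \<le> C" and eps: "0 < \<epsilon>" and eta: "0 < \<eta>"
  shows "eventually (\<lambda>q. \<forall>A. bounded_sym q C A \<longrightarrow>
     measure (M q) {\<omega> \<in> space (M q). \<epsilon> * real q < \<bar>qform A (y q \<omega>) - qform A (z q \<omega>)\<bar>} \<le> \<eta>) sequentially"
proof -
  define dev where "dev q A \<omega> = qform A (y q \<omega>) - mat_trace (\<Sigma> q \<omega> * A)" for q A \<omega>
  have psd: "eventually (\<lambda>q. \<forall>A. sym_psd_mat q A \<longrightarrow> bounded_sym q C A \<longrightarrow>
     measure (M q) {\<omega> \<in> space (M q). \<epsilon> * real q < \<bar>dev q A \<omega>\<bar>} \<le> \<eta>) sequentially"
    if C: "0 \<le> C" and eps: "0 < \<epsilon>" and eta: "0 < \<eta>" for C \<epsilon> \<eta>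
  proof -
    define bad where "bad q A \<longleftrightarrow> sym_psd_mat q A \<and> bounded_sym q C A \<and>
       \<eta> < measure (M q) {\<omega> \<in> space (M q). \<epsilon> * real q < \<bar>dev q A \<omega>\<bar>}" for q A
    \<comment> \<open>A worst matrix for each \<open>q\<close> if there is a bad one, the zero
      matrix otherwise. (A1) for this single sequence shows that eventually no bad matrix
      exists.\<close>
    define A where "A q = (if \<exists>A. bad q A then SOME A. bad q A else 0\<^sub>m q q)" for q
    have bad: "bad q (A q)" if "\<exists>A. bad q A" for q using someI_ex[OF that] that by (simp add: A_def)
    have A: "sym_psd_mat q (A q) \<and> bounded_sym q C (A q)" for q
    proof (cases "\<exists>A. bad q A")
      case True
      then show ?thesis using bad by (auto simp: bad_def)
    next
      case False
      have "0\<^sub>m q q *\<^sub>v v = (0\<^sub>v q :: real vec)" if "v \<in> carrier_vec q" for v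
        using that by (intro eq_vecI) auto
      then have "sym_psd_mat q (0\<^sub>m q q) \<and> bounded_sym q C (0\<^sub>m q q)"
        by (auto simp: sym_psd_mat_def sym_mat_def bounded_sym_def scalar_prod_self_nonneg)
      then show ?thesis using False by (simp add: A_def)
    qed
    have "\<exists>C. \<forall>q\<ge>1. spectral_norm (A q) \<le> C"
    proof (intro exI allI impI)
      fix q show "spectral_norm (A q) \<le> C"
        using A[of q] C by (intro spectral_norm_le[of _ q]) (auto simp: bounded_sym_def sym_mat_def)
    qed
    with A have "tendsto_0_in_prob M (\<lambda>q \<omega>. (y q \<omega> \<bullet> (A q *\<^sub>v y q \<omega>) - mat_trace (\<Sigma> q \<omega> * A q)) / real q)"
      by (intro A1) auto
    then have "(\<lambda>q. measure (M q) {\<omega> \<in> space (M q). \<epsilon> < \<bar>dev q (A q) \<omega> / real q\<bar>}) \<longlonglongrightarrow> 0"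
      using eps by (simp add: tendsto_0_in_prob_def dev_def qform_def)
    then have "eventually (\<lambda>q. measure (M q) {\<omega> \<in> space (M q). \<epsilon> < \<bar>dev q (A q) \<omega> / real q\<bar>} < \<eta>) sequentially"
      using eta by (rule order_tendstoD)
    with eventually_ge_at_top[of 1] show ?thesis
    proof eventually_elim
      case (elim q)
      have "\<not> bad q (A q)"
      proof
        assume "bad q (A q)"
        moreover have "(\<epsilon> < \<bar>dev q (A q) \<omega> / real q\<bar>) = (\<epsilon> * real q < \<bar>dev q (A q) \<omega>\<bar>)" for \<omega>
          using elim(1) by (simp add: field_simps)
        ultimately show False using elim(2) by (simp add: bad_def)
      qed
      then have "\<not> (\<exists>A. bad q A)" using bad by blast
      then show ?case by (auto simp: bad_def not_less)
    qed
  qed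
  \<comment> \<open>A + C I is positive semi-definite because |v^T A v| \<le> C |v|^2. Its norm is
    at most 2 C, which is therefore the constant used in the semi-definite case.\<close>
  have shift: "sym_psd_mat q (A + C \<cdot>\<^sub>m 1\<^sub>m q) \<and> bounded_sym q (2 * C) (A + C \<cdot>\<^sub>m 1\<^sub>m q)"
      "sym_psd_mat q (C \<cdot>\<^sub>m 1\<^sub>m q) \<and> bounded_sym q (2 * C) (C \<cdot>\<^sub>m 1\<^sub>m q)"
    if A: "bounded_sym q C A" for q A
  proof -
    have Ac: "A \<in> carrier_mat q q" and At: "A\<^sup>T = A" using A by (auto simp: bounded_sym_def sym_mat_def)
    have cm: "(C \<cdot>\<^sub>m 1\<^sub>m q) *\<^sub>v v = C \<cdot>\<^sub>v v" if "v \<in> carrier_vec q" for v :: "real vec"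
      using that by (intro eq_vecI) (auto simp: scalar_prod_left_unit)
    have am: "(A + C \<cdot>\<^sub>m 1\<^sub>m q) *\<^sub>v v = A *\<^sub>v v + C \<cdot>\<^sub>v v" if "v \<in> carrier_vec q" for v
      using add_mult_distrib_mat_vec[OF Ac _ that, of "C \<cdot>\<^sub>m 1\<^sub>m q"] cm[OF that] by simp
    have symI: "sym_mat q (C \<cdot>\<^sub>m 1\<^sub>m q)" by (auto simp: sym_mat_def intro!: eq_matI)
    have Asym: "A $$ (i, j) = A $$ (j, i)" if "i < q" "j < q" for i j
      using At that Ac index_transpose_mat(1)[of i A j] by simp
    have symA: "sym_mat q (A + C \<cdot>\<^sub>m 1\<^sub>m q)"
      unfolding sym_mat_def using Ac Asym by (auto intro!: eq_matI)
    have nn: "C\<^sup>2 * (v \<bullet> v) \<le> (2 * C)\<^sup>2 * (v \<bullet> v)" for v :: "real vec"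
      using C scalar_prod_self_nonneg[of v] by (intro mult_right_mono power_mono) auto
    show "sym_psd_mat q (C \<cdot>\<^sub>m 1\<^sub>m q) \<and> bounded_sym q (2 * C) (C \<cdot>\<^sub>m 1\<^sub>m q)"
      unfolding sym_psd_mat_def bounded_sym_def
    proof (intro conjI symI ballI)
      fix v :: "real vec" assume v: "v \<in> carrier_vec q"
      show "0 \<le> v \<bullet> ((C \<cdot>\<^sub>m 1\<^sub>m q) *\<^sub>v v)" unfolding cm[OF v] using v C scalar_prod_self_nonneg[of v] by simp
      show "((C \<cdot>\<^sub>m 1\<^sub>m q) *\<^sub>v v) \<bullet> ((C \<cdot>\<^sub>m 1\<^sub>m q) *\<^sub>v v) \<le> (2 * C)\<^sup>2 * (v \<bullet> v)"
        unfolding cm[OF v] using v nn[of v] by (simp add: power2_eq_square)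
    qed
    show "sym_psd_mat q (A + C \<cdot>\<^sub>m 1\<^sub>m q) \<and> bounded_sym q (2 * C) (A + C \<cdot>\<^sub>m 1\<^sub>m q)"
      unfolding sym_psd_mat_def bounded_sym_def
    proof (intro conjI symA ballI)
      fix v :: "real vec" assume v: "v \<in> carrier_vec q"
      have Av: "A *\<^sub>v v \<in> carrier_vec q" using Ac v by simp
      define a b where ab: "a = v \<bullet> v" "b = (A *\<^sub>v v) \<bullet> (A *\<^sub>v v)"
      have b: "b \<le> C\<^sup>2 * a" using A v by (auto simp: bounded_sym_def ab)
      have a0: "0 \<le> a" unfolding ab by (rule scalar_prod_self_nonneg)
      have "(v \<bullet> (A *\<^sub>v v))\<^sup>2 \<le> a * b" unfolding ab by (rule scalar_prod_Cauchy_Schwarz[OF v Av])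
      also have "\<dots> \<le> a * (C\<^sup>2 * a)" using a0 b by (intro mult_left_mono)
      also have "\<dots> = (C * a)\<^sup>2" by (simp add: power2_eq_square)
      finally have c: "\<bar>v \<bullet> (A *\<^sub>v v)\<bar> \<le> C * a" using C a0 by (simp add: abs_le_square_iff[symmetric])
      have "v \<bullet> (A *\<^sub>v v + C \<cdot>\<^sub>v v) = v \<bullet> (A *\<^sub>v v) + C * a"
        using v Av by (simp add: scalar_prod_add_distrib[of _ q] ab)
      with c show "0 \<le> v \<bullet> ((A + C \<cdot>\<^sub>m 1\<^sub>m q) *\<^sub>v v)" unfolding am[OF v] by linarith
      have "(A *\<^sub>v v + C \<cdot>\<^sub>v v) \<bullet> (A *\<^sub>v v + C \<cdot>\<^sub>v v) = b + 2 * C * (v \<bullet> (A *\<^sub>v v)) + C\<^sup>2 * a"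
        using v Av comm_scalar_prod[OF v Av]
        by (simp add: scalar_prod_add_distrib[of _ q] add_scalar_prod_distrib[of _ q] ab power2_eq_square algebra_simps)
      also have "\<dots> \<le> C\<^sup>2 * a + 2 * C * (C * a) + C\<^sup>2 * a"
        using b c C by (intro add_mono mult_left_mono) auto
      finally show "((A + C \<cdot>\<^sub>m 1\<^sub>m q) *\<^sub>v v) \<bullet> ((A + C \<cdot>\<^sub>m 1\<^sub>m q) *\<^sub>v v) \<le> (2 * C)\<^sup>2 * (v \<bullet> v)"
        unfolding am[OF v] by (simp add: ab power2_eq_square algebra_simps)
    qed
  qed
  \<comment> \<open>Turns the Chebyshev term 2 C^2 d / (\<epsilon> / 2)^2 into \<eta> times 8 C^2 /
    (32 C^2 + 1), which is at most \<eta> / 4; the summand 1 avoids a zero denominator for C =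
    0.\<close>
  define d where "d = \<eta> * \<epsilon>\<^sup>2 / (32 * C\<^sup>2 + 1)"
  have d: "0 < d" using eps eta by (simp add: d_def add_nonneg_pos)
  have dC: "2 * C\<^sup>2 * d / (\<epsilon> / 2)\<^sup>2 \<le> \<eta> / 4"
  proof -
    have "2 * C\<^sup>2 * d / (\<epsilon> / 2)\<^sup>2 = \<eta> * (8 * C\<^sup>2 / (32 * C\<^sup>2 + 1))"
    proof -
      define D where "D = 32 * C\<^sup>2 + 1"
      have "0 < D" by (simp add: D_def add_nonneg_pos)
      then show ?thesis
        unfolding d_def D_def[symmetric] using eps by (simp add: field_simps power2_eq_square)
    qed
    also have "\<dots> \<le> \<eta> * (1 / 4)"
    proof (intro mult_left_mono)
      have "0 < 32 * C\<^sup>2 + 1" by (simp add: add_nonneg_pos)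
      then show "8 * C\<^sup>2 / (32 * C\<^sup>2 + 1) \<le> 1 / 4" by (simp add: field_simps)
    qed (use eta in simp)
    finally show ?thesis by simp
  qed
  have "(\<lambda>q. measure (M q) {\<omega> \<in> space (M q). d < \<bar>mat_trace (\<Sigma> q \<omega> * \<Sigma> q \<omega>) / (real q)\<^sup>2\<bar>}) \<longlonglongrightarrow> 0"
    using A2 d by (simp add: tendsto_0_in_prob_def)
  then have tr: "eventually (\<lambda>q. measure (M q) {\<omega> \<in> space (M q). d < \<bar>mat_trace (\<Sigma> q \<omega> * \<Sigma> q \<omega>) / (real q)\<^sup>2\<bar>} < \<eta> / 4) sequentially"
    using eta by (intro order_tendstoD) auto
  have "eventually (\<lambda>q. \<forall>A. sym_psd_mat q A \<longrightarrow> bounded_sym q (2 * C) A \<longrightarrow>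
     measure (M q) {\<omega> \<in> space (M q). \<epsilon> / 4 * real q < \<bar>dev q A \<omega>\<bar>} \<le> \<eta> / 4) sequentially"
    using C eps eta by (intro psd) auto
  with tr eventually_ge_at_top[of 1] show ?thesis
  proof eventually_elim
    case (elim q)
    note q = elim(2)
    interpret gaussian_mixture "M q" q "\<Sigma> q" "w q" "z q" by (rule mix[OF q])
    show ?case
    proof (intro allI impI)
      fix A assume A: "bounded_sym q C A"
      then have Ac: "A \<in> carrier_mat q q" by (auto simp: bounded_sym_def sym_mat_def)
      define I where "I = C \<cdot>\<^sub>m (1\<^sub>m q :: real mat)"
      have Ic: "I \<in> carrier_mat q q" by (simp add: I_def)
      note sh = shift[OF A, folded I_def]
      have yc: "y q \<omega> \<in> carrier_vec q" if "\<omega> \<in> space (M q)" for \<omega>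
        using y[OF q] that by (auto simp: measurable_vec_borel_iff)
      have devdiff: "dev q A \<omega> = dev q (A + I) \<omega> - dev q I \<omega>" if \<omega>: "\<omega> \<in> space (M q)" for \<omega>
      proof -
        note yc = yc[OF \<omega>]
        note Sc = Sigma_carrier[OF \<omega>]
        have AIc: "A + I \<in> carrier_mat q q" using Ac Ic by simp
        have 1: "qform (A + I) (y q \<omega>) = qform A (y q \<omega>) + qform I (y q \<omega>)"
          unfolding qform_def quad_form_sum[OF AIc yc yc] quad_form_sum[OF Ac yc yc] quad_form_sum[OF Ic yc yc]
            sum.distrib[symmetric] using Ac Ic by (intro sum.cong refl) (simp add: distrib_right)
        have 2: "mat_trace (\<Sigma> q \<omega> * (A + I)) = mat_trace (\<Sigma> q \<omega> * A) + mat_trace (\<Sigma> q \<omega> * I)"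
          unfolding mat_trace_mult_sum[OF Sc AIc] mat_trace_mult_sum[OF Sc Ac] mat_trace_mult_sum[OF Sc Ic]
            sum.distrib[symmetric] using Ac Ic by (intro sum.cong refl) (simp add: distrib_left)
        show ?thesis unfolding dev_def 1 2 by simp
      qed
      \<comment> \<open>The deviation of y^T A y splits into those for A + I and for I, where
        \<open>I\<close> is C times the identity matrix; z^T A z is treated unsplit. The thresholds
        \<epsilon> / 4, \<epsilon> / 4, \<epsilon> / 2 add up to \<epsilon>.\<close>
      define E1 where "E1 = {\<omega> \<in> space (M q). \<epsilon> / 4 * real q < \<bar>dev q (A + I) \<omega>\<bar>}"
      define E2 where "E2 = {\<omega> \<in> space (M q). \<epsilon> / 4 * real q < \<bar>dev q I \<omega>\<bar>}"
      define E3 where "E3 = {\<omega> \<in> space (M q). \<epsilon> / 2 * real q < \<bar>qform A (z q \<omega>) - mat_trace (\<Sigma> q \<omega> * A)\<bar>}"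
      have ev: "E1 \<in> events" "E2 \<in> events" "E3 \<in> events"
        unfolding E1_def E2_def E3_def dev_def
        using qform_dev_meas[OF add_carrier_mat[OF Ic, of A] y[OF q], measurable]
          qform_dev_meas[OF Ic y[OF q], measurable] qform_dev_meas[OF Ac z_meas, measurable]
        by measurable
      have p12: "prob E1 \<le> \<eta> / 4" "prob E2 \<le> \<eta> / 4"
        using elim(3) sh unfolding E1_def E2_def by auto
      have "prob E3 \<le> prob {\<omega> \<in> space (M q). d * (real q)\<^sup>2 < mat_trace (\<Sigma> q \<omega> * \<Sigma> q \<omega>)}
          + 2 * C\<^sup>2 * (d * (real q)\<^sup>2) / (\<epsilon> / 2 * real q)\<^sup>2"
        unfolding E3_def using q eps d by (intro qform_z_concentration[OF A]) auto
      also have "2 * C\<^sup>2 * (d * (real q)\<^sup>2) / (\<epsilon> / 2 * real q)\<^sup>2 = 2 * C\<^sup>2 * d / (\<epsilon> / 2)\<^sup>2"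
        using q eps by (simp add: field_simps power2_eq_square)
      also have "\<dots> \<le> \<eta> / 4" by (rule dC)
      also have "prob {\<omega> \<in> space (M q). d * (real q)\<^sup>2 < mat_trace (\<Sigma> q \<omega> * \<Sigma> q \<omega>)}
         \<le> prob {\<omega> \<in> space (M q). d < \<bar>mat_trace (\<Sigma> q \<omega> * \<Sigma> q \<omega>) / (real q)\<^sup>2\<bar>}"
      proof (rule finite_measure_mono)
        show "{\<omega> \<in> space (M q). d < \<bar>mat_trace (\<Sigma> q \<omega> * \<Sigma> q \<omega>) / (real q)\<^sup>2\<bar>} \<in> events"
          using trace_sq_meas by measurable
        have "d < \<bar>x / (real q)\<^sup>2\<bar>" if "d * (real q)\<^sup>2 < x" for x
        proof -
          have "d < x / (real q)\<^sup>2" using that q by (simp add: field_simps)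
          then show ?thesis by linarith
        qed
        then show "{\<omega> \<in> space (M q). d * (real q)\<^sup>2 < mat_trace (\<Sigma> q \<omega> * \<Sigma> q \<omega>)}
          \<subseteq> {\<omega> \<in> space (M q). d < \<bar>mat_trace (\<Sigma> q \<omega> * \<Sigma> q \<omega>) / (real q)\<^sup>2\<bar>}" by blast
      qed
      also note less_imp_le[OF elim(1)]
      finally have p3: "prob E3 \<le> \<eta> / 2" by simp
      have "{\<omega> \<in> space (M q). \<epsilon> * real q < \<bar>qform A (y q \<omega>) - qform A (z q \<omega>)\<bar>} \<subseteq> (E1 \<union> E2) \<union> E3"
      proof
        fix \<omega> assume \<omega>: "\<omega> \<in> {\<omega> \<in> space (M q). \<epsilon> * real q < \<bar>qform A (y q \<omega>) - qform A (z q \<omega>)\<bar>}"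
        then have sp: "\<omega> \<in> space (M q)" by simp
        have eq: "qform A (y q \<omega>) - qform A (z q \<omega>) = dev q (A + I) \<omega> - dev q I \<omega>
           - (qform A (z q \<omega>) - mat_trace (\<Sigma> q \<omega> * A))"
          unfolding devdiff[OF sp, symmetric] by (simp add: dev_def)
        have "\<epsilon> * real q < \<bar>dev q (A + I) \<omega> - dev q I \<omega> - (qform A (z q \<omega>) - mat_trace (\<Sigma> q \<omega> * A))\<bar>"
          using \<omega> by (simp only: eq mem_Collect_eq)
        moreover have "e / 4 < \<bar>a\<bar> \<or> e / 4 < \<bar>b\<bar> \<or> e / 2 < \<bar>c\<bar>" if "e < \<bar>a - b - c\<bar>" for a b c e :: real
          using that by linarith
        ultimately have "\<epsilon> * real q / 4 < \<bar>dev q (A + I) \<omega>\<bar> \<or> \<epsilon> * real q / 4 < \<bar>dev q I \<omega>\<bar>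
           \<or> \<epsilon> * real q / 2 < \<bar>qform A (z q \<omega>) - mat_trace (\<Sigma> q \<omega> * A)\<bar>" by blast
        with sp show "\<omega> \<in> (E1 \<union> E2) \<union> E3" by (auto simp: E1_def E2_def E3_def)
      qed
      then have "prob {\<omega> \<in> space (M q). \<epsilon> * real q < \<bar>qform A (y q \<omega>) - qform A (z q \<omega>)\<bar>} \<le> prob ((E1 \<union> E2) \<union> E3)"
        using ev by (intro finite_measure_mono) auto
      also have "\<dots> \<le> (prob E1 + prob E2) + prob E3"
        using measure_Un_le[of "E1 \<union> E2" "M q" E3] measure_Un_le[of E1 "M q" E2] ev by auto
      finally show "prob {\<omega> \<in> space (M q). \<epsilon> * real q < \<bar>qform A (y q \<omega>) - qform A (z q \<omega>)\<bar>} \<le> \<eta>"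
        using p12 p3 by simp
    qed
  qed
qed

section \<open>Bounded differences and product measures\<close>

lemma fun_upd_in_space_PiM:
  "x \<in> space (PiM I N) \<Longrightarrow> u \<in> space (N j) \<Longrightarrow> x(j := u) \<in> space (PiM (insert j I) N)"
  by (auto simp: space_PiM PiE_def extensional_def)

lemma fun_upd_in_space_PiM':
  "x \<in> space (PiM I N) \<Longrightarrow> j \<in> I \<Longrightarrow> u \<in> space (N j) \<Longrightarrow> x(j := u) \<in> space (PiM I N)"
  using fun_upd_in_space_PiM[of x I N u j] by (simp add: insert_absorb)

lemma measurable_PiM_upd:
  assumes f: "f \<in> measurable (PiM (insert j I) N) R"
  shows "(\<lambda>p. f ((fst p)(j := snd p))) \<in> measurable (PiM I N \<Otimes>\<^sub>M N j) R"
proof -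
  have "(\<lambda>p. (fst p)(j := snd p)) \<in> measurable (PiM I N \<Otimes>\<^sub>M N j) (PiM (insert j I) N)"
    using measurable_add_dim[of j I N] by (simp add: case_prod_beta)
  from measurable_compose[OF this f] show ?thesis .
qed

lemma measurable_PiM_upd_section:
  assumes f: "f \<in> measurable (PiM (insert j I) N) R" and x: "x \<in> space (PiM I N)"
  shows "(\<lambda>u. f (x(j := u))) \<in> measurable (N j) R"
  using measurable_compose[OF measurable_Pair1'[OF x] measurable_PiM_upd[OF f]] by simp

lemma measurable_PiM_upd_integral:
  fixes f :: "_ \<Rightarrow> 'b::{banach, second_countable_topology}"
  assumes N: "prob_space (N j)" and f: "f \<in> borel_measurable (PiM (insert j I) N)"
  shows "(\<lambda>x. \<integral>u. f (x(j := u)) \<partial>N j) \<in> borel_measurable (PiM I N)"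
proof -
  interpret prob_space "N j" by fact
  show ?thesis
    using borel_measurable_lebesgue_integral[of "\<lambda>x u. f (x(j := u))" "PiM I N"] measurable_PiM_upd[OF f]
    by (simp add: case_prod_beta)
qed

text \<open>Averaging out one coordinate preserves both the bound and the bounded differences, and
  Hoeffding's lemma controls the exponential moment of the fluctuation that is averaged out.\<close>

lemma bounded_differences_exp_moment:
  fixes N :: "'i \<Rightarrow> 'x measure" and f :: "('i \<Rightarrow> 'x) \<Rightarrow> real"
  assumes "finite I" and N: "\<And>i. prob_space (N i)" and l: "0 < l"
    and "f \<in> borel_measurable (PiM I N)"
    and "\<And>x. x \<in> space (PiM I N) \<Longrightarrow> \<bar>f x\<bar> \<le> K"
    and "\<And>i x u. i \<in> I \<Longrightarrow> x \<in> space (PiM I N) \<Longrightarrow> u \<in> space (N i) \<Longrightarrow> \<bar>f (x(i := u)) - f x\<bar> \<le> c"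
  shows "(\<integral>\<^sup>+x. exp (l * (f x - (\<integral>x. f x \<partial>PiM I N))) \<partial>PiM I N) \<le> ennreal (exp (real (card I) * (l\<^sup>2 * c\<^sup>2 / 2)))"
  using assms(1,4-6)
proof (induction I arbitrary: f rule: finite_induct)
  case empty
  interpret P: prob_space "PiM {} N" by (rule prob_space_PiM[OF N])
  have triv: "f x = f (\<lambda>_. undefined)" if "x \<in> space (PiM {} N)" for x
    using that by (simp add: space_PiM)
  have "(\<integral>x. f x \<partial>PiM {} N) = (\<integral>x. f (\<lambda>_. undefined) \<partial>PiM {} N)"
    by (rule Bochner_Integration.integral_cong[OF refl triv])
  then have e: "(\<integral>x. f x \<partial>PiM {} N) = f (\<lambda>_. undefined)" by (simp add: P.prob_space)
  have "(\<integral>\<^sup>+x. exp (l * (f x - (\<integral>x. f x \<partial>PiM {} N))) \<partial>PiM {} N) = (\<integral>\<^sup>+x. 1 \<partial>PiM {} N)"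
    by (intro nn_integral_cong) (simp add: e space_PiM)
  then show ?case by (simp add: P.emeasure_space_1)
next
  case (insert j I)
  let ?P = "PiM I N" and ?P' = "PiM (insert j I) N"
  interpret P': prob_space ?P' by (rule prob_space_PiM[OF N])
  interpret P: prob_space ?P by (rule prob_space_PiM[OF N])
  interpret j: prob_space "N j" by (rule N)
  interpret PS: product_sigma_finite N
    by (rule product_sigma_finite.intro) (rule prob_space_imp_sigma_finite[OF N])
  note fm = insert.prems(1) and fb = insert.prems(2) and fd = insert.prems(3)
  define g where "g x = (\<integral>u. f (x(j := u)) \<partial>N j)" for x
  have up: "x(j := u) \<in> space ?P'" if "x \<in> space ?P" "u \<in> space (N j)" for x u
    using that by (rule fun_upd_in_space_PiM)
  have sm: "(\<lambda>u. f (x(j := u))) \<in> borel_measurable (N j)" if "x \<in> space ?P" for x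
    using fm that by (rule measurable_PiM_upd_section)
  have si: "integrable (N j) (\<lambda>u. f (x(j := u)))" if "x \<in> space ?P" for x
    by (rule j.integrable_const_bound[OF AE_I2[of _ _ ] sm[OF that], of K])
      (use fb up that in auto)
  have gm: "g \<in> borel_measurable ?P"
    unfolding g_def[abs_def] by (rule measurable_PiM_upd_integral[OF N fm])
  have const_close: "\<bar>g x - v\<bar> \<le> e" if "x \<in> space ?P" "\<And>u. u \<in> space (N j) \<Longrightarrow> \<bar>f (x(j := u)) - v\<bar> \<le> e" for x v e
  proof -
    have "g x - v = (\<integral>u. f (x(j := u)) - v \<partial>N j)"
      unfolding g_def using si[OF that(1)] by (simp add: j.prob_space)
    also have "\<bar>\<dots>\<bar> \<le> (\<integral>u. \<bar>f (x(j := u)) - v\<bar> \<partial>N j)"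
      using integral_norm_bound[of "N j" "\<lambda>u. f (x(j := u)) - v"] by simp
    also have "\<dots> \<le> (\<integral>u. e \<partial>N j)" using si[OF that(1)] that(2) by (intro integral_mono) auto
    finally show ?thesis by (simp add: j.prob_space)
  qed
  have gb: "\<bar>g x\<bar> \<le> K" if "x \<in> space ?P" for x
    using const_close[OF that, of 0 K] fb[OF up[OF that]] by simp
  have gd: "\<bar>g (x(i := v)) - g x\<bar> \<le> c" if i: "i \<in> I" and x: "x \<in> space ?P" and v: "v \<in> space (N i)" for i x v
  proof -
    have ij: "i \<noteq> j" using i insert.hyps by auto
    have xv: "x(i := v) \<in> space ?P" using x i v by (rule fun_upd_in_space_PiM')
    have "g (x(i := v)) - g x = (\<integral>u. f (x(i := v, j := u)) - f (x(j := u)) \<partial>N j)"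
      unfolding g_def using si[OF x] si[OF xv] by simp
    also have "\<bar>\<dots>\<bar> \<le> (\<integral>u. \<bar>f (x(i := v, j := u)) - f (x(j := u))\<bar> \<partial>N j)"
      using integral_norm_bound[of "N j" "\<lambda>u. f (x(i := v, j := u)) - f (x(j := u))"] by simp
    also have "\<dots> \<le> (\<integral>u. c \<partial>N j)"
    proof (intro integral_mono)
      fix u assume u: "u \<in> space (N j)"
      have tw: "x(i := v, j := u) = (x(j := u))(i := v)" using ij by (rule fun_upd_twist)
      show "\<bar>f (x(i := v, j := u)) - f (x(j := u))\<bar> \<le> c"
        unfolding tw by (rule fd[OF insertI2[OF i] up[OF x u] v])
    qed (use si[OF x] si[OF xv] in auto)
    finally show ?thesis by (simp add: j.prob_space)
  qed
  have fint: "integrable ?P' f"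
    by (rule P'.integrable_const_bound[OF AE_I2 fm, of K]) (use fb in auto)
  have Eg: "(\<integral>x. f x \<partial>?P') = (\<integral>x. g x \<partial>?P)"
    unfolding g_def by (rule PS.product_integral_insert[OF insert.hyps(1,2) fint])
  define E where "E = (\<integral>x. g x \<partial>?P)"
  have inner: "(\<integral>\<^sup>+u. exp (l * (f (x(j := u)) - g x)) \<partial>N j) \<le> ennreal (exp (l\<^sup>2 * c\<^sup>2 / 2))" if x: "x \<in> space ?P" for x
  proof -
    have close: "\<bar>f (x(j := u)) - g x\<bar> \<le> c" if u: "u \<in> space (N j)" for u
    proof -
      have "\<bar>g x - f (x(j := u))\<bar> \<le> c"
      proof (rule const_close[OF x])
        fix u' assume u': "u' \<in> space (N j)"
        show "\<bar>f (x(j := u')) - f (x(j := u))\<bar> \<le> c"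
          using fd[OF insertI1 up[OF x u] u'] by (simp only: fun_upd_upd)
      qed
      then show ?thesis by linarith
    qed
    \<comment> \<open>The section stays within \<open>c\<close> of its mean \<open>g x\<close>, an
      interval of length 2 c, so Hoeffding's factor (2 c)^2 / 8 equals c^2 / 2.\<close>
    interpret B: interval_bounded_random_variable "N j" "\<lambda>u. f (x(j := u))" "g x - c" "g x + c"
    proof unfold_locales
      show "AE u in N j. f (x(j := u)) \<in> {g x - c..g x + c}"
        by (rule AE_I2) (use close in \<open>force simp: abs_le_iff\<close>)
    qed (rule sm[OF x])
    have "l\<^sup>2 * (g x + c - (g x - c))\<^sup>2 / 8 = l\<^sup>2 * c\<^sup>2 / 2" by (simp add: power2_eq_square)
    from B.Hoeffdings_lemma_nn_integral[OF l, folded g_def, unfolded this] show ?thesis .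
  qed
  have "(\<integral>\<^sup>+x. exp (l * (f x - (\<integral>x. f x \<partial>?P'))) \<partial>?P')
      = (\<integral>\<^sup>+x. \<integral>\<^sup>+u. exp (l * (f (x(j := u)) - E)) \<partial>N j \<partial>?P)"
    unfolding Eg E_def[symmetric]
    by (rule PS.product_nn_integral_insert[OF insert.hyps(1,2)]) (use fm in measurable)
  also have "\<dots> \<le> (\<integral>\<^sup>+x. ennreal (exp (l\<^sup>2 * c\<^sup>2 / 2)) * ennreal (exp (l * (g x - E))) \<partial>?P)"
  proof (intro nn_integral_mono)
    fix x assume x: "x \<in> space ?P"
    have "(\<integral>\<^sup>+u. exp (l * (f (x(j := u)) - E)) \<partial>N j)
        = (\<integral>\<^sup>+u. ennreal (exp (l * (g x - E))) * ennreal (exp (l * (f (x(j := u)) - g x))) \<partial>N j)"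
      by (intro nn_integral_cong) (simp add: ennreal_mult'[symmetric] exp_add[symmetric] algebra_simps)
    also have "\<dots> = ennreal (exp (l * (g x - E))) * (\<integral>\<^sup>+u. exp (l * (f (x(j := u)) - g x)) \<partial>N j)"
      by (intro nn_integral_cmult) (use sm[OF x] in measurable)
    also have "\<dots> \<le> ennreal (exp (l * (g x - E))) * ennreal (exp (l\<^sup>2 * c\<^sup>2 / 2))"
      by (intro mult_left_mono inner[OF x]) simp
    finally show "(\<integral>\<^sup>+u. exp (l * (f (x(j := u)) - E)) \<partial>N j)
      \<le> ennreal (exp (l\<^sup>2 * c\<^sup>2 / 2)) * ennreal (exp (l * (g x - E)))" by (simp add: mult.commute)
  qed
  also have "\<dots> = ennreal (exp (l\<^sup>2 * c\<^sup>2 / 2)) * (\<integral>\<^sup>+x. exp (l * (g x - E)) \<partial>?P)"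
    by (intro nn_integral_cmult) (use gm in measurable)
  also have "\<dots> \<le> ennreal (exp (l\<^sup>2 * c\<^sup>2 / 2)) * ennreal (exp (real (card I) * (l\<^sup>2 * c\<^sup>2 / 2)))"
    unfolding E_def by (intro mult_left_mono insert.IH gm gb gd) auto
  also have "\<dots> = ennreal (exp (real (card (insert j I)) * (l\<^sup>2 * c\<^sup>2 / 2)))"
    using insert.hyps by (simp add: ennreal_mult'[symmetric] exp_add[symmetric] algebra_simps)
  finally show ?case .
qed

text \<open>Chernoff's bound for f and for - f: an inequality of McDiarmid's type, with a constant
  in the exponent that is not optimal.\<close>

lemma bounded_differences_tail:
  fixes N :: "'i \<Rightarrow> 'x measure" and f :: "('i \<Rightarrow> 'x) \<Rightarrow> real"
  assumes I: "finite I" "I \<noteq> {}" and N: "\<And>i. prob_space (N i)"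
    and f: "f \<in> borel_measurable (PiM I N)"
    and fb: "\<And>x. x \<in> space (PiM I N) \<Longrightarrow> \<bar>f x\<bar> \<le> K"
    and fd: "\<And>i x u. i \<in> I \<Longrightarrow> x \<in> space (PiM I N) \<Longrightarrow> u \<in> space (N i) \<Longrightarrow> \<bar>f (x(i := u)) - f x\<bar> \<le> c"
    and c: "0 < c" and t: "0 < t"
  shows "measure (PiM I N) {x \<in> space (PiM I N). t \<le> \<bar>f x - (\<integral>x. f x \<partial>PiM I N)\<bar>}
     \<le> 2 * exp (- (t\<^sup>2 / (2 * real (card I) * c\<^sup>2)))"
proof -
  interpret P: prob_space "PiM I N" by (rule prob_space_PiM[OF N])
  define n where "n = real (card I)"
  have n: "0 < n" using I by (simp add: n_def card_gt_0_iff)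
  \<comment> \<open>Minimises the exponent n l^2 c^2 / 2 - l t; the minimum is - t^2 / (2 n
    c^2).\<close>
  define l where "l = t / (n * c\<^sup>2)"
  have l: "0 < l" using n t c by (simp add: l_def)
  have one: "P.prob {x \<in> space (PiM I N). t \<le> h x - (\<integral>x. h x \<partial>PiM I N)} \<le> exp (- (t\<^sup>2 / (2 * n * c\<^sup>2)))"
    if h: "h \<in> borel_measurable (PiM I N)" "\<And>x. x \<in> space (PiM I N) \<Longrightarrow> \<bar>h x\<bar> \<le> K"
      "\<And>i x u. i \<in> I \<Longrightarrow> x \<in> space (PiM I N) \<Longrightarrow> u \<in> space (N i) \<Longrightarrow> \<bar>h (x(i := u)) - h x\<bar> \<le> c" for h
  proof -
    define E where "E = (\<integral>x. h x \<partial>PiM I N)"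
    define S where "S = {x \<in> space (PiM I N). t \<le> h x - E}"
    have S: "S \<in> sets (PiM I N)" unfolding S_def using h(1) by measurable
    have "ennreal (exp (l * t)) * emeasure (PiM I N) S = (\<integral>\<^sup>+x. ennreal (exp (l * t)) * indicator S x \<partial>PiM I N)"
      using S by (simp add: nn_integral_cmult_indicator)
    also have "\<dots> \<le> (\<integral>\<^sup>+x. exp (l * (h x - E)) \<partial>PiM I N)"
      using l by (intro nn_integral_mono) (auto simp: S_def split: split_indicator intro!: ennreal_leI)
    also have "\<dots> \<le> ennreal (exp (n * (l\<^sup>2 * c\<^sup>2 / 2)))"
      unfolding E_def n_def by (rule bounded_differences_exp_moment[OF I(1) N l h])
    finally have "ennreal (exp (l * t) * P.prob S) \<le> ennreal (exp (n * (l\<^sup>2 * c\<^sup>2 / 2)))"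
      by (simp add: P.emeasure_eq_measure ennreal_mult')
    then have "exp (l * t) * P.prob S \<le> exp (n * (l\<^sup>2 * c\<^sup>2 / 2))" by (subst (asm) ennreal_le_iff) auto
    then have "P.prob S \<le> exp (n * (l\<^sup>2 * c\<^sup>2 / 2)) / exp (l * t)" by (simp add: field_simps)
    also have "\<dots> = exp (n * (l\<^sup>2 * c\<^sup>2 / 2) - l * t)" by (simp add: exp_diff)
    also have "n * (l\<^sup>2 * c\<^sup>2 / 2) - l * t = - (t\<^sup>2 / (2 * n * c\<^sup>2))"
      using n c by (simp add: l_def field_simps power2_eq_square)
    finally show ?thesis unfolding S_def E_def .
  qed
  define E where "E = (\<integral>x. f x \<partial>PiM I N)"
  define S1 where "S1 = {x \<in> space (PiM I N). t \<le> f x - E}"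
  define S2 where "S2 = {x \<in> space (PiM I N). t \<le> - f x - (- E)}"
  have S: "S1 \<in> P.events" "S2 \<in> P.events" unfolding S1_def S2_def using f by measurable
  have "\<bar>- f (x(i := u)) - - f x\<bar> \<le> c" if "i \<in> I" "x \<in> space (PiM I N)" "u \<in> space (N i)" for i x u
    using fd[OF that] by linarith
  then have 2: "P.prob S2 \<le> exp (- (t\<^sup>2 / (2 * n * c\<^sup>2)))"
    using one[of "\<lambda>x. - f x"] f fb by (simp add: S2_def E_def)
  have 1: "P.prob S1 \<le> exp (- (t\<^sup>2 / (2 * n * c\<^sup>2)))"
    using one[of f] f fb fd by (simp add: S1_def E_def)
  have "{x \<in> space (PiM I N). t \<le> \<bar>f x - (\<integral>x. f x \<partial>PiM I N)\<bar>} = S1 \<union> S2"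
    unfolding S1_def S2_def E_def[symmetric] by auto
  then have "P.prob {x \<in> space (PiM I N). t \<le> \<bar>f x - (\<integral>x. f x \<partial>PiM I N)\<bar>} \<le> P.prob S1 + P.prob S2"
    using measure_Un_le[OF S] by simp
  with 1 2 show ?thesis unfolding n_def by simp
qed

section \<open>Lindeberg exchange on product measures\<close>

text \<open>Telescoping over hybrid laws with \<mu> on the first k coordinates and \<nu> on the
  others: consecutive hybrids differ in coordinate k only. The hypothesis \<open>step\<close> is
  stated for every mixture \<kappa> of the two laws, which covers all hybrids.\<close>

lemma product_swap:
  fixes f :: "(nat \<Rightarrow> 'x) \<Rightarrow> complex"
  assumes mu: "prob_space \<mu>" "sets \<mu> = sets V" and nu: "prob_space \<nu>" "sets \<nu> = sets V"
    and f: "f \<in> borel_measurable (\<Pi>\<^sub>M i\<in>{..<n}. V)"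
    and fb: "\<And>x. x \<in> space (\<Pi>\<^sub>M i\<in>{..<n}. V) \<Longrightarrow> cmod (f x) \<le> K"
    and step: "\<And>j \<kappa>. j < n \<Longrightarrow> (\<And>i. \<kappa> i = \<mu> \<or> \<kappa> i = \<nu>) \<Longrightarrow>
      cmod (\<integral>x. (\<integral>u. f (x(j := u)) \<partial>\<mu>) - (\<integral>u. f (x(j := u)) \<partial>\<nu>) \<partial>PiM ({..<n} - {j}) \<kappa>) \<le> \<delta>"
  shows "cmod ((\<integral>x. f x \<partial>(\<Pi>\<^sub>M i\<in>{..<n}. \<mu>)) - (\<integral>x. f x \<partial>(\<Pi>\<^sub>M i\<in>{..<n}. \<nu>))) \<le> real n * \<delta>"
proof -
  define \<kappa> where "\<kappa> k i = (if i < k then \<mu> else \<nu>)" for k i :: nat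
  have kap: "\<kappa> k i = \<mu> \<or> \<kappa> k i = \<nu>" for k i by (simp add: \<kappa>_def)
  have kp: "prob_space (\<kappa> k i)" and ks: "sets (\<kappa> k i) = sets V" for k i using mu nu by (auto simp: \<kappa>_def)
  define E where "E k = (\<integral>x. f x \<partial>PiM {..<n} (\<kappa> k))" for k
  have setsP: "sets (PiM J (\<kappa> k)) = sets (\<Pi>\<^sub>M i\<in>J. V)" for J k by (intro sets_PiM_cong ks) auto
  have spaceP: "space (PiM J (\<kappa> k)) = space (\<Pi>\<^sub>M i\<in>J. V)" for J k by (rule sets_eq_imp_space_eq[OF setsP])
  have fm: "f \<in> borel_measurable (PiM {..<n} (\<kappa> k))" for k
    using f by (simp cong: measurable_cong_sets add: measurable_cong_sets[OF setsP refl])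
  have st: "cmod (E (Suc k) - E k) \<le> \<delta>" if k: "k < n" for k
  proof -
    let ?J = "{..<n} - {k}"
    have ins: "insert k ?J = {..<n}" using k by auto
    have P: "PiM ?J (\<kappa> (Suc k)) = PiM ?J (\<kappa> k)" by (intro PiM_cong refl) (auto simp: \<kappa>_def)
    interpret PJ: prob_space "PiM ?J (\<kappa> k)" by (rule prob_space_PiM[OF kp])
    have ex: "E k' = (\<integral>x. \<integral>u. f (x(k := u)) \<partial>\<kappa> k' k \<partial>PiM ?J (\<kappa> k'))" for k'
    proof -
      interpret PS: product_sigma_finite "\<kappa> k'"
        by (rule product_sigma_finite.intro) (rule prob_space_imp_sigma_finite[OF kp])
      interpret PP: prob_space "PiM {..<n} (\<kappa> k')" by (rule prob_space_PiM[OF kp])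
      have "integrable (PiM {..<n} (\<kappa> k')) f"
        by (rule PP.integrable_const_bound[OF AE_I2 fm, of K]) (use fb spaceP in auto)
      then show ?thesis
        unfolding E_def using PS.product_integral_insert[of ?J k f] unfolding ins by simp
    qed
    have m: "(\<lambda>x. \<integral>u. f (x(k := u)) \<partial>\<kappa> k' k) \<in> borel_measurable (PiM ?J (\<kappa> k'))" for k'
      by (rule measurable_PiM_upd_integral[where N = "\<kappa> k'"]) (rule kp, simp only: ins fm)
    have int: "integrable (PiM ?J (\<kappa> k)) (\<lambda>x. \<integral>u. f (x(k := u)) \<partial>\<kappa> k' k)"
      if P': "PiM ?J (\<kappa> k') = PiM ?J (\<kappa> k)" for k'
    proof (rule PJ.integrable_const_bound[OF AE_I2, of _ K])
      show "(\<lambda>x. \<integral>u. f (x(k := u)) \<partial>\<kappa> k' k) \<in> borel_measurable (PiM ?J (\<kappa> k))" using m[of k'] unfolding P' .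
      fix x assume x: "x \<in> space (PiM ?J (\<kappa> k))"
      interpret kk: prob_space "\<kappa> k' k" by (rule kp)
      have x': "x \<in> space (PiM ?J (\<kappa> k'))" using x unfolding P' .
      have up: "cmod (f (x(k := u))) \<le> K" if "u \<in> space (\<kappa> k' k)" for u
        using fun_upd_in_space_PiM[OF x' that] unfolding ins spaceP by (rule fb)
      have sm: "(\<lambda>u. f (x(k := u))) \<in> borel_measurable (\<kappa> k' k)"
        by (rule measurable_PiM_upd_section[OF _ x']) (simp only: ins fm)
      have si: "integrable (\<kappa> k' k) (\<lambda>u. f (x(k := u)))"
        by (rule kk.integrable_const_bound[OF AE_I2 sm, of K]) (use up in auto)
      have "cmod (\<integral>u. f (x(k := u)) \<partial>\<kappa> k' k) \<le> (\<integral>u. cmod (f (x(k := u))) \<partial>\<kappa> k' k)"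
        by (rule integral_norm_bound)
      also have "\<dots> \<le> (\<integral>u. K \<partial>\<kappa> k' k)" using si up by (intro integral_mono) auto
      finally show "cmod (\<integral>u. f (x(k := u)) \<partial>\<kappa> k' k) \<le> K" by (simp add: kk.prob_space)
    qed
    have "E (Suc k) - E k = (\<integral>x. \<integral>u. f (x(k := u)) \<partial>\<mu> \<partial>PiM ?J (\<kappa> k)) - (\<integral>x. \<integral>u. f (x(k := u)) \<partial>\<nu> \<partial>PiM ?J (\<kappa> k))"
      unfolding ex P by (simp add: \<kappa>_def)
    also have "\<dots> = (\<integral>x. (\<integral>u. f (x(k := u)) \<partial>\<mu>) - (\<integral>u. f (x(k := u)) \<partial>\<nu>) \<partial>PiM ?J (\<kappa> k))"
      using int[OF P] int[OF refl] by (simp add: \<kappa>_def)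
    finally show ?thesis using step[OF k kap] by simp
  qed
  have "cmod (E k - E 0) \<le> real k * \<delta>" if "k \<le> n" for k
    using that
  proof (induction k)
    case (Suc k)
    have "cmod (E (Suc k) - E 0) \<le> cmod (E (Suc k) - E k) + cmod (E k - E 0)"
      using norm_triangle_ineq[of "E (Suc k) - E k" "E k - E 0"] by simp
    also have "\<dots> \<le> \<delta> + real k * \<delta>" using Suc st[of k] by simp
    finally show ?case by (simp add: algebra_simps)
  qed simp
  from this[of n] have "cmod (E n - E 0) \<le> real n * \<delta>" by simp
  moreover have "PiM {..<n} (\<kappa> n) = (\<Pi>\<^sub>M i\<in>{..<n}. \<mu>)" "PiM {..<n} (\<kappa> 0) = (\<Pi>\<^sub>M i\<in>{..<n}. \<nu>)"
    by (intro PiM_cong; simp add: \<kappa>_def)+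
  ultimately show ?thesis by (simp add: E_def)
qed

section \<open>Exchanging one column\<close>

lemma second_moment_integral:
  assumes X: "second_moment_le M q X l t" and l: "0 \<le> l" and a: "a \<in> carrier_vec q"
  shows "integrable M (\<lambda>\<omega>. (a \<bullet> X \<omega>)\<^sup>2)" "(\<integral>\<omega>. (a \<bullet> X \<omega>)\<^sup>2 \<partial>M) \<le> l * (a \<bullet> a)"
proof -
  have m: "X \<in> measurable M (vec_borel q)" using X by (simp add: second_moment_le_def)
  then have Xc: "X \<omega> \<in> carrier_vec q" if "\<omega> \<in> space M" for \<omega> using that by (auto simp: measurable_vec_borel_iff)
  have "(\<lambda>\<omega>. (\<Sum>i<q. a $ i * X \<omega> $ i)\<^sup>2) \<in> borel_measurable M"
    by (intro borel_measurable_power borel_measurable_sum borel_measurable_times borel_measurable_const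
        measurable_vec_index[OF m]) auto
  then have bm: "(\<lambda>\<omega>. (a \<bullet> X \<omega>)\<^sup>2) \<in> borel_measurable M"
    by (rule measurable_cong[THEN iffD2, rotated]) (simp add: scalar_prod_sum[OF Xc])
  have le: "(\<integral>\<^sup>+\<omega>. ennreal ((a \<bullet> X \<omega>)\<^sup>2) \<partial>M) \<le> ennreal (l * (a \<bullet> a))"
    using X a by (simp add: second_moment_le_def)
  show i: "integrable M (\<lambda>\<omega>. (a \<bullet> X \<omega>)\<^sup>2)"
    by (rule integrableI_nonneg[OF bm]) (use le in \<open>auto simp: less_top[symmetric] top_unique\<close>)
  have "ennreal (\<integral>\<omega>. (a \<bullet> X \<omega>)\<^sup>2 \<partial>M) \<le> ennreal (l * (a \<bullet> a))"
    using le i by (subst (asm) nn_integral_eq_integral) auto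
  then show "(\<integral>\<omega>. (a \<bullet> X \<omega>)\<^sup>2 \<partial>M) \<le> l * (a \<bullet> a)"
    using l scalar_prod_self_nonneg[of a] by (subst (asm) ennreal_le_iff) auto
qed

lemma second_moment_norm_integral:
  assumes X: "second_moment_le M q X l t" and t: "0 \<le> t"
  shows "integrable (distr M (vec_borel q) X) (\<lambda>u. u \<bullet> u)" "(\<integral>u. u \<bullet> u \<partial>distr M (vec_borel q) X) \<le> t"
proof -
  have m: "X \<in> measurable M (vec_borel q)" using X by (simp add: second_moment_le_def)
  have "(\<lambda>u. \<Sum>i<q. u $ i * u $ i) \<in> borel_measurable (vec_borel q)"
    by (intro borel_measurable_sum borel_measurable_times measurable_vec_index[OF measurable_ident]) auto
  then have bm: "(\<lambda>u. u \<bullet> u) \<in> borel_measurable (vec_borel q)"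
    by (rule measurable_cong[THEN iffD2, rotated]) (simp add: scalar_prod_sum)
  have le: "(\<integral>\<^sup>+\<omega>. ennreal (X \<omega> \<bullet> X \<omega>) \<partial>M) \<le> ennreal t"
    using X by (simp add: second_moment_le_def)
  have i: "integrable M (\<lambda>\<omega>. X \<omega> \<bullet> X \<omega>)"
    by (rule integrableI_nonneg[OF measurable_compose[OF m bm]])
      (use le in \<open>auto simp: less_top[symmetric] top_unique scalar_prod_self_nonneg\<close>)
  then show "integrable (distr M (vec_borel q) X) (\<lambda>u. u \<bullet> u)"
    using integrable_distr_eq[OF m bm] by simp
  have "ennreal (\<integral>\<omega>. X \<omega> \<bullet> X \<omega> \<partial>M) \<le> ennreal t"
    using le i by (subst (asm) nn_integral_eq_integral) (auto simp: scalar_prod_self_nonneg)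
  then show "(\<integral>u. u \<bullet> u \<partial>distr M (vec_borel q) X) \<le> t"
    using t by (subst (asm) ennreal_le_iff) (auto simp: integral_distr[OF m bm])
qed

definition gram_trace :: "nat \<Rightarrow> nat \<Rightarrow> (nat \<Rightarrow> nat \<Rightarrow> real) \<Rightarrow> complex \<Rightarrow> (nat \<Rightarrow> real vec) \<Rightarrow> complex" where
  "gram_trace q n g \<zeta> x = trace_resolvent (gram q n g x) \<zeta>"

lemma gram_trace_measurable:
  "0 < Im \<zeta> \<Longrightarrow> gram_trace q n g \<zeta> \<in> borel_measurable (\<Pi>\<^sub>M i\<in>{..<n}. vec_borel q)"
  unfolding gram_trace_def[abs_def]
  by (rule borel_measurable_trace_resolvent[OF gram_psd _ borel_measurable_gram_index])

lemma gram_trace_bound: "0 < Im \<zeta> \<Longrightarrow> cmod (gram_trace q n g \<zeta> x) \<le> real q / Im \<zeta>"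
  unfolding gram_trace_def by (rule trace_resolvent_bound[OF gram_psd])

text \<open>The matrix \<open>S\<close> depends on \<open>x\<close> and \<open>j\<close> but not on
  the inserted column, which thus acts through the rank-one vector alone.\<close>

lemma gram_trace_rank_one:
  assumes j: "j < n" and z: "0 < Im \<zeta>"
  obtains S where "sym_psd_mat q S"
    "\<And>u u'. u \<in> carrier_vec q \<Longrightarrow> u' \<in> carrier_vec q \<Longrightarrow>
       cmod (gram_trace q n g \<zeta> (x(j := u)) - gram_trace q n g \<zeta> (x(j := u'))) =
       (let v = loading n g j \<cdot>\<^sub>v u + residual q n g j x; v' = loading n g j \<cdot>\<^sub>v u' + residual q n g j x
        in cmod (rk_num S \<zeta> v / rk_den S \<zeta> v - rk_num S \<zeta> v' / rk_den S \<zeta> v'))"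
    "\<And>u u'. u \<in> carrier_vec q \<Longrightarrow> u' \<in> carrier_vec q \<Longrightarrow>
       cmod (gram_trace q n g \<zeta> (x(j := u)) - gram_trace q n g \<zeta> (x(j := u'))) \<le> 2 / Im \<zeta>"
proof -
  obtain S where S: "sym_psd_mat q S"
    and eq: "\<And>u a c. u \<in> carrier_vec q \<Longrightarrow> a < q \<Longrightarrow> c < q \<Longrightarrow>
       gram q n g (x(j := u)) $$ (a, c) = S $$ (a, c) +
         (loading n g j \<cdot>\<^sub>v u + residual q n g j x) $ a * (loading n g j \<cdot>\<^sub>v u + residual q n g j x) $ c"
    using gram_complete_square[OF j, of q g x] by metis
  have c: "loading n g j \<cdot>\<^sub>v u + residual q n g j x \<in> carrier_vec q" if "u \<in> carrier_vec q" for u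
    using that by (auto simp: residual_def)
  show thesis
  proof (rule that[OF S])
    fix u u' :: "real vec" assume u: "u \<in> carrier_vec q" and u': "u' \<in> carrier_vec q"
    show "cmod (gram_trace q n g \<zeta> (x(j := u)) - gram_trace q n g \<zeta> (x(j := u'))) =
       (let v = loading n g j \<cdot>\<^sub>v u + residual q n g j x; v' = loading n g j \<cdot>\<^sub>v u' + residual q n g j x
        in cmod (rk_num S \<zeta> v / rk_den S \<zeta> v - rk_num S \<zeta> v' / rk_den S \<zeta> v'))"
      unfolding gram_trace_def Let_def
      by (rule trace_resolvent_rank_one_diff(1)[OF S gram_psd gram_psd z c[OF u] c[OF u']]) (simp_all only: eq u u')
    show "cmod (gram_trace q n g \<zeta> (x(j := u)) - gram_trace q n g \<zeta> (x(j := u'))) \<le> 2 / Im \<zeta>"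
      unfolding gram_trace_def
      by (rule trace_resolvent_rank_one_diff(2)[OF S gram_psd gram_psd z c[OF u] c[OF u']]) (simp_all only: eq u u')
  qed
qed

text \<open>The constants of \<open>rank_one_swap\<close>: here the Lipschitz factor of the
  quotient, in \<open>resolvent_const\<close> the norm bound covering both R and R^2.\<close>

definition swap_const :: "complex \<Rightarrow> real" where
  "swap_const \<zeta> = cmod \<zeta> / Im \<zeta> * (1 + 1 / Im \<zeta>)"

definition resolvent_const :: "complex \<Rightarrow> real" where
  "resolvent_const \<zeta> = 1 / Im \<zeta> + 1 / (Im \<zeta>)\<^sup>2"

text \<open>The two laws are realised by \<open>y\<close> and \<open>z\<close> on the same space, so
  the difference is the mean of \<phi> (y) - \<phi> (z). Where one of the four quadratic forms
  deviates by more than \<open>e\<close>, the trivial bound 2 / Im \<zeta> is paid, with probability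
  at most \<eta> for each form; elsewhere \<open>rank_one_swap\<close> applies. The other columns
  \<open>x\<close> are fixed, which makes the matrices \<open>A k\<close> deterministic.\<close>

lemma column_swap:
  assumes M: "prob_space M" and z0: "0 < Im \<zeta>"
    and y: "second_moment_le M q y l t" and z: "second_moment_le M q z l t" and l: "0 \<le> l"
    and qf: "\<And>A. bounded_sym q (resolvent_const \<zeta>) A \<Longrightarrow>
      measure M {\<omega> \<in> space M. e < \<bar>qform A (y \<omega>) - qform A (z \<omega>)\<bar>} \<le> \<eta>"
    and e: "0 \<le> e" and s: "0 < s" and j: "j < n" and b: "loading n g j \<le> b"
    and x: "x \<in> space (\<Pi>\<^sub>M i\<in>{..<n} - {j}. vec_borel q)"
  shows "cmod ((\<integral>u. gram_trace q n g \<zeta> (x(j := u)) \<partial>distr M (vec_borel q) y)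
        - (\<integral>u. gram_trace q n g \<zeta> (x(j := u)) \<partial>distr M (vec_borel q) z))
     \<le> 4 * (2 / Im \<zeta> * \<eta> + swap_const \<zeta> * (b\<^sup>2 * e + 2 * b * s))
       + 8 * swap_const \<zeta> * b * l * (resolvent_const \<zeta>)\<^sup>2 / s * (residual q n g j x \<bullet> residual q n g j x)"
proof -
  interpret prob_space M by fact
  define \<phi> where "\<phi> u = gram_trace q n g \<zeta> (x(j := u))" for u
  define \<alpha> where "\<alpha> = residual q n g j x"
  define \<beta> where "\<beta> = loading n g j"
  define K where "K = swap_const \<zeta>"
  define C where "C = resolvent_const \<zeta>"
  have \<alpha>: "\<alpha> \<in> carrier_vec q" by (simp add: \<alpha>_def residual_def)
  have \<beta>: "0 \<le> \<beta>" "\<beta> \<le> b" using b by (auto simp: \<beta>_def loading_def sum_nonneg)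
  have K: "0 \<le> K" using z0 by (simp add: K_def swap_const_def)
  have ym: "y \<in> measurable M (vec_borel q)" and zm: "z \<in> measurable M (vec_borel q)"
    using y z by (auto simp: second_moment_le_def)
  have yc: "y \<omega> \<in> carrier_vec q" and zc: "z \<omega> \<in> carrier_vec q" if "\<omega> \<in> space M" for \<omega>
    using that ym zm by (auto simp: measurable_vec_borel_iff)
  have ins: "insert j ({..<n} - {j}) = {..<n}" using j by auto
  have "gram_trace q n g \<zeta> \<in> borel_measurable (\<Pi>\<^sub>M i\<in>insert j ({..<n} - {j}). vec_borel q)"
    unfolding ins by (rule gram_trace_measurable[OF z0])
  from measurable_PiM_upd_section[OF this x] have \<phi>m: "\<phi> \<in> borel_measurable (vec_borel q)"
    unfolding \<phi>_def[abs_def] .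
  have \<phi>b: "cmod (\<phi> u) \<le> real q / Im \<zeta>" for u unfolding \<phi>_def by (rule gram_trace_bound[OF z0])
  have int: "integrable M (\<lambda>\<omega>. \<phi> (X \<omega>))" if "X \<in> measurable M (vec_borel q)" for X
    by (rule integrable_const_bound[OF AE_I2 measurable_compose[OF that \<phi>m]]) (rule \<phi>b)
  obtain S where S: "sym_psd_mat q S"
    and D: "\<And>u u'. u \<in> carrier_vec q \<Longrightarrow> u' \<in> carrier_vec q \<Longrightarrow> cmod (\<phi> u - \<phi> u') =
       cmod (rk_num S \<zeta> (\<beta> \<cdot>\<^sub>v u + \<alpha>) / rk_den S \<zeta> (\<beta> \<cdot>\<^sub>v u + \<alpha>)
         - rk_num S \<zeta> (\<beta> \<cdot>\<^sub>v u' + \<alpha>) / rk_den S \<zeta> (\<beta> \<cdot>\<^sub>v u' + \<alpha>))"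
    and D2: "\<And>u u'. u \<in> carrier_vec q \<Longrightarrow> u' \<in> carrier_vec q \<Longrightarrow> cmod (\<phi> u - \<phi> u') \<le> 2 / Im \<zeta>"
    by (rule gram_trace_rank_one[OF j z0, of q g x, unfolded Let_def, folded \<phi>_def \<alpha>_def \<beta>_def],
      rule that)
  obtain A :: "nat \<Rightarrow> real mat" where A: "\<And>k. bounded_sym q C (A k)"
    and AD: "\<And>\<beta> a y w. y \<in> carrier_vec q \<Longrightarrow> w \<in> carrier_vec q \<Longrightarrow> a \<in> carrier_vec q \<Longrightarrow>
       cmod (rk_num S \<zeta> (\<beta> \<cdot>\<^sub>v y + a) / rk_den S \<zeta> (\<beta> \<cdot>\<^sub>v y + a)
           - rk_num S \<zeta> (\<beta> \<cdot>\<^sub>v w + a) / rk_den S \<zeta> (\<beta> \<cdot>\<^sub>v w + a))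
       \<le> K * (\<Sum>k<4. \<beta>\<^sup>2 * \<bar>qform (A k) y - qform (A k) w\<bar>
           + 2 * \<bar>\<beta>\<bar> * (\<bar>(A k *\<^sub>v a) \<bullet> y\<bar> + \<bar>(A k *\<^sub>v a) \<bullet> w\<bar>))"
    by (rule rank_one_swap[OF S z0, folded swap_const_def resolvent_const_def, folded C_def K_def],
      rule that)
  define B where "B k = A k *\<^sub>v \<alpha>" for k
  have Ac: "A k \<in> carrier_mat q q" for k using A[of k] by (auto simp: bounded_sym_def sym_mat_def)
  have B: "B k \<in> carrier_vec q" for k using Ac[of k] \<alpha> by (simp add: B_def)
  have BB: "B k \<bullet> B k \<le> C\<^sup>2 * (\<alpha> \<bullet> \<alpha>)" for k using A[of k] \<alpha> by (simp add: B_def bounded_sym_def)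
  define bad where "bad k = {\<omega> \<in> space M. e < \<bar>qform (A k) (y \<omega>) - qform (A k) (z \<omega>)\<bar>}" for k
  have qm: "(\<lambda>\<omega>. qform (A k) (X \<omega>)) \<in> borel_measurable M" if X: "X \<in> measurable M (vec_borel q)" for X k
  proof -
    have Xc: "X \<omega> \<in> carrier_vec q" if "\<omega> \<in> space M" for \<omega> using that X by (auto simp: measurable_vec_borel_iff)
    have "(\<lambda>\<omega>. \<Sum>i<q. \<Sum>j<q. A k $$ (i, j) * (X \<omega> $ i * X \<omega> $ j)) \<in> borel_measurable M"
      by (intro borel_measurable_sum borel_measurable_times borel_measurable_const measurable_vec_index[OF X]) auto
    then show ?thesis
      by (rule measurable_cong[THEN iffD2, rotated]) (simp add: qform_def quad_form_sum[OF Ac Xc Xc])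
  qed
  have badm: "bad k \<in> events" for k unfolding bad_def using qm[OF ym, of k] qm[OF zm, of k] by measurable
  have badp: "prob (bad k) \<le> \<eta>" for k unfolding bad_def by (rule qf) (use A in \<open>simp add: C_def\<close>)
  \<comment> \<open>For each of the four matrices: the cost of the bad event, the level reached off
    it, and the second moments that dominate the linear terms. All summands are nonnegative, so a
    single bad \<open>k\<close> pays for the whole difference.\<close>
  define h where "h k \<omega> = 2 / Im \<zeta> * indicator (bad k) \<omega> + K * (\<beta>\<^sup>2 * e + 2 * \<beta> * s)
     + K * \<beta> / s * ((B k \<bullet> y \<omega>)\<^sup>2 + (B k \<bullet> z \<omega>)\<^sup>2)" for k \<omega>
  have pointwise: "cmod (\<phi> (y \<omega>) - \<phi> (z \<omega>)) \<le> (\<Sum>k<4. h k \<omega>)" if \<omega>: "\<omega> \<in> space M" for \<omega>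
  proof (cases "\<exists>k<4. \<omega> \<in> bad k")
    case True
    then obtain k where k: "k < (4::nat)" "\<omega> \<in> bad k" by auto
    have hn: "0 \<le> h k \<omega>" for k unfolding h_def using z0 K \<beta> e s
      by (intro add_nonneg_nonneg mult_nonneg_nonneg divide_nonneg_nonneg) auto
    have "cmod (\<phi> (y \<omega>) - \<phi> (z \<omega>)) \<le> 2 / Im \<zeta>" by (rule D2[OF yc[OF \<omega>] zc[OF \<omega>]])
    also have "\<dots> \<le> h k \<omega>" unfolding h_def using k(2) z0 K \<beta> e s by simp
    also have "\<dots> \<le> (\<Sum>k<4. h k \<omega>)" by (rule member_le_sum) (use k hn in auto)
    finally show ?thesis .
  next
    case False
    have "cmod (\<phi> (y \<omega>) - \<phi> (z \<omega>)) \<le> K * (\<Sum>k<4. \<beta>\<^sup>2 * \<bar>qform (A k) (y \<omega>) - qform (A k) (z \<omega>)\<bar>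
           + 2 * \<bar>\<beta>\<bar> * (\<bar>B k \<bullet> y \<omega>\<bar> + \<bar>B k \<bullet> z \<omega>\<bar>))"
      unfolding D[OF yc[OF \<omega>] zc[OF \<omega>]] B_def by (rule AD[OF yc[OF \<omega>] zc[OF \<omega>] \<alpha>])
    also have "\<dots> \<le> (\<Sum>k<4. h k \<omega>)"
      unfolding sum_distrib_left
    proof (intro sum_mono)
      fix k :: nat assume "k \<in> {..<4}"
      with False \<omega> have qe: "\<bar>qform (A k) (y \<omega>) - qform (A k) (z \<omega>)\<bar> \<le> e" by (auto simp: bad_def)
      define P R where PR: "P = B k \<bullet> y \<omega>" "R = B k \<bullet> z \<omega>"
      \<comment> \<open>The linear terms are not small pointwise. They are traded for the level
        \<open>s\<close> plus a square whose mean is controlled; the level stays free until the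
        limit is taken.\<close>
      have amgm: "2 * \<bar>p\<bar> \<le> s + p\<^sup>2 / s" for p :: real
        using s sum_squares_bound[of s "\<bar>p\<bar>"] by (simp add: field_simps power2_eq_square)
      have "\<beta>\<^sup>2 * \<bar>qform (A k) (y \<omega>) - qform (A k) (z \<omega>)\<bar> + 2 * \<bar>\<beta>\<bar> * (\<bar>P\<bar> + \<bar>R\<bar>)
        \<le> \<beta>\<^sup>2 * e + \<beta> * ((s + P\<^sup>2 / s) + (s + R\<^sup>2 / s))"
      proof (intro add_mono mult_left_mono qe)
        have "2 * \<bar>\<beta>\<bar> * (\<bar>P\<bar> + \<bar>R\<bar>) = \<beta> * (2 * \<bar>P\<bar> + 2 * \<bar>R\<bar>)" using \<beta> by (simp add: algebra_simps)
        also have "\<dots> \<le> \<beta> * ((s + P\<^sup>2 / s) + (s + R\<^sup>2 / s))"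
          using \<beta> amgm[of P] amgm[of R] by (intro mult_left_mono add_mono) auto
        finally show "2 * \<bar>\<beta>\<bar> * (\<bar>P\<bar> + \<bar>R\<bar>) \<le> \<beta> * ((s + P\<^sup>2 / s) + (s + R\<^sup>2 / s))" .
      qed simp
      then have "K * (\<beta>\<^sup>2 * \<bar>qform (A k) (y \<omega>) - qform (A k) (z \<omega>)\<bar> + 2 * \<bar>\<beta>\<bar> * (\<bar>P\<bar> + \<bar>R\<bar>))
        \<le> K * (\<beta>\<^sup>2 * e + \<beta> * ((s + P\<^sup>2 / s) + (s + R\<^sup>2 / s)))" using K by (rule mult_left_mono)
      also have "\<dots> = K * (\<beta>\<^sup>2 * e + 2 * \<beta> * s) + K * \<beta> / s * (P\<^sup>2 + R\<^sup>2)"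
        using s by (simp add: field_simps)
      also have "\<dots> \<le> h k \<omega>" unfolding h_def PR using z0 by simp
      finally show "K * (\<beta>\<^sup>2 * \<bar>qform (A k) (y \<omega>) - qform (A k) (z \<omega>)\<bar>
           + 2 * \<bar>\<beta>\<bar> * (\<bar>B k \<bullet> y \<omega>\<bar> + \<bar>B k \<bullet> z \<omega>\<bar>)) \<le> h k \<omega>" unfolding PR .
    qed
    finally show ?thesis .
  qed
  have hk: "has_bochner_integral M (h k) (2 / Im \<zeta> * prob (bad k) + K * (\<beta>\<^sup>2 * e + 2 * \<beta> * s)
     + K * \<beta> / s * ((\<integral>\<omega>. (B k \<bullet> y \<omega>)\<^sup>2 \<partial>M) + (\<integral>\<omega>. (B k \<bullet> z \<omega>)\<^sup>2 \<partial>M)))" for k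
    unfolding h_def[abs_def]
    using second_moment_integral(1)[OF y l B] second_moment_integral(1)[OF z l B] badm[of k]
    by (intro has_bochner_integral_add has_bochner_integral_mult_right)
      (auto simp: has_bochner_integral_iff prob_space emeasure_eq_measure)
  have Ik: "(\<integral>\<omega>. h k \<omega> \<partial>M) \<le> 2 / Im \<zeta> * \<eta> + K * (b\<^sup>2 * e + 2 * b * s) + 2 * K * b * l * C\<^sup>2 / s * (\<alpha> \<bullet> \<alpha>)" for k
  proof -
    have I2: "(\<integral>\<omega>. (B k \<bullet> X \<omega>)\<^sup>2 \<partial>M) \<le> l * (C\<^sup>2 * (\<alpha> \<bullet> \<alpha>))" if "second_moment_le M q X l t" for X
      using second_moment_integral(2)[OF that l B[of k]] mult_left_mono[OF BB[of k] l] by linarith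
    have "(\<integral>\<omega>. h k \<omega> \<partial>M) = 2 / Im \<zeta> * prob (bad k) + K * (\<beta>\<^sup>2 * e + 2 * \<beta> * s)
     + K * \<beta> / s * ((\<integral>\<omega>. (B k \<bullet> y \<omega>)\<^sup>2 \<partial>M) + (\<integral>\<omega>. (B k \<bullet> z \<omega>)\<^sup>2 \<partial>M))"
      by (rule has_bochner_integral_integral_eq[OF hk])
    also have "\<dots> \<le> 2 / Im \<zeta> * \<eta> + K * (b\<^sup>2 * e + 2 * b * s)
     + K * b / s * (l * (C\<^sup>2 * (\<alpha> \<bullet> \<alpha>)) + l * (C\<^sup>2 * (\<alpha> \<bullet> \<alpha>)))"
      using z0 K \<beta> e s l badp[of k] I2[OF y] I2[OF z] scalar_prod_self_nonneg[of \<alpha>]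
      by (intro add_mono mult_mono divide_right_mono mult_nonneg_nonneg divide_nonneg_nonneg power_mono add_nonneg_nonneg) auto
    finally show ?thesis by (simp add: field_simps)
  qed
  have "(\<integral>u. \<phi> u \<partial>distr M (vec_borel q) y) - (\<integral>u. \<phi> u \<partial>distr M (vec_borel q) z)
     = (\<integral>\<omega>. \<phi> (y \<omega>) - \<phi> (z \<omega>) \<partial>M)"
    using int[OF ym] int[OF zm] by (simp add: integral_distr[OF ym \<phi>m] integral_distr[OF zm \<phi>m])
  also have "cmod \<dots> \<le> (\<integral>\<omega>. cmod (\<phi> (y \<omega>) - \<phi> (z \<omega>)) \<partial>M)" by (rule integral_norm_bound)
  also have "\<dots> \<le> (\<integral>\<omega>. (\<Sum>k<4. h k \<omega>) \<partial>M)"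
    using hk int[OF ym] int[OF zm] pointwise
    by (intro integral_mono Bochner_Integration.integrable_sum) (auto simp: has_bochner_integral_iff)
  also have "\<dots> = (\<Sum>k<4. \<integral>\<omega>. h k \<omega> \<partial>M)"
    using hk by (intro Bochner_Integration.integral_sum) (auto simp: has_bochner_integral_iff)
  also have "\<dots> \<le> (\<Sum>k<(4::nat). 2 / Im \<zeta> * \<eta> + K * (b\<^sup>2 * e + 2 * b * s) + 2 * K * b * l * C\<^sup>2 / s * (\<alpha> \<bullet> \<alpha>))"
    by (intro sum_mono Ik)
  also have "\<dots> = 4 * (2 / Im \<zeta> * \<eta> + K * (b\<^sup>2 * e + 2 * b * s)) + 8 * K * b * l * C\<^sup>2 / s * (\<alpha> \<bullet> \<alpha>)"
    by simp
  finally show ?thesis unfolding \<phi>_def K_def C_def \<alpha>_def .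
qed

text \<open>\<open>column_swap\<close> is averaged over the remaining columns, distributed by any
  mixture of the two laws. Both laws satisfy E |u|^2 \<le> t, so the mean of |\<alpha>|^2 is bounded
  through the at most \<open>2 * m\<close> neighbouring columns occurring in it.\<close>

lemma expectation_swap:
  assumes M: "prob_space M" and z0: "0 < Im \<zeta>"
    and y: "second_moment_le M q y l t" and z: "second_moment_le M q z l t" and lt: "0 \<le> l" "0 \<le> t"
    and qf: "\<And>A. bounded_sym q (resolvent_const \<zeta>) A \<Longrightarrow>
      measure M {\<omega> \<in> space M. e < \<bar>qform A (y \<omega>) - qform A (z \<omega>)\<bar>} \<le> \<eta>"
    and e: "0 \<le> e" and s: "0 < s"
    and band: "\<And>l i. l < n \<Longrightarrow> i < n \<Longrightarrow> i + m \<le> l \<or> l < i \<Longrightarrow> g l i = 0"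
    and bound: "\<And>l i. l < n \<Longrightarrow> i < n \<Longrightarrow> (g l i)\<^sup>2 \<le> K" and K: "0 \<le> K"
    and b: "b = sqrt (real m * K)"
  shows "cmod ((\<integral>x. gram_trace q n g \<zeta> x \<partial>(\<Pi>\<^sub>M i\<in>{..<n}. distr M (vec_borel q) y))
        - (\<integral>x. gram_trace q n g \<zeta> x \<partial>(\<Pi>\<^sub>M i\<in>{..<n}. distr M (vec_borel q) z)))
     \<le> real n * (4 * (2 / Im \<zeta> * \<eta> + swap_const \<zeta> * (b\<^sup>2 * e + 2 * b * s))
       + 8 * swap_const \<zeta> * b * l * (resolvent_const \<zeta>)\<^sup>2 / s * (2 * real m * (real m * K) * (2 * real m * t)))"
proof -
  interpret prob_space M by fact
  let ?V = "vec_borel q" and ?f = "gram_trace q n g \<zeta>"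
  let ?\<mu> = "distr M ?V y" and ?\<nu> = "distr M ?V z"
  have ym: "y \<in> measurable M ?V" and zm: "z \<in> measurable M ?V"
    using y z by (auto simp: second_moment_le_def)
  have pr: "prob_space ?\<mu>" "prob_space ?\<nu>" using ym zm by (auto intro: prob_space_distr)
  define c0 where "c0 = 4 * (2 / Im \<zeta> * \<eta> + swap_const \<zeta> * (b\<^sup>2 * e + 2 * b * s))"
  define c1 where "c1 = 8 * swap_const \<zeta> * b * l * (resolvent_const \<zeta>)\<^sup>2 / s"
  define r where "r = 2 * real m * (real m * K)"
  have b0: "0 \<le> b" using K by (simp add: b)
  have sw: "0 \<le> swap_const \<zeta>" using z0 by (simp add: swap_const_def)
  have c1: "0 \<le> c1" unfolding c1_def using b0 sw lt s by simp
  have r: "0 \<le> r" using K by (simp add: r_def)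
  \<comment> \<open>The hypothesis \<open>qf\<close> at the zero matrix bounds a measure by
    \<eta>.\<close>
  have eta: "0 \<le> \<eta>"
  proof -
    from qf[OF bounded_sym_zero] show ?thesis by (rule order_trans[OF measure_nonneg])
  qed
  have c0: "0 \<le> c0" unfolding c0_def using z0 eta sw b0 e s by simp
  show ?thesis
    unfolding c0_def[symmetric] c1_def[symmetric] r_def[symmetric]
  proof (rule product_swap[OF pr(1) _ pr(2) _ gram_trace_measurable[OF z0] gram_trace_bound[OF z0]])
    fix j and \<kappa> :: "nat \<Rightarrow> real vec measure"
    assume j: "j < n" and \<kappa>: "\<And>i. \<kappa> i = ?\<mu> \<or> \<kappa> i = ?\<nu>"
    let ?J = "{..<n} - {j}"
    let ?P = "PiM ?J \<kappa>"
    have kp: "prob_space (\<kappa> i)" and ks: "sets (\<kappa> i) = sets ?V" for i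
      using \<kappa>[of i] pr by auto
    interpret P: prob_space ?P by (rule prob_space_PiM[OF kp])
    have spP: "space ?P = space (\<Pi>\<^sub>M i\<in>?J. ?V)"
      by (rule sets_eq_imp_space_eq) (intro sets_PiM_cong ks refl)
    define T where "T = {i\<in>?J. j < i + m \<and> i < j + m}"
    have T: "T \<subseteq> ?J" "finite T" by (auto simp: T_def)
    have cT: "real (card T) \<le> 2 * real m" using card_band_le[of n j m] unfolding T_def by linarith
    have comp: "has_bochner_integral ?P (\<lambda>x. x i \<bullet> x i) (\<integral>u. u \<bullet> u \<partial>\<kappa> i)"
      "(\<integral>u. u \<bullet> u \<partial>\<kappa> i) \<le> t" if i: "i \<in> ?J" for i
    proof -
      have u: "integrable (\<kappa> i) (\<lambda>u. u \<bullet> u)" "(\<integral>u. u \<bullet> u \<partial>\<kappa> i) \<le> t"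
        using \<kappa>[of i] second_moment_norm_integral[OF y lt(2)] second_moment_norm_integral[OF z lt(2)] by auto
      have d: "distr ?P (\<kappa> i) (\<lambda>x. x i) = \<kappa> i" by (rule distr_PiM_component[OF kp i])
      have m: "(\<lambda>x. x i) \<in> measurable ?P (\<kappa> i)" using i by (rule measurable_component_singleton)
      have "integrable ?P (\<lambda>x. x i \<bullet> x i)"
        by (rule integrable_distr[OF m]) (simp only: d u)
      moreover have "(\<integral>x. x i \<bullet> x i \<partial>?P) = (\<integral>u. u \<bullet> u \<partial>\<kappa> i)"
        using integral_distr[OF m borel_measurable_integrable[OF u(1)]] unfolding d by simp
      ultimately show "has_bochner_integral ?P (\<lambda>x. x i \<bullet> x i) (\<integral>u. u \<bullet> u \<partial>\<kappa> i)"
        by (simp add: has_bochner_integral_iff)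
      show "(\<integral>u. u \<bullet> u \<partial>\<kappa> i) \<le> t" by fact
    qed
    have hb: "has_bochner_integral ?P (\<lambda>x. c0 + c1 * (r * (\<Sum>i\<in>T. x i \<bullet> x i)))
        (c0 + c1 * (r * (\<Sum>i\<in>T. \<integral>u. u \<bullet> u \<partial>\<kappa> i)))"
      using T by (intro has_bochner_integral_add has_bochner_integral_mult_right has_bochner_integral_sum comp)
        (auto simp: has_bochner_integral_iff P.prob_space P.emeasure_eq_measure)
    let ?G = "\<lambda>x. (\<integral>u. ?f (x(j := u)) \<partial>?\<mu>) - (\<integral>u. ?f (x(j := u)) \<partial>?\<nu>)"
    have "cmod (\<integral>x. ?G x \<partial>?P) \<le> (\<integral>x. cmod (?G x) \<partial>?P)" by (rule integral_norm_bound)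
    \<comment> \<open>\<open>integral_mono'\<close> asks for integrability of the dominating
      function only.\<close>
    also have "\<dots> \<le> (\<integral>x. c0 + c1 * (r * (\<Sum>i\<in>T. x i \<bullet> x i)) \<partial>?P)"
    proof (rule integral_mono')
      show "integrable ?P (\<lambda>x. c0 + c1 * (r * (\<Sum>i\<in>T. x i \<bullet> x i)))"
        using hb by (simp add: has_bochner_integral_iff)
      fix x assume x: "x \<in> space ?P"
      show "0 \<le> c0 + c1 * (r * (\<Sum>i\<in>T. x i \<bullet> x i))"
        using c0 c1 r by (intro add_nonneg_nonneg mult_nonneg_nonneg sum_nonneg scalar_prod_self_nonneg)
      have x': "x \<in> space (\<Pi>\<^sub>M i\<in>?J. ?V)" using x spP by simp
      have xc: "x i \<in> carrier_vec q" if "i < n" "i \<noteq> j" for i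
        using x' that by (auto simp: space_PiM)
      have "cmod (?G x) \<le> c0 + c1 * (residual q n g j x \<bullet> residual q n g j x)"
        unfolding c0_def c1_def
        by (rule column_swap[OF M z0 y z lt(1) qf e s j _ x'])
          (use loading_le[OF band bound K j] in \<open>simp_all add: b\<close>)
      also have "\<dots> \<le> c0 + c1 * (r * (\<Sum>i\<in>T. x i \<bullet> x i))"
        unfolding r_def T_def using c1
        by (intro add_left_mono mult_left_mono residual_bound[OF band bound K j xc]) auto
      finally show "cmod (?G x) \<le> c0 + c1 * (r * (\<Sum>i\<in>T. x i \<bullet> x i))" .
    qed
    also have "\<dots> = c0 + c1 * (r * (\<Sum>i\<in>T. \<integral>u. u \<bullet> u \<partial>\<kappa> i))"
      by (rule has_bochner_integral_integral_eq[OF hb])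
    also have "\<dots> \<le> c0 + c1 * (r * (2 * real m * t))"
    proof (intro add_left_mono mult_left_mono c1 r)
      have "(\<Sum>i\<in>T. \<integral>u. u \<bullet> u \<partial>\<kappa> i) \<le> (\<Sum>i\<in>T. t)" using comp(2) T by (intro sum_mono) auto
      also have "\<dots> \<le> 2 * real m * t" using cT lt by (simp add: mult_right_mono)
      finally show "(\<Sum>i\<in>T. \<integral>u. u \<bullet> u \<partial>\<kappa> i) \<le> 2 * real m * t" .
    qed
    finally show "cmod (\<integral>x. ?G x \<partial>?P) \<le> c0 + c1 * (r * (2 * real m * t))" .
  qed simp_all
qed

section \<open>Concentration of the trace around its mean\<close>

text \<open>Carries statements about a random matrix on \<open>N\<close> over to the product of the
  column laws, where both concentration and exchange take place.\<close>

lemma iid_columns_distr: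
  assumes N: "prob_space N" and n: "1 \<le> n" and X: "iid_columns q n N X M x"
  shows "(\<lambda>\<omega>. \<lambda>j\<in>{..<n}. col (X \<omega>) j) \<in> measurable N (\<Pi>\<^sub>M j\<in>{..<n}. vec_borel q)"
    "distr N (\<Pi>\<^sub>M j\<in>{..<n}. vec_borel q) (\<lambda>\<omega>. \<lambda>j\<in>{..<n}. col (X \<omega>) j)
       = (\<Pi>\<^sub>M j\<in>{..<n}. distr M (vec_borel q) x)"
proof -
  interpret prob_space N by fact
  have ind: "indep_vars (\<lambda>_. vec_borel q) (\<lambda>j \<omega>. col (X \<omega>) j) {..<n}"
    and d: "\<And>j. j < n \<Longrightarrow> distr N (vec_borel q) (\<lambda>\<omega>. col (X \<omega>) j) = distr M (vec_borel q) x"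
    using X by (auto simp: iid_columns_def)
  have rv: "(\<lambda>\<omega>. col (X \<omega>) j) \<in> measurable N (vec_borel q)" if "j \<in> {..<n}" for j
    using ind that by (auto simp: indep_vars_def)
  show "(\<lambda>\<omega>. \<lambda>j\<in>{..<n}. col (X \<omega>) j) \<in> measurable N (\<Pi>\<^sub>M j\<in>{..<n}. vec_borel q)"
    by (rule measurable_restrict) (rule rv)
  have "distr N (\<Pi>\<^sub>M j\<in>{..<n}. vec_borel q) (\<lambda>\<omega>. \<lambda>j\<in>{..<n}. col (X \<omega>) j)
      = (\<Pi>\<^sub>M j\<in>{..<n}. distr N (vec_borel q) (\<lambda>\<omega>. col (X \<omega>) j))"
    using indep_vars_iff_distr_eq_PiM'[of "{..<n}" "\<lambda>j \<omega>. col (X \<omega>) j" "\<lambda>_. vec_borel q"] ind rv n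
    by (simp add: lessThan_empty_iff)
  also have "\<dots> = (\<Pi>\<^sub>M j\<in>{..<n}. distr M (vec_borel q) x)"
    by (intro PiM_cong refl) (simp add: d)
  finally show "distr N (\<Pi>\<^sub>M j\<in>{..<n}. vec_borel q) (\<lambda>\<omega>. \<lambda>j\<in>{..<n}. col (X \<omega>) j)
       = (\<Pi>\<^sub>M j\<in>{..<n}. distr M (vec_borel q) x)" .
qed

text \<open>Real and imaginary parts are treated separately with threshold \<tau> / 2, and one
  column changes the trace by at most 2 / Im \<zeta>. The exponent is (\<tau> q / 2)^2 / (2 n (2 /
  Im \<zeta>)^2), whence the 32; the 4 counts two parts with two sides each.\<close>

lemma gram_trace_tail:
  fixes g :: "nat \<Rightarrow> nat \<Rightarrow> real"
  assumes N: "prob_space N" and n: "1 \<le> n" and q: "1 \<le> q" and X: "iid_columns q n N X M x"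
    and M: "prob_space M" and x: "x \<in> measurable M (vec_borel q)" and z0: "0 < Im \<zeta>" and \<tau>: "0 < \<tau>"
  defines "F \<equiv> \<lambda>\<omega>. gram_trace q n g \<zeta> (\<lambda>j\<in>{..<n}. col (X \<omega>) j) / of_nat q
      - (\<integral>x. gram_trace q n g \<zeta> x \<partial>(\<Pi>\<^sub>M j\<in>{..<n}. distr M (vec_borel q) x)) / of_nat q"
  shows "F \<in> borel_measurable N"
    "measure N {\<omega> \<in> space N. \<tau> \<le> cmod (F \<omega>)} \<le> 4 * exp (- ((\<tau> * Im \<zeta> * real q)\<^sup>2 / (32 * real n)))"
proof -
  interpret prob_space N by fact
  let ?V = "vec_borel q"
  let ?P = "\<Pi>\<^sub>M j\<in>{..<n}. distr M ?V x" and ?S = "\<Pi>\<^sub>M j\<in>{..<n}. ?V"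
  let ?f = "gram_trace q n g \<zeta>"
  define cols where "cols \<omega> = (\<lambda>j\<in>{..<n}. col (X \<omega>) j)" for \<omega>
  have cm: "cols \<in> measurable N ?S" and cd: "distr N ?S cols = ?P"
    using iid_columns_distr[OF N n X] unfolding cols_def[abs_def] by auto
  have fm: "?f \<in> borel_measurable ?S" by (rule gram_trace_measurable[OF z0])
  show Fm: "F \<in> borel_measurable N"
    unfolding F_def cols_def[symmetric] using measurable_compose[OF cm fm] by simp
  have px: "prob_space (distr M ?V x)" using prob_space.prob_space_distr[OF M x] .
  interpret P: prob_space ?P by (rule prob_space_PiM[OF px])
  have setsP: "sets ?P = sets ?S" by (intro sets_PiM_cong) auto
  have spP: "space ?P = space ?S" by (rule sets_eq_imp_space_eq[OF setsP])
  have fmP: "?f \<in> borel_measurable ?P" using fm by (simp add: measurable_cong_sets[OF setsP refl])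
  have fint: "integrable ?P ?f"
    by (rule P.integrable_const_bound[OF AE_I2 fmP]) (rule gram_trace_bound[OF z0])
  define E where "E = (\<integral>x. ?f x \<partial>?P)"
  have part: "prob {\<omega> \<in> space N. \<tau> / 2 \<le> \<bar>h (F \<omega>)\<bar>} \<le> 2 * exp (- ((\<tau> * Im \<zeta> * real q)\<^sup>2 / (32 * real n)))"
    if h: "h = Re \<or> h = Im" for h
  proof -
    have hd: "h (a - b) = h a - h b" "h (a / of_nat q) = h a / real q" "\<bar>h a\<bar> \<le> cmod a" for a b
      using h abs_Re_le_cmod abs_Im_le_cmod by auto
    have hm: "(\<lambda>x. h (?f x)) \<in> borel_measurable ?S" using h fm by auto
    have hE: "h E = (\<integral>x. h (?f x) \<partial>?P)" unfolding E_def using h fint by auto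
    have "prob {\<omega> \<in> space N. \<tau> / 2 \<le> \<bar>h (F \<omega>)\<bar>} = measure ?P {x \<in> space ?P. \<tau> / 2 * real q \<le> \<bar>h (?f x) - h E\<bar>}"
    proof -
      have "{x \<in> space ?S. \<tau> / 2 * real q \<le> \<bar>h (?f x) - h E\<bar>} \<in> sets ?S" using hm by measurable
      then have "measure (distr N ?S cols) {x \<in> space ?S. \<tau> / 2 * real q \<le> \<bar>h (?f x) - h E\<bar>}
         = prob (cols -` {x \<in> space ?S. \<tau> / 2 * real q \<le> \<bar>h (?f x) - h E\<bar>} \<inter> space N)"
        by (rule measure_distr[OF cm])
      moreover have "cols -` {x \<in> space ?S. \<tau> / 2 * real q \<le> \<bar>h (?f x) - h E\<bar>} \<inter> space N
         = {\<omega> \<in> space N. \<tau> / 2 \<le> \<bar>h (F \<omega>)\<bar>}"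
      proof -
        have "\<bar>h (F \<omega>)\<bar> = \<bar>h (?f (cols \<omega>)) - h E\<bar> / real q" for \<omega>
          unfolding F_def cols_def[symmetric] E_def[symmetric] hd diff_divide_distrib[symmetric]
          by (simp add: abs_divide)
        moreover have q0: "0 < real q" using q by simp
        ultimately have "(\<tau> / 2 * real q \<le> \<bar>h (?f (cols \<omega>)) - h E\<bar>) = (\<tau> / 2 \<le> \<bar>h (F \<omega>)\<bar>)" for \<omega>
          by (simp only: pos_le_divide_eq[OF q0])
        then show ?thesis using measurable_space[OF cm] by auto
      qed
      ultimately show ?thesis unfolding cd spP by simp
    qed
    also have "\<dots> \<le> 2 * exp (- ((\<tau> / 2 * real q)\<^sup>2 / (2 * real (card {..<n}) * (2 / Im \<zeta>)\<^sup>2)))"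
      unfolding hE
    proof (rule bounded_differences_tail[of "{..<n}" "\<lambda>_. distr M ?V x" "\<lambda>x. h (?f x)" "real q / Im \<zeta>"])
      show "{..<n} \<noteq> {}" using n by (simp add: lessThan_empty_iff)
      show "(\<lambda>x. h (?f x)) \<in> borel_measurable ?P" using hm by (simp add: measurable_cong_sets[OF setsP refl])
      show "\<bar>h (?f x)\<bar> \<le> real q / Im \<zeta>" for x using hd(3) gram_trace_bound[OF z0] by (rule order_trans)
      fix i x' u assume i: "i \<in> {..<n}" and x': "x' \<in> space ?P" and u: "u \<in> space (distr M ?V x)"
      have "x' i \<in> carrier_vec q" "u \<in> carrier_vec q" using x' i u unfolding spP by (auto simp: space_PiM)
      then have "cmod (?f (x'(i := u)) - ?f (x'(i := x' i))) \<le> 2 / Im \<zeta>"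
        using gram_trace_rank_one[OF _ z0, of i n q g x'] i by (metis lessThan_iff)
      then show "\<bar>h (?f (x'(i := u))) - h (?f x')\<bar> \<le> 2 / Im \<zeta>"
        using hd(3)[of "?f (x'(i := u)) - ?f x'"] hd(1) by simp
    qed (use px z0 \<tau> q in auto)
    also have "(\<tau> / 2 * real q)\<^sup>2 / (2 * real (card {..<n}) * (2 / Im \<zeta>)\<^sup>2) = (\<tau> * Im \<zeta> * real q)\<^sup>2 / (32 * real n)"
      using n z0 by (simp add: field_simps power2_eq_square)
    finally show ?thesis .
  qed
  have m: "{\<omega> \<in> space N. \<tau> / 2 \<le> \<bar>Re (F \<omega>)\<bar>} \<in> events" "{\<omega> \<in> space N. \<tau> / 2 \<le> \<bar>Im (F \<omega>)\<bar>} \<in> events"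
    using Fm by measurable
  have "prob {\<omega> \<in> space N. \<tau> \<le> cmod (F \<omega>)}
    \<le> prob ({\<omega> \<in> space N. \<tau> / 2 \<le> \<bar>Re (F \<omega>)\<bar>} \<union> {\<omega> \<in> space N. \<tau> / 2 \<le> \<bar>Im (F \<omega>)\<bar>})"
  proof (rule finite_measure_mono)
    show "{\<omega> \<in> space N. \<tau> \<le> cmod (F \<omega>)}
       \<subseteq> {\<omega> \<in> space N. \<tau> / 2 \<le> \<bar>Re (F \<omega>)\<bar>} \<union> {\<omega> \<in> space N. \<tau> / 2 \<le> \<bar>Im (F \<omega>)\<bar>}"
    proof
      fix \<omega> assume "\<omega> \<in> {\<omega> \<in> space N. \<tau> \<le> cmod (F \<omega>)}"
      moreover from this have "\<tau> / 2 \<le> \<bar>Re (F \<omega>)\<bar> \<or> \<tau> / 2 \<le> \<bar>Im (F \<omega>)\<bar>" using cmod_le[of "F \<omega>"] by auto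
      ultimately show "\<omega> \<in> {\<omega> \<in> space N. \<tau> / 2 \<le> \<bar>Re (F \<omega>)\<bar>} \<union> {\<omega> \<in> space N. \<tau> / 2 \<le> \<bar>Im (F \<omega>)\<bar>}" by auto
    qed
  qed (use m in auto)
  also have "\<dots> \<le> prob {\<omega> \<in> space N. \<tau> / 2 \<le> \<bar>Re (F \<omega>)\<bar>} + prob {\<omega> \<in> space N. \<tau> / 2 \<le> \<bar>Im (F \<omega>)\<bar>}"
    by (rule measure_Un_le[OF m])
  also have "\<dots> \<le> 4 * exp (- ((\<tau> * Im \<zeta> * real q)\<^sup>2 / (32 * real n)))"
    using part[of Re] part[of Im] by simp
  finally show "prob {\<omega> \<in> space N. \<tau> \<le> cmod (F \<omega>)} \<le> 4 * exp (- ((\<tau> * Im \<zeta> * real q)\<^sup>2 / (32 * real n)))" .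
qed

text \<open>Borel-Cantelli for the thresholds 1 / (k + 1), a countable family that reaches below
  every positive bound.\<close>

lemma AE_tendsto_0_of_summable_tails:
  fixes X :: "nat \<Rightarrow> 'b \<Rightarrow> complex"
  assumes N: "prob_space N" and X: "\<And>n. X n \<in> borel_measurable N"
    and s: "\<And>\<tau>. 0 < \<tau> \<Longrightarrow> summable (\<lambda>n. measure N {\<omega> \<in> space N. \<tau> \<le> cmod (X n \<omega>)})"
  shows "AE \<omega> in N. (\<lambda>n. X n \<omega>) \<longlonglongrightarrow> 0"
proof -
  interpret prob_space N by fact
  have "AE \<omega> in N. \<forall>k. eventually (\<lambda>n. \<omega> \<in> space N - {\<omega> \<in> space N. inverse (real (Suc k)) \<le> cmod (X n \<omega>)}) sequentially"
    unfolding AE_all_countable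
  proof
    fix k show "AE \<omega> in N. eventually (\<lambda>n. \<omega> \<in> space N - {\<omega> \<in> space N. inverse (real (Suc k)) \<le> cmod (X n \<omega>)}) sequentially"
      using X s[of "inverse (real (Suc k))"]
      by (intro borel_cantelli_AE1) (auto simp: emeasure_eq_measure)
  qed
  then show ?thesis
  proof eventually_elim
    case (elim \<omega>)
    show ?case
    proof (rule tendstoI)
      fix e :: real assume "0 < e"
      then obtain k where k: "inverse (real (Suc k)) < e" using reals_Archimedean by blast
      from elim have "eventually (\<lambda>n. \<omega> \<in> space N - {\<omega> \<in> space N. inverse (real (Suc k)) \<le> cmod (X n \<omega>)}) sequentially" by blast
      then show "eventually (\<lambda>n. dist (X n \<omega>) 0 < e) sequentially"
        by eventually_elim (use k in \<open>auto simp: not_le\<close>)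
    qed
  qed
qed

text \<open>The factor 1 / n enters the coefficients as 1 / sqrt n, so that bounded entries of
  \<open>L\<close> give squared loadings of order at most 1 / n.\<close>

lemma product_gram:
  assumes Y: "Y \<in> carrier_mat q n" and L: "L \<in> carrier_mat n n" and n: "1 \<le> n"
  shows "(1 / real n) \<cdot>\<^sub>m (Y * L\<^sup>T * L * Y\<^sup>T)
    = gram q n (\<lambda>k i. L $$ (k, i) / sqrt (real n)) (\<lambda>j\<in>{..<n}. col Y j)"
proof (rule eq_matI)
  let ?g = "\<lambda>k i. L $$ (k, i) / sqrt (real n)"
  let ?G = "gram q n ?g (\<lambda>j\<in>{..<n}. col Y j)"
  fix a c assume "a < dim_row ?G" "c < dim_col ?G"
  then have ac: "a < q" "c < q" by (auto simp: gram_def)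
  have YL: "Y * L\<^sup>T \<in> carrier_mat q n" and LY: "L * Y\<^sup>T \<in> carrier_mat n q" using Y L by auto
  have assoc: "Y * L\<^sup>T * L * Y\<^sup>T = (Y * L\<^sup>T) * (L * Y\<^sup>T)" using YL L Y by (intro assoc_mult_mat) auto
  have 1: "(Y * L\<^sup>T) $$ (b, k) = (\<Sum>i<n. L $$ (k, i) * Y $$ (b, i))" if "b < q" "k < n" for b k
    using mult_mat_sum[of Y q n "L\<^sup>T" n b k] Y L that by (simp add: mult.commute)
  have 2: "(L * Y\<^sup>T) $$ (k, b) = (\<Sum>i<n. L $$ (k, i) * Y $$ (b, i))" if "b < q" "k < n" for b k
    using mult_mat_sum[of L n n "Y\<^sup>T" q k b] Y L that by simp
  have row: "(\<Sum>i<n. ?g k i * (\<lambda>j\<in>{..<n}. col Y j) i $ b) = (\<Sum>i<n. L $$ (k, i) * Y $$ (b, i)) / sqrt (real n)"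
    if "b < q" for k b
    unfolding sum_divide_distrib using Y that by (intro sum.cong refl) simp
  have "((1 / real n) \<cdot>\<^sub>m (Y * L\<^sup>T * L * Y\<^sup>T)) $$ (a, c) = (1 / real n) * ((Y * L\<^sup>T) * (L * Y\<^sup>T)) $$ (a, c)"
    using Y L ac unfolding assoc by simp
  also have "((Y * L\<^sup>T) * (L * Y\<^sup>T)) $$ (a, c) = (\<Sum>k<n. (Y * L\<^sup>T) $$ (a, k) * (L * Y\<^sup>T) $$ (k, c))"
    by (rule mult_mat_sum[OF YL LY ac])
  also have "\<dots> = (\<Sum>k<n. (\<Sum>i<n. L $$ (k, i) * Y $$ (a, i)) * (\<Sum>i<n. L $$ (k, i) * Y $$ (c, i)))"
    using ac by (intro sum.cong refl) (simp add: 1 2 del: index_mult_mat)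
  also have "(1 / real n) * \<dots> = ?G $$ (a, c)"
    unfolding gram_def index_mat(1)[OF ac] prod.case row[OF ac(1)] row[OF ac(2)]
    using n by (subst sum_distrib_left, intro sum.cong refl) simp
  finally show "((1 / real n) \<cdot>\<^sub>m (Y * L\<^sup>T * L * Y\<^sup>T)) $$ (a, c) = ?G $$ (a, c)" .
qed (use Y in \<open>auto simp: gram_def\<close>)

lemma mat_trace_expectation_nonneg:
  assumes "\<And>\<omega> i. \<omega> \<in> space M \<Longrightarrow> i < q \<Longrightarrow> 0 \<le> X \<omega> $$ (i, i)"
  shows "0 \<le> mat_trace (mat_expectation q M X)"
  unfolding mat_trace_def mat_expectation_def
  using assms by (auto intro!: sum_nonneg integral_nonneg_AE AE_I2)

lemma second_moment_le_mono:
  assumes "second_moment_le M q X l t" "l \<le> l'" "t \<le> t'"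
  shows "second_moment_le M q X l' t'"
  unfolding second_moment_le_def
proof (intro conjI ballI)
  fix a :: "real vec" assume a: "a \<in> carrier_vec q"
  have "(\<integral>\<^sup>+\<omega>. ennreal ((a \<bullet> X \<omega>)\<^sup>2) \<partial>M) \<le> ennreal (l * (a \<bullet> a))"
    using assms a by (simp add: second_moment_le_def)
  also have "\<dots> \<le> ennreal (l' * (a \<bullet> a))"
    using assms(2) scalar_prod_self_nonneg by (intro ennreal_leI mult_right_mono)
  finally show "(\<integral>\<^sup>+\<omega>. ennreal ((a \<bullet> X \<omega>)\<^sup>2) \<partial>M) \<le> ennreal (l' * (a \<bullet> a))" .
next
  show "X \<in> measurable M (vec_borel q)" using assms by (simp add: second_moment_le_def)
  have "(\<integral>\<^sup>+\<omega>. ennreal (X \<omega> \<bullet> X \<omega>) \<partial>M) \<le> ennreal t" using assms by (simp add: second_moment_le_def)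
  also have "\<dots> \<le> ennreal t'" using assms(3) by (rule ennreal_leI)
  finally show "(\<integral>\<^sup>+\<omega>. ennreal (X \<omega> \<bullet> X \<omega>) \<partial>M) \<le> ennreal t'" .
qed

section \<open>Convergence\<close>

text \<open>Serves to choose parameters: the value \<rho> / (a + 1) keeps a term with coefficient
  \<open>a\<close> below \<rho>, also when a = 0.\<close>

lemma mult_div_Suc_le:
  fixes a \<rho> :: real
  assumes "0 \<le> a" "0 \<le> \<rho>"
  shows "a * (\<rho> / (a + 1)) \<le> \<rho>"
proof -
  have "a / (a + 1) \<le> 1" using assms by simp
  then have "\<rho> * (a / (a + 1)) \<le> \<rho> * 1" using assms by (intro mult_left_mono)
  then show ?thesis by (simp add: mult.commute)
qed

text \<open>Eventually p \<ge> c n / 2, so the exponent in the tail bound is at least a positive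
  constant times n. The tails are dominated by a geometric series for every \<tau>, and
  Borel-Cantelli applies.\<close>

lemma gram_trace_AE_converges:
  fixes p :: "nat \<Rightarrow> nat" and g :: "nat \<Rightarrow> nat \<Rightarrow> nat \<Rightarrow> real"
  assumes N: "prob_space N" and M: "\<And>q. 1 \<le> q \<Longrightarrow> prob_space (M q)"
    and x: "\<And>q. 1 \<le> q \<Longrightarrow> x q \<in> measurable (M q) (vec_borel q)"
    and X: "\<And>n. 1 \<le> n \<Longrightarrow> iid_columns (p n) n N (X n) (M (p n)) (x (p n))"
    and p_pos: "\<And>n. 1 \<le> n \<Longrightarrow> 1 \<le> p n"
    and p_lim: "(\<lambda>n. real (p n) / real n) \<longlonglongrightarrow> c" and c: "0 < c" and z0: "0 < Im \<zeta>"
  shows "AE \<omega> in N. (\<lambda>n. gram_trace (p n) n (g n) \<zeta> (\<lambda>j\<in>{..<n}. col (X n \<omega>) j) / of_nat (p n)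
      - (\<integral>x. gram_trace (p n) n (g n) \<zeta> x \<partial>(\<Pi>\<^sub>M j\<in>{..<n}. distr (M (p n)) (vec_borel (p n)) (x (p n)))) / of_nat (p n))
    \<longlonglongrightarrow> 0"
proof -
  define F where "F n \<omega> = gram_trace (p n) n (g n) \<zeta> (\<lambda>j\<in>{..<n}. col (X n \<omega>) j) / of_nat (p n)
      - (\<integral>x. gram_trace (p n) n (g n) \<zeta> x \<partial>(\<Pi>\<^sub>M j\<in>{..<n}. distr (M (p n)) (vec_borel (p n)) (x (p n)))) / of_nat (p n)" for n \<omega>
  \<comment> \<open>The hypotheses start at n = 1; the term n = 0 is set to 0 so that all terms are
    measurable.\<close>
  define F' where "F' n \<omega> = (if n = 0 then 0 else F n \<omega>)" for n \<omega>
  have tail: "F n \<in> borel_measurable N"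
    "measure N {\<omega> \<in> space N. \<tau> \<le> cmod (F n \<omega>)} \<le> 4 * exp (- ((\<tau> * Im \<zeta> * real (p n))\<^sup>2 / (32 * real n)))"
    if "1 \<le> n" "0 < \<tau>" for n \<tau>
    unfolding F_def by (rule gram_trace_tail[OF N that(1) p_pos X M x z0 that(2)]; use that p_pos in simp)+
  have F'm: "F' n \<in> borel_measurable N" for n
    using tail(1)[of n 1] by (cases "n = 0") (auto simp: F'_def[abs_def])
  have sm: "summable (\<lambda>n. measure N {\<omega> \<in> space N. \<tau> \<le> cmod (F' n \<omega>)})" if \<tau>: "0 < \<tau>" for \<tau>
  proof -
    define \<kappa> where "\<kappa> = (\<tau> * Im \<zeta> * (c / 2))\<^sup>2 / 32"
    have \<kappa>: "0 < \<kappa>" using \<tau> z0 c by (simp add: \<kappa>_def)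
    have "summable (\<lambda>n. 4 * exp (- \<kappa>) ^ n)" using \<kappa> by (intro summable_mult summable_geometric) simp
    moreover have "eventually (\<lambda>n. c / 2 < real (p n) / real n) sequentially"
      using order_tendstoD(1)[OF p_lim, of "c / 2"] c by simp
    with eventually_ge_at_top[of 1]
    have "eventually (\<lambda>n. norm (measure N {\<omega> \<in> space N. \<tau> \<le> cmod (F' n \<omega>)}) \<le> 4 * exp (- \<kappa>) ^ n) sequentially"
    proof eventually_elim
      case (elim n)
      have n0: "0 < real n" using elim(1) by simp
      have pn: "c / 2 * real n \<le> real (p n)" using elim(2) n0 by (simp add: field_simps)
      have "\<tau> * Im \<zeta> * (c / 2 * real n) \<le> \<tau> * Im \<zeta> * real (p n)"
        using \<tau> z0 pn by (intro mult_left_mono) auto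
      then have "(\<tau> * Im \<zeta> * (c / 2 * real n))\<^sup>2 \<le> (\<tau> * Im \<zeta> * real (p n))\<^sup>2"
        using \<tau> z0 c n0 by (intro power_mono) auto
      then have "(\<tau> * Im \<zeta> * (c / 2 * real n))\<^sup>2 / (32 * real n) \<le> (\<tau> * Im \<zeta> * real (p n))\<^sup>2 / (32 * real n)"
        using n0 by (intro divide_right_mono) auto
      moreover have "(\<tau> * Im \<zeta> * (c / 2 * real n))\<^sup>2 / (32 * real n) = \<kappa> * real n"
        using n0 by (simp add: \<kappa>_def power2_eq_square)
      ultimately have ex: "\<kappa> * real n \<le> (\<tau> * Im \<zeta> * real (p n))\<^sup>2 / (32 * real n)" by simp
      have "measure N {\<omega> \<in> space N. \<tau> \<le> cmod (F' n \<omega>)} = measure N {\<omega> \<in> space N. \<tau> \<le> cmod (F n \<omega>)}"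
        using elim(1) by (simp add: F'_def)
      also have "\<dots> \<le> 4 * exp (- ((\<tau> * Im \<zeta> * real (p n))\<^sup>2 / (32 * real n)))"
        by (rule tail(2)) (use elim(1) \<tau> in auto)
      also have "\<dots> \<le> 4 * exp (- (\<kappa> * real n))" using ex by simp
      also have "exp (- (\<kappa> * real n)) = exp (- \<kappa>) ^ n" by (simp add: exp_of_nat2_mult[symmetric])
      finally show ?case by simp
    qed
    ultimately show ?thesis by (rule summable_comparison_test_ev[rotated])
  qed
  have "AE \<omega> in N. (\<lambda>n. F' n \<omega>) \<longlonglongrightarrow> 0" by (rule AE_tendsto_0_of_summable_tails[OF N F'm sm])
  then have "AE \<omega> in N. (\<lambda>n. F n \<omega>) \<longlonglongrightarrow> 0"
  proof eventually_elim
    case (elim \<omega>)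
    have "eventually (\<lambda>n. F' n \<omega> = F n \<omega>) sequentially"
      using eventually_ge_at_top[of 1] by eventually_elim (simp add: F'_def)
    then show ?case by (rule Lim_transform_eventually[OF elim])
  qed
  then show ?thesis unfolding F_def .
qed

theorem theorem3p3:
  fixes M :: "nat \<Rightarrow> 'a measure"
    and y w z :: "nat \<Rightarrow> 'a \<Rightarrow> real vec"
    and \<Sigma> :: "nat \<Rightarrow> 'a \<Rightarrow> real mat"
    and N :: "'b measure"
    and Y Z :: "nat \<Rightarrow> 'b \<Rightarrow> real mat"
    and L :: "nat \<Rightarrow> real mat"
    and m :: nat
    and p :: "nat \<Rightarrow> nat"
    and c :: real
  assumes prob_M: "\<And>q. 1 \<le> q \<Longrightarrow> prob_space (M q)"
    and y: "\<And>q. 1 \<le> q \<Longrightarrow> y q \<in> measurable (M q) (vec_borel q)"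
    and Sigma: "\<And>q. 1 \<le> q \<Longrightarrow> \<Sigma> q \<in> measurable (M q) (mat_borel q q)"
    and Sigma_psd: "\<And>q \<omega>. 1 \<le> q \<Longrightarrow> \<omega> \<in> space (M q) \<Longrightarrow> sym_psd_mat q (\<Sigma> q \<omega>)"
    and y_int: "\<And>q. 1 \<le> q \<Longrightarrow> integrable_mat q (M q) (\<lambda>\<omega>. outer_prod (y q \<omega>))"
    and Sigma_int: "\<And>q. 1 \<le> q \<Longrightarrow> integrable_mat q (M q) (\<Sigma> q)"
    and w: "\<And>q. 1 \<le> q \<Longrightarrow> std_normal_vec q (M q) (w q)"
    and w_indep: "\<And>q. 1 \<le> q \<Longrightarrow>
          indep_rv (M q) (vec_borel q) (w q) (mat_borel q q) (\<Sigma> q)"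
    and z: "\<And>q \<omega>. 1 \<le> q \<Longrightarrow> \<omega> \<in> space (M q) \<Longrightarrow> z q \<omega> = psd_sqrt (\<Sigma> q \<omega>) *\<^sub>v w q \<omega>"
    and A1: "\<And>A :: nat \<Rightarrow> real mat.
          (\<forall>q\<ge>1. sym_psd_mat q (A q)) \<Longrightarrow> (\<exists>C. \<forall>q\<ge>1. spectral_norm (A q) \<le> C) \<Longrightarrow>
          tendsto_0_in_prob M
            (\<lambda>q \<omega>. (y q \<omega> \<bullet> (A q *\<^sub>v y q \<omega>) - mat_trace (\<Sigma> q \<omega> * A q)) / real q)"
    and A2: "tendsto_0_in_prob M (\<lambda>q \<omega>. mat_trace (\<Sigma> q \<omega> * \<Sigma> q \<omega>) / (real q)\<^sup>2)"
    and A6: "(\<lambda>q. (spectral_norm (mat_expectation q (M q) (\<lambda>\<omega>. outer_prod (y q \<omega>)))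
                    + spectral_norm (mat_expectation q (M q) (\<Sigma> q)))
                  * mat_trace (mat_expectation q (M q) (\<lambda>\<omega>. outer_prod (y q \<omega>))
                               + mat_expectation q (M q) (\<Sigma> q)))
             \<in> o(\<lambda>q. (real q)\<^sup>2)"
    and L_band: "\<And>n. 1 \<le> n \<Longrightarrow> lower_banded m n (L n)"
    and L_bound: "\<exists>C. \<forall>n\<ge>1. \<forall>k<n. \<forall>j<n. \<bar>L n $$ (k, j)\<bar> \<le> C"
    and p_pos: "\<And>n. 1 \<le> n \<Longrightarrow> 1 \<le> p n"
    and p_lim: "(\<lambda>n. real (p n) / real n) \<longlonglongrightarrow> c" and c_pos: "0 < c"
    and prob_N: "prob_space N"
    and Y: "\<And>n. 1 \<le> n \<Longrightarrow> iid_columns (p n) n N (Y n) (M (p n)) (y (p n))"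
    and Z: "\<And>n. 1 \<le> n \<Longrightarrow> iid_columns (p n) n N (Z n) (M (p n)) (z (p n))"
  shows "\<forall>\<zeta>::complex. 0 < Im \<zeta> \<longrightarrow>
    (AE \<omega> in N.
      (\<lambda>n. trace_resolvent ((1 / real n) \<cdot>\<^sub>m (Y n \<omega> * (L n)\<^sup>T * L n * (Y n \<omega>)\<^sup>T)) \<zeta> / of_nat (p n)
         - trace_resolvent ((1 / real n) \<cdot>\<^sub>m (Z n \<omega> * (L n)\<^sup>T * L n * (Z n \<omega>)\<^sup>T)) \<zeta> / of_nat (p n))
      \<longlonglongrightarrow> 0)"
proof (intro allI impI)
  fix \<zeta> :: complex assume z0: "0 < Im \<zeta>"
  have mix: "gaussian_mixture (M q) q (\<Sigma> q) (w q) (z q)" if q: "1 \<le> q" for q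
    by (intro gaussian_mixture.intro gaussian_mixture_axioms.intro prob_M Sigma Sigma_psd Sigma_int w w_indep z q)
  have zm: "z q \<in> measurable (M q) (vec_borel q)" if "1 \<le> q" for q
    by (rule gaussian_mixture.z_meas[OF mix[OF that]])
  define Ey where "Ey q = mat_expectation q (M q) (\<lambda>\<omega>. outer_prod (y q \<omega>))" for q
  define Ez where "Ez q = mat_expectation q (M q) (\<Sigma> q)" for q
  \<comment> \<open>\<open>l\<close> and \<open>t\<close> bound the second moments of
    \<open>y\<close> and of \<open>z\<close> at once, since all summands are nonnegative for q \<ge>
    1; their product is the quantity in (A6).\<close>
  define l where "l q = spectral_norm (Ey q) + spectral_norm (Ez q)" for q
  define t where "t q = mat_trace (Ey q + Ez q)" for q
  have Ec: "Ey q \<in> carrier_mat q q" "Ez q \<in> carrier_mat q q" for q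
    by (simp_all add: Ey_def Ez_def mat_expectation_def)
  have sn: "0 \<le> spectral_norm (Ey q)" "0 \<le> spectral_norm (Ez q)" for q
    using spectral_norm_bound(2)[OF Ec(1) zero_carrier_vec] spectral_norm_bound(2)[OF Ec(2) zero_carrier_vec]
    by auto
  have ty: "0 \<le> mat_trace (Ey q)" if "1 \<le> q" for q
    unfolding Ey_def
  proof (rule mat_trace_expectation_nonneg)
    fix \<omega> i assume "\<omega> \<in> space (M q)" "i < q"
    then show "0 \<le> outer_prod (y q \<omega>) $$ (i, i)"
      using y[OF that] by (auto simp: outer_prod_def measurable_vec_borel_iff Pi_iff)
  qed
  have tz: "0 \<le> mat_trace (Ez q)" if "1 \<le> q" for q
    unfolding Ez_def by (intro mat_trace_expectation_nonneg psd_diag_nonneg[OF Sigma_psd[OF that]])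
  have t_sum: "t q = mat_trace (Ey q) + mat_trace (Ez q)" for q
    using Ec[of q] by (simp add: t_def mat_trace_def sum.distrib)
  have l0: "0 \<le> l q" for q using sn[of q] by (simp add: l_def)
  have t0: "0 \<le> t q" if "1 \<le> q" for q using ty[OF that] tz[OF that] by (simp add: t_sum)
  have smy: "second_moment_le (M q) q (y q) (l q) (t q)" if q: "1 \<le> q" for q
    by (rule second_moment_le_mono[OF second_moment_outer_prod[OF y[OF q] y_int[OF q]]])
      (use sn[of q] ty[OF q] tz[OF q] in \<open>auto simp: l_def t_sum Ey_def\<close>)
  have smz: "second_moment_le (M q) q (z q) (l q) (t q)" if q: "1 \<le> q" for q
    by (rule second_moment_le_mono[OF gaussian_mixture.second_moment_z[OF mix[OF q]]])
      (use sn[of q] ty[OF q] tz[OF q] in \<open>auto simp: l_def t_sum Ez_def\<close>)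
  have lt_small: "eventually (\<lambda>q. l q * t q \<le> \<epsilon> * (real q)\<^sup>2) sequentially" if "0 < \<epsilon>" for \<epsilon>
    using landau_o.smallD[OF A6 that] unfolding l_def t_def Ey_def Ez_def
    by eventually_elim (simp add: abs_le_iff)
  obtain C0 where L_le: "\<And>n k j. 1 \<le> n \<Longrightarrow> k < n \<Longrightarrow> j < n \<Longrightarrow> \<bar>L n $$ (k, j)\<bar> \<le> C0"
    using L_bound by blast
  have Lc: "L n \<in> carrier_mat n n" if "1 \<le> n" for n using L_band[OF that] by (simp add: lower_banded_def)
  define g where "g n k i = L n $$ (k, i) / sqrt (real n)" for n k i
  have g_band: "g n k i = 0" if "1 \<le> n" "k < n" "i < n" "i + m \<le> k \<or> k < i" for n k i
  proof -
    have "L n $$ (k, i) = 0" using L_band[OF that(1)] that(2-4) unfolding lower_banded_def by blast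
    then show ?thesis by (simp add: g_def)
  qed
  have g_bound: "(g n k i)\<^sup>2 \<le> C0\<^sup>2 / real n" if n: "1 \<le> n" "k < n" "i < n" for n k i
  proof -
    have "\<bar>L n $$ (k, i)\<bar>\<^sup>2 \<le> C0\<^sup>2" by (rule power_mono[OF L_le[OF n]]) simp
    then show ?thesis using n(1) by (simp add: g_def power_divide divide_right_mono)
  qed
  define avg where "avg x n = (\<integral>x. gram_trace (p n) n (g n) \<zeta> x
      \<partial>(\<Pi>\<^sub>M j\<in>{..<n}. distr (M (p n)) (vec_borel (p n)) (x (p n)))) / of_nat (p n)"
    for x :: "nat \<Rightarrow> 'a \<Rightarrow> real vec" and n
  have conv: "AE \<omega> in N. (\<lambda>n. gram_trace (p n) n (g n) \<zeta> (\<lambda>j\<in>{..<n}. col (X n \<omega>) j) / of_nat (p n) - avg x n) \<longlonglongrightarrow> 0"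
    if "\<And>q. 1 \<le> q \<Longrightarrow> x q \<in> measurable (M q) (vec_borel q)"
      and "\<And>n. 1 \<le> n \<Longrightarrow> iid_columns (p n) n N (X n) (M (p n)) (x (p n))" for X x
    unfolding avg_def by (rule gram_trace_AE_converges[OF prob_N prob_M that p_pos p_lim c_pos z0])
  \<comment> \<open>Statements about all large dimensions \<open>q\<close> are transferred to all
    large \<open>n\<close> along \<open>p\<close>.\<close>
  have p_inf: "filterlim p at_top sequentially"
  proof -
    have "eventually (\<lambda>n. c / 2 < real (p n) / real n) sequentially"
      using order_tendstoD(1)[OF p_lim, of "c / 2"] c_pos by simp
    with eventually_ge_at_top[of 1]
    have "eventually (\<lambda>n. c / 2 * real n \<le> real (p n)) sequentially"
      by eventually_elim (simp add: field_simps)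
    moreover have "filterlim (\<lambda>n. c / 2 * real n) at_top sequentially"
      using c_pos by (intro filterlim_tendsto_pos_mult_at_top[OF tendsto_const] filterlim_real_sequentially) auto
    ultimately have "filterlim (\<lambda>n. real (p n)) at_top sequentially" by (rule filterlim_at_top_mono[rotated])
    then show ?thesis by (simp add: filterlim_sequentially_iff_filterlim_real)
  qed
  have "(\<lambda>n. avg y n - avg z n) \<longlonglongrightarrow> 0"
  proof (rule tendstoI)
    fix r' :: real assume "0 < r'"
    \<comment> \<open>Halving leaves room for the strict inequality required at the end.\<close>
    define r where "r = r' / 2"
    have r: "0 < r" "r < r'" using \<open>0 < r'\<close> by (auto simp: r_def)
    define K where "K = swap_const \<zeta>"
    define C where "C = resolvent_const \<zeta>"
    define B where "B = sqrt (real m * C0\<^sup>2)"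
    have K: "0 \<le> K" using z0 by (simp add: K_def swap_const_def)
    have C: "0 \<le> C" using z0 by (simp add: C_def resolvent_const_def)
    have B: "0 \<le> B" by (simp add: B_def)
    \<comment> \<open>The error bound \<open>T\<close> has four terms. If each is at most \<rho>
      then T \<le> r c / 2, and n / p < 2 / c brings the normalised error n T / p to at most
      r.\<close>
    define \<rho> where "\<rho> = r * c / 8"
    have \<rho>: "0 < \<rho>" using r c_pos by (simp add: \<rho>_def)
    \<comment> \<open>Once \<open>b\<close> is expressed through n and p / n is bounded by c + 1,
      the last three terms of \<open>T\<close> are at most a1 \<epsilon>, a2 s0 and a3 \<epsilon>2 /
      s0.\<close>
    define a1 where "a1 = 4 * K * real m * C0\<^sup>2 * (c + 1)"
    define a2 where "a2 = 8 * K * B"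
    define a3 where "a3 = 32 * K * C\<^sup>2 * B * real m ^ 3 * C0\<^sup>2 * (c + 1)\<^sup>2"
    have a: "0 \<le> a1" "0 \<le> a2" "0 \<le> a3" using K B c_pos by (auto simp: a1_def a2_def a3_def)
    \<comment> \<open>Makes the bad-event term 4 (2 / Im \<zeta>) \<eta> equal to \<rho>.\<close>
    define \<eta> where "\<eta> = \<rho> * Im \<zeta> / 8"
    define \<epsilon> where "\<epsilon> = \<rho> / (a1 + 1)"
    define s0 where "s0 = \<rho> / (a2 + 1)"
    \<comment> \<open>Depends on s0, because splitting the linear terms leaves a factor 1 / s0 in
      the term controlled by (A6).\<close>
    define \<epsilon>2 where "\<epsilon>2 = \<rho> * s0 / (a3 + 1)"
    have pos: "0 < \<eta>" "0 < \<epsilon>" "0 < s0" using \<rho> z0 a by (auto simp: \<eta>_def \<epsilon>_def s0_def)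
    then have pos2: "0 < \<epsilon>2" using \<rho> a by (auto simp: \<epsilon>2_def)
    have A: "a1 * \<epsilon> \<le> \<rho>" "a2 * s0 \<le> \<rho>" "a3 * (\<epsilon>2 / s0) \<le> \<rho>"
      using mult_div_Suc_le[OF a(1)] mult_div_Suc_le[OF a(2)] mult_div_Suc_le[OF a(3)] \<rho> pos
      by (auto simp: \<epsilon>_def s0_def \<epsilon>2_def)
    have "eventually (\<lambda>q. \<forall>A. bounded_sym q C A \<longrightarrow> measure (M q)
        {\<omega> \<in> space (M q). \<epsilon> * real q < \<bar>qform A (y q \<omega>) - qform A (z q \<omega>)\<bar>} \<le> \<eta>) sequentially"
      by (rule qform_swap_in_prob[OF mix y A1 A2 C pos(2,1)])
    then have e1: "eventually (\<lambda>n. \<forall>A. bounded_sym (p n) C A \<longrightarrow> measure (M (p n))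
        {\<omega> \<in> space (M (p n)). \<epsilon> * real (p n) < \<bar>qform A (y (p n) \<omega>) - qform A (z (p n) \<omega>)\<bar>} \<le> \<eta>) sequentially"
      by (rule eventually_compose_filterlim[OF _ p_inf])
    have e2: "eventually (\<lambda>n. l (p n) * t (p n) \<le> \<epsilon>2 * (real (p n))\<^sup>2) sequentially"
      by (rule eventually_compose_filterlim[OF lt_small[OF pos2] p_inf])
    have e3: "eventually (\<lambda>n. c / 2 < real (p n) / real n) sequentially"
      using order_tendstoD(1)[OF p_lim, of "c / 2"] c_pos by simp
    have e4: "eventually (\<lambda>n. real (p n) / real n < c + 1) sequentially"
      using order_tendstoD(2)[OF p_lim, of "c + 1"] by simp
    from e1 e2 e3 e4 eventually_ge_at_top[of 1]
    show "eventually (\<lambda>n. dist (avg y n - avg z n) 0 < r') sequentially"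
    proof eventually_elim
      case (elim n)
      note n = elim(5) and q = p_pos[OF elim(5)]
      have n0: "0 < real n" and q0: "0 < real (p n)" using n q by auto
      define b where "b = sqrt (real m * (C0\<^sup>2 / real n))"
      \<comment> \<open>The level grows like sqrt n: as b = B / sqrt n, the product b s is the
        constant B s0 while b / s is of order 1 / n.\<close>
      define s where "s = s0 * sqrt (real n)"
      define T where "T = 4 * (2 / Im \<zeta> * \<eta> + K * (b\<^sup>2 * (\<epsilon> * real (p n)) + 2 * b * s))
        + 8 * K * b * l (p n) * C\<^sup>2 / s * (2 * real m * (real m * (C0\<^sup>2 / real n)) * (2 * real m * t (p n)))"
      have s: "0 < s" using pos n0 by (simp add: s_def)
      have main: "cmod ((\<integral>x. gram_trace (p n) n (g n) \<zeta> x \<partial>(\<Pi>\<^sub>M j\<in>{..<n}. distr (M (p n)) (vec_borel (p n)) (y (p n))))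
          - (\<integral>x. gram_trace (p n) n (g n) \<zeta> x \<partial>(\<Pi>\<^sub>M j\<in>{..<n}. distr (M (p n)) (vec_borel (p n)) (z (p n)))))
        \<le> real n * T"
        unfolding T_def K_def C_def
        by (rule expectation_swap[OF prob_M[OF q] z0 smy[OF q] smz[OF q] l0 t0[OF q] _ _ s])
          (use elim(1) pos g_band[OF n] g_bound[OF n] in \<open>auto simp: C_def b_def\<close>)
      have b_eq: "b = B / sqrt (real n)" 
        unfolding b_def B_def times_divide_eq_right real_sqrt_divide ..
      have b2: "b\<^sup>2 = real m * C0\<^sup>2 / real n" by (simp add: b_def)
      have T1: "4 * (2 / Im \<zeta> * \<eta>) = \<rho>" using z0 by (simp add: \<eta>_def)
      have T2: "4 * (K * (b\<^sup>2 * (\<epsilon> * real (p n)))) \<le> \<rho>"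
      proof -
        have "4 * (K * (b\<^sup>2 * (\<epsilon> * real (p n)))) = 4 * K * real m * C0\<^sup>2 * \<epsilon> * (real (p n) / real n)"
          by (simp add: b2)
        also have "\<dots> \<le> 4 * K * real m * C0\<^sup>2 * \<epsilon> * (c + 1)"
          using elim(4) K pos by (intro mult_left_mono) auto
        also have "\<dots> = a1 * \<epsilon>" by (simp add: a1_def)
        finally show ?thesis using A(1) by linarith
      qed
      have T3: "4 * (K * (2 * b * s)) \<le> \<rho>"
      proof -
        have "b * s = B * s0" using n0 by (simp add: b_eq s_def)
        then have "4 * (K * (2 * b * s)) = a2 * s0" by (simp add: a2_def)
        then show ?thesis using A(2) by simp
      qed
      \<comment> \<open>Here (A6) enters: b / s and the coefficient bound C0^2 / n supply one factor
        1 / n each, and l t / n^2 is small because p / n is bounded.\<close>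
      have T4: "8 * K * b * l (p n) * C\<^sup>2 / s * (2 * real m * (real m * (C0\<^sup>2 / real n)) * (2 * real m * t (p n))) \<le> \<rho>"
      proof -
        define D where "D = 32 * K * C\<^sup>2 * B * real m ^ 3 * C0\<^sup>2"
        have D: "0 \<le> D" using K B by (simp add: D_def)
        have bs: "b / s = B / (s0 * real n)"
          using n0 by (simp add: b_eq s_def)
        have "8 * K * b * l (p n) * C\<^sup>2 / s * (2 * real m * (real m * (C0\<^sup>2 / real n)) * (2 * real m * t (p n)))
          = (8 * K * C\<^sup>2 * 4 * real m ^ 3 * C0\<^sup>2) * (b / s) * (l (p n) * t (p n)) / real n"
          by (simp add: power3_eq_cube)
        also have "\<dots> = D / s0 * (l (p n) * t (p n)) / (real n)\<^sup>2"
          unfolding bs D_def by (simp add: power2_eq_square mult_ac)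
        also have "\<dots> \<le> D / s0 * (\<epsilon>2 * (real (p n))\<^sup>2) / (real n)\<^sup>2"
          using D pos elim(2) by (intro divide_right_mono mult_left_mono) auto
        also have "\<dots> = D / s0 * \<epsilon>2 * (real (p n) / real n)\<^sup>2" by (simp add: power_divide)
        also have "\<dots> \<le> D / s0 * \<epsilon>2 * (c + 1)\<^sup>2"
          using D pos pos2 elim(4) by (intro mult_left_mono power_mono) auto
        also have "\<dots> = a3 * (\<epsilon>2 / s0)" by (simp add: a3_def D_def)
        finally show ?thesis using A(3) by linarith
      qed
      have "T \<le> 4 * \<rho>" using T1 T2 T3 T4 unfolding T_def by (simp only: distrib_left)
      then have "real n * T \<le> real n * (r * c / 2)" using n0 by (intro mult_left_mono) (auto simp: \<rho>_def mult.commute)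
      also have "\<dots> \<le> r * real (p n)"
      proof -
        have "c / 2 * real n \<le> real (p n)" using elim(3) n0 by (simp add: field_simps)
        then have "r * (c / 2 * real n) \<le> r * real (p n)" using r by (intro mult_left_mono) auto
        then show ?thesis by (simp add: mult_ac)
      qed
      finally have nT: "real n * T / real (p n) \<le> r" using q0 by (simp add: field_simps)
      have "cmod (avg y n - avg z n) \<le> real n * T / real (p n)"
        unfolding avg_def diff_divide_distrib[symmetric] norm_divide norm_of_nat
        using main q0 by (intro divide_right_mono) auto
      with nT r show ?case by simp
    qed
  qed
  note lim = this
  have "AE \<omega> in N. (\<lambda>n. gram_trace (p n) n (g n) \<zeta> (\<lambda>j\<in>{..<n}. col (Y n \<omega>) j) / of_nat (p n) - avg y n) \<longlonglongrightarrow> 0"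
    by (rule conv; rule y Y; assumption)
  moreover have "AE \<omega> in N. (\<lambda>n. gram_trace (p n) n (g n) \<zeta> (\<lambda>j\<in>{..<n}. col (Z n \<omega>) j) / of_nat (p n) - avg z n) \<longlonglongrightarrow> 0"
    by (rule conv; rule zm Z; assumption)
  ultimately show "AE \<omega> in N.
      (\<lambda>n. trace_resolvent ((1 / real n) \<cdot>\<^sub>m (Y n \<omega> * (L n)\<^sup>T * L n * (Y n \<omega>)\<^sup>T)) \<zeta> / of_nat (p n)
         - trace_resolvent ((1 / real n) \<cdot>\<^sub>m (Z n \<omega> * (L n)\<^sup>T * L n * (Z n \<omega>)\<^sup>T)) \<zeta> / of_nat (p n))
      \<longlonglongrightarrow> 0"
    using AE_space[of N]
  proof eventually_elim
    case (elim \<omega>)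
    have X_eq: "trace_resolvent ((1 / real n) \<cdot>\<^sub>m (X n \<omega> * (L n)\<^sup>T * L n * (X n \<omega>)\<^sup>T)) \<zeta>
        = gram_trace (p n) n (g n) \<zeta> (\<lambda>j\<in>{..<n}. col (X n \<omega>) j)"
      if n: "1 \<le> n" and X: "iid_columns (p n) n N (X n) (M (p n)) (x (p n))" for n X x
    proof -
      have Xc: "X n \<omega> \<in> carrier_mat (p n) n"
        using X elim(3) by (auto simp: iid_columns_def measurable_mat_borel_iff)
      have "g n = (\<lambda>k i. L n $$ (k, i) / sqrt (real n))" by (simp add: g_def fun_eq_iff)
      then show ?thesis unfolding gram_trace_def product_gram[OF Xc Lc[OF n] n] by simp
    qed
    let ?G = "\<lambda>X n. gram_trace (p n) n (g n) \<zeta> (\<lambda>j\<in>{..<n}. col (X n \<omega>) j) / of_nat (p n)"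
    have "(\<lambda>n. ((?G Y n - avg y n) - (?G Z n - avg z n)) + (avg y n - avg z n)) \<longlonglongrightarrow> 0"
      using tendsto_add[OF tendsto_diff[OF elim(1,2)] lim] by simp
    moreover have "eventually (\<lambda>n. ((?G Y n - avg y n) - (?G Z n - avg z n)) + (avg y n - avg z n)
       = trace_resolvent ((1 / real n) \<cdot>\<^sub>m (Y n \<omega> * (L n)\<^sup>T * L n * (Y n \<omega>)\<^sup>T)) \<zeta> / of_nat (p n)
         - trace_resolvent ((1 / real n) \<cdot>\<^sub>m (Z n \<omega> * (L n)\<^sup>T * L n * (Z n \<omega>)\<^sup>T)) \<zeta> / of_nat (p n)) sequentially"
      using eventually_ge_at_top[of 1]
      by eventually_elim (simp add: X_eq[where X = Y and x = y, OF _ Y] X_eq[where X = Z and x = z, OF _ Z])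
    ultimately show ?case by (rule Lim_transform_eventually)
  qed
qed

end
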